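(* Let $K:\mathbb{R}^2\to\mathbb{R}$ be a measurable function satisfying $0<\lambda\le K\le\Lambda$ for constants $\lambda,\Lambda$. Let $u:\mathbb{R}^2\to\mathbb{R}$ be an entire solution of $$\Delta u+K e^{2u}=0$$ which is bounded from above. Then there exists $\epsilon>0$ such that $\int_{B_R}e^{2u}\,dx=O(R^{2-\epsilon})$ as $R\to\infty$ and, for this $\epsilon$, $$\|u\|_{L^\infty(B_R)}=O(R^{2-\epsilon}),\qquad \|Du\|_{L^\infty(B_R)}=O(R^{1-\epsilon^2/2})\quad\text{as }R\to\infty.$$ If, in addition, $[K]_{C^\alpha(\mathbb{R}^2)}<\infty$ for some $\alpha\in(0,1)$, then $$\|D^2u\|_{L^\infty(B_R)}=O(R^\alpha\ln R)\quad\text{as }R\to\infty.$$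
   Context: An entire solution is a solution on all of $\mathbb{R}^2$. $B_R$ denotes the Euclidean disc of radius $R$ centered at the origin in $\mathbb{R}^2$. $[K]_{C^\alpha(\mathbb{R}^2)}=\sup_{x\ne y}|K(x)-K(y)|/|x-y|^\alpha$ is the global Hölder seminorm. *)

theory Defs
  imports
    "HOL-Analysis.Analysis"
    "HOL-Library.Landau_Symbols"
    "HOL-Probability.Essential_Supremum"
begin

definition partial_deriv :: "'n::finite \<Rightarrow> (real^'n \<Rightarrow> real) \<Rightarrow> real^'n \<Rightarrow> real" where
  "partial_deriv i f x = frechet_derivative f (at x) (axis i 1)"

(* All iterated partial derivatives exist and are (Frechet) differentiable, hence continuous. *)
definition smooth :: "(real^'n::finite \<Rightarrow> real) \<Rightarrow> bool" where
  "smooth f \<longleftrightarrow> (\<forall>is x. foldr partial_deriv is f differentiable (at x))"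

definition test_function :: "(real^'n::finite \<Rightarrow> real) \<Rightarrow> bool" where
  "test_function \<phi> \<longleftrightarrow> smooth \<phi> \<and> compact (closure {x. \<phi> x \<noteq> 0})"

definition laplacian :: "(real^'n::finite \<Rightarrow> real) \<Rightarrow> real^'n \<Rightarrow> real" where
  "laplacian f x = (\<Sum>i\<in>UNIV. partial_deriv i (partial_deriv i f) x)"

definition locally_integrable :: "(real^'n::finite \<Rightarrow> real) \<Rightarrow> bool" where
  "locally_integrable f \<longleftrightarrow> (\<forall>S. compact S \<longrightarrow> set_integrable lebesgue S f)"

(* Laplace u + K exp(2u) = 0 on the whole space, in the sense of distributions.  K is only
   measurable, so that u need not be twice differentiable in the classical sense. *)
definition entire_solution :: "(real^'n::finite \<Rightarrow> real) \<Rightarrow> (real^'n \<Rightarrow> real) \<Rightarrow> bool" where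
  "entire_solution K u \<longleftrightarrow>
     locally_integrable u \<and> locally_integrable (\<lambda>x. K x * exp (2 * u x)) \<and>
     (\<forall>\<phi>. test_function \<phi> \<longrightarrow>
        (LINT x|lebesgue. u x * laplacian \<phi> x + K x * exp (2 * u x) * \<phi> x) = 0)"

definition weak_partial :: "'n::finite \<Rightarrow> (real^'n \<Rightarrow> real) \<Rightarrow> (real^'n \<Rightarrow> real) \<Rightarrow> bool" where
  "weak_partial i f g \<longleftrightarrow>
     locally_integrable f \<and> locally_integrable g \<and>
     (\<forall>\<phi>. test_function \<phi> \<longrightarrow>
        (LINT x|lebesgue. f x * partial_deriv i \<phi> x) = - (LINT x|lebesgue. g x * \<phi> x))"

definition weak_gradient :: "(real^'n::finite \<Rightarrow> real) \<Rightarrow> (real^'n \<Rightarrow> real^'n) \<Rightarrow> bool" where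
  "weak_gradient f Df \<longleftrightarrow> (\<forall>i. weak_partial i f (\<lambda>x. Df x $ i))"

definition weak_hessian :: "(real^'n::finite \<Rightarrow> real) \<Rightarrow> (real^'n \<Rightarrow> real^'n^'n) \<Rightarrow> bool" where
  "weak_hessian f D2f \<longleftrightarrow>
     (\<exists>Df. weak_gradient f Df \<and> (\<forall>i. weak_gradient (\<lambda>x. Df x $ i) (\<lambda>x. D2f x $ i)))"

(* On matrices, norm is the Euclidean (Frobenius) norm. *)
definition Linf_norm :: "'a::euclidean_space set \<Rightarrow> ('a \<Rightarrow> 'b::real_normed_vector) \<Rightarrow> ereal" where
  "Linf_norm S f = esssup (restrict_space lebesgue S) (\<lambda>x. ereal (norm (f x)))"

(* The norm of f in L^infty(B_R) is O(g R) as R tends to infinity; since the norm is an extended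
   real, this includes its finiteness. *)
definition Linf_ball_bigo :: "('a::euclidean_space \<Rightarrow> 'b::real_normed_vector) \<Rightarrow> (real \<Rightarrow> real) \<Rightarrow> bool" where
  "Linf_ball_bigo f g \<longleftrightarrow> (\<exists>C. \<forall>\<^sub>F R in at_top. Linf_norm (ball 0 R) f \<le> ereal (C * g R))"

definition holder_seminorm :: "real \<Rightarrow> ('a::metric_space \<Rightarrow> real) \<Rightarrow> ereal" where
  "holder_seminorm \<alpha> f =
     (SUP (x, y) \<in> {(x, y). x \<noteq> y}. ereal (\<bar>f x - f y\<bar> / dist x y powr \<alpha>))"

end

theory Submission
  imports Defs
begin

text \<open>
  If \<open>u \<le> U\<close>, then \<open>w = U - u\<close> is nonnegative and satisfies \<open>\<Delta>w = f\<close> with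
  \<open>f = K exp (2 u)\<close> and \<open>0 \<le> f \<le> M exp (- 2 w)\<close>. Everything is read off averages of \<open>w\<close> over dyadic
  scales. There are a compactly supported mollifier and a nonpositive test function \<open>green\<close> with
  \<open>\<Delta> green = mollifier - mollifier (\<sqdot>/2) / 4\<close> (lemma \<open>laplacian_green\<close>); testing the equation with
  rescaled copies of \<open>green\<close> shows that the averages of \<open>w\<close> at the scales \<open>s\<close> and \<open>2 s\<close> differ by a
  weighted integral of \<open>f\<close> over a ball of radius \<open>2 s\<close> (lemma \<open>mean_doubling\<close>). Hence a bound for the
  mass of \<open>f\<close> in balls turns into bounds for \<open>w\<close> and its gradient by summing geometric series
  (\<open>mean_telescope\<close>, \<open>partial_deriv_mean_telescope\<close>), where the first term is controlled by
  a Harnack-type comparison of averages of nonnegative functions (\<open>mean_Harnack\<close>).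

  The core is the lemma \<open>mass_decay\<close>: for some \<open>\<epsilon> > 0\<close> every ball of radius \<open>\<rho>\<close> has mass
  \<open>O(\<rho>\<^sup>2 \<rho>\<^sup>-\<^sup>\<epsilon>)\<close>, uniformly in the centre. Suppose that this is known for radii up to \<open>r0\<close>, so
  that \<open>f\<close> has mean density at most of the order of \<open>D0 = B r0\<^sup>-\<^sup>\<epsilon>\<close> at scale \<open>r0\<close>. Averaging at a
  scale comparable with \<open>r0\<close> yields a smooth \<open>v \<ge> 0\<close> with \<open>0 \<le> \<Delta>v \<le> D\<close>, where \<open>D\<close> is a multiple of
  \<open>D0\<close>. Two observations are combined.

  \<^item> Where \<open>v\<close> exceeds a suitable multiple \<open>L\<close> of \<open>D0 r0\<^sup>2\<close>, also \<open>w\<close> is large nearby, and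
    \<open>f \<le> M exp (- 2 w)\<close> makes \<open>\<Delta>v\<close> tiny.
  \<^item> On \<open>{v \<le> L}\<close> a concave power \<open>\<Gamma>(v)\<close>, of order \<open>(1 + v/L)\<close> to the power \<open>1 - p\<close>, is used as a test.
    Nonnegativity of \<open>v\<close> and boundedness of \<open>\<Delta>v\<close> imply \<open>\<bar>\<nabla>v\<bar>\<^sup>2 \<le> C D (v + L)\<close>
    (\<open>gradient_square_estimate\<close>), so the error made by concavity is small,
    \<open>\<bar>\<Gamma>''(v)\<bar> \<bar>\<nabla>v\<bar>\<^sup>2 \<le> C p D\<close>, whereas \<open>\<Gamma>'(v) \<ge> 1/2\<close>. Thus \<open>\<Delta>v\<close> is dominated by
    \<open>2 \<Delta>\<Gamma>(v) + C p D\<close>. But \<open>v\<close> grows at most like \<open>D R\<^sup>2\<close>, so \<open>\<Gamma>(v)\<close> grows strictly slower and the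
    mean of \<open>\<Delta>\<Gamma>(v)\<close> over a ball of radius \<open>R\<close> is small compared with \<open>D\<close> (\<open>low_set_mass\<close>).

  Altogether the mean density at scale \<open>R\<close> is at most a constant times \<open>D0\<close> times \<open>p\<close> plus
  \<open>r0 / R\<close> to the power \<open>2 p\<close> (\<open>scale_step\<close>). Choosing \<open>p\<close> small and then \<open>R / r0\<close> large, the
  density is halved whenever the scale grows by a fixed factor; iterating gives the power \<open>\<epsilon>\<close>.

  The mass bound yields \<open>w = O(R\<^sup>2 R\<^sup>-\<^sup>\<epsilon>)\<close> and \<open>\<nabla>w = O(R R\<^sup>-\<^sup>\<epsilon>)\<close>, and \<open>1 - \<epsilon> \<le> 1 - \<epsilon>\<^sup>2/2\<close>. For the second
  derivatives no power is left in the series: at each dyadic scale the contribution is bounded by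
  the oscillation of \<open>f\<close> there, because the second derivatives of \<open>green\<close> have integral zero. On a
  ball of radius \<open>R\<close> the function \<open>exp (2 u)\<close> has Lipschitz constant \<open>O(R)\<close>, so below
  scale \<open>1/R\<close> Hoelder continuity of \<open>K\<close> makes the series geometric. The scales between \<open>R\<close> and
  \<open>1/R\<close> are \<open>O(ln R)\<close> in number and contribute \<open>O(ln R)\<close>, which is better than required.
\<close>

section \<open>Smooth functions\<close>

lemma partial_deriv_eq:
  "(f has_derivative f') (at x) \<Longrightarrow> partial_deriv i f x = f' (axis i 1)"
  by (simp add: partial_deriv_def frechet_derivative_at[symmetric])

lemma has_derivative_partials:
  fixes f :: "real^'n::finite \<Rightarrow> real"
  assumes "f differentiable (at x)"
  shows "(f has_derivative (\<lambda>h. \<Sum>i\<in>UNIV. h $ i * partial_deriv i f x)) (at x)"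
proof -
  have d: "(f has_derivative frechet_derivative f (at x)) (at x)"
    using assms frechet_derivative_works by blast
  have lin: "linear (frechet_derivative f (at x))"
    using assms by (rule linear_frechet_derivative)
  have "frechet_derivative f (at x) h = (\<Sum>i\<in>UNIV. h $ i * partial_deriv i f x)" for h
  proof -
    have "frechet_derivative f (at x) h = frechet_derivative f (at x) (\<Sum>i\<in>UNIV. h $ i *\<^sub>R axis i 1)"
      by (metis (no_types, lifting) basis_expansion scalar_mult_eq_scaleR sum.cong)
    also have "\<dots> = (\<Sum>i\<in>UNIV. h $ i * partial_deriv i f x)"
      by (simp add: linear_sum[OF lin] linear_cmul[OF lin] partial_deriv_def)
    finally show ?thesis .
  qed
  then show ?thesis using d by (metis (no_types, lifting) ext)
qed

lemma smooth_differentiable: "smooth f \<Longrightarrow> f differentiable (at x)"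
  unfolding smooth_def by (metis foldr_Nil id_apply)

lemma smooth_partial_deriv: "smooth f \<Longrightarrow> smooth (partial_deriv i f)"
  unfolding smooth_def
proof (intro allI)
  fix "is" x
  assume "\<forall>is x. foldr partial_deriv is f differentiable (at x)"
  then have "foldr partial_deriv (is @ [i]) f differentiable (at x)" by blast
  then show "foldr partial_deriv is (partial_deriv i f) differentiable (at x)" by simp
qed

text \<open>Smoothness is the greatest property implying differentiability and inherited by partial
  derivatives, so a function is smooth as soon as it lies in some class with these two features.\<close>
lemma smooth_coinduct:
  assumes "S f"
    and step: "\<And>g. S g \<Longrightarrow> (\<forall>x. g differentiable (at x)) \<and> (\<forall>i. S (partial_deriv i g))"
  shows "smooth f"
proof -
  have "S (foldr partial_deriv is f)" for "is"
    by (induction "is") (use assms in auto)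
  then show ?thesis using step unfolding smooth_def by blast
qed

lemma smooth_continuous_on: "smooth f \<Longrightarrow> continuous_on A f"
  by (meson smooth_differentiable differentiable_imp_continuous_within
      continuous_at_imp_continuous_on)

lemma isCont_smooth: "smooth f \<Longrightarrow> isCont f x"
  by (rule differentiable_imp_continuous_within) (rule smooth_differentiable)

lemma partial_deriv_add:
  "f differentiable (at x) \<Longrightarrow> g differentiable (at x) \<Longrightarrow>
    partial_deriv i (\<lambda>x. f x + g x) x = partial_deriv i f x + partial_deriv i g x"
  by (subst partial_deriv_eq[OF has_derivative_add])
     (auto simp: frechet_derivative_works partial_deriv_def)

lemma partial_deriv_mult:
  "f differentiable (at x) \<Longrightarrow> g differentiable (at x) \<Longrightarrow>
    partial_deriv i (\<lambda>x. f x * g x) x = f x * partial_deriv i g x + partial_deriv i f x * g x"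
  by (subst partial_deriv_eq[OF has_derivative_mult])
     (auto simp: frechet_derivative_works partial_deriv_def)

lemma has_derivative_compose_real:
  fixes h :: "real \<Rightarrow> real" and f :: "real^'n::finite \<Rightarrow> real"
  assumes "f differentiable (at x)" "(h has_real_derivative h') (at (f x))"
  shows "((\<lambda>x. h (f x)) has_derivative (\<lambda>v. h' * frechet_derivative f (at x) v)) (at x)"
  using assms(1)[unfolded frechet_derivative_works] assms(2)
  by (auto simp: has_field_derivative_def o_def dest: diff_chain_at)

lemma partial_deriv_compose:
  "f differentiable (at x) \<Longrightarrow> (h has_real_derivative h') (at (f x)) \<Longrightarrow>
    partial_deriv i (\<lambda>x. h (f x)) x = h' * partial_deriv i f x"
  by (subst partial_deriv_eq[OF has_derivative_compose_real]) (auto simp: partial_deriv_def)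

lemma partial_deriv_const: "partial_deriv i (\<lambda>x. c) = (\<lambda>x. 0)"
  by (simp add: partial_deriv_def fun_eq_iff)

lemma smooth_const: "smooth (\<lambda>x. c)"
  by (rule smooth_coinduct[where S = "\<lambda>f. \<exists>c. f = (\<lambda>x. c)"])
     (auto simp: partial_deriv_const)

lemma partial_deriv_nth: "partial_deriv i (\<lambda>x::real^'n::finite. x $ j) x = (if i = j then 1 else 0)"
proof -
  have "((\<lambda>x::real^'n. x $ j) has_derivative (\<lambda>h. h $ j)) (at x)"
    by (rule bounded_linear_imp_has_derivative) (rule bounded_linear_vec_nth)
  from partial_deriv_eq[OF this, of i] show ?thesis by (simp add: axis_def)
qed

lemma differentiable_nth: "(\<lambda>x::real^'n::finite. x $ j) differentiable (at x)"
  by (rule differentiableI, rule bounded_linear_imp_has_derivative) (rule bounded_linear_vec_nth)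

lemma smooth_nth: "smooth (\<lambda>x::real^'n::finite. x $ j)"
proof (rule smooth_coinduct[where S = "\<lambda>f. (\<exists>c. f = (\<lambda>x. c)) \<or> f = (\<lambda>x. x $ j)"])
  have "partial_deriv i (\<lambda>x::real^'n. x $ j) = (\<lambda>x. if i = j then 1 else 0)" for i
    by (simp add: fun_eq_iff partial_deriv_nth)
  then show "(\<forall>x. g differentiable (at x)) \<and>
     (\<forall>i. (\<exists>c. partial_deriv i g = (\<lambda>x. c)) \<or> partial_deriv i g = (\<lambda>x. x $ j))"
    if "(\<exists>c. g = (\<lambda>x::real^'n. c)) \<or> g = (\<lambda>x. x $ j)" for g
    using that by (auto simp: partial_deriv_const differentiable_nth)
qed auto

text \<open>The class used as witness for the closure properties of \<open>smooth\<close>: by the product and chain rules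
  a partial derivative of a member is again built from smooth functions by the same operations. The
  outer function of a composition comes with all its derivatives \<open>d n\<close>, which are required only on
  the range of the inner function; this admits real powers of positive functions.\<close>
inductive smooth_closure :: "(real^'n::finite \<Rightarrow> real) \<Rightarrow> bool" where
  base: "smooth f \<Longrightarrow> smooth_closure f"
| add: "smooth_closure f \<Longrightarrow> smooth_closure g \<Longrightarrow> smooth_closure (\<lambda>x. f x + g x)"
| mult: "smooth_closure f \<Longrightarrow> smooth_closure g \<Longrightarrow> smooth_closure (\<lambda>x. f x * g x)"
| compose: "smooth_closure f \<Longrightarrow>
    (\<And>n x. (d n has_real_derivative d (Suc n) (f x)) (at (f x))) \<Longrightarrow> smooth_closure (\<lambda>x. d (0::nat) (f x))"

lemma smooth_closure_imp_smooth: "smooth_closure f \<Longrightarrow> smooth f"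
proof (erule smooth_coinduct)
  fix g :: "real^'n \<Rightarrow> real" assume "smooth_closure g"
  then show "(\<forall>x. g differentiable (at x)) \<and> (\<forall>i. smooth_closure (partial_deriv i g))"
  proof induction
    case (base f)
    then show ?case
      by (intro conjI allI smooth_differentiable smooth_closure.base smooth_partial_deriv)
  next
    case (add f g)
    then have "partial_deriv i (\<lambda>x. f x + g x) = (\<lambda>x. partial_deriv i f x + partial_deriv i g x)" for i
      by (simp add: fun_eq_iff partial_deriv_add)
    with add show ?case by (simp add: smooth_closure.add)
  next
    case (mult f g)
    then have "partial_deriv i (\<lambda>x. f x * g x) =
        (\<lambda>x. f x * partial_deriv i g x + partial_deriv i f x * g x)" for i
      by (simp add: fun_eq_iff partial_deriv_mult)
    with mult show ?case by (simp add: smooth_closure.add smooth_closure.mult)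
  next
    case (compose f d)
    have "partial_deriv i (\<lambda>x. d 0 (f x)) x = d (Suc 0) (f x) * partial_deriv i f x" for i x
      by (rule partial_deriv_compose) (use compose in simp_all)
    then have "partial_deriv i (\<lambda>x. d 0 (f x)) = (\<lambda>x. d (Suc 0) (f x) * partial_deriv i f x)" for i
      by (simp add: fun_eq_iff)
    moreover have "smooth_closure (\<lambda>x. d (Suc 0) (f x))"
      by (rule smooth_closure.compose[of f "\<lambda>n. d (Suc n)"]) (use compose in simp_all)
    moreover have "(\<lambda>x. d 0 (f x)) differentiable (at x)" for x
      by (rule differentiableI, rule has_derivative_compose_real[of f x "d 0"]) (use compose in auto)
    ultimately show ?case using compose by (simp add: smooth_closure.mult)
  qed
qed

lemma smooth_add: "smooth f \<Longrightarrow> smooth g \<Longrightarrow> smooth (\<lambda>x. f x + g x)"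
  by (rule smooth_closure_imp_smooth, rule smooth_closure.add) (auto intro: smooth_closure.base)

lemma smooth_mult: "smooth f \<Longrightarrow> smooth g \<Longrightarrow> smooth (\<lambda>x. f x * g x)"
  by (rule smooth_closure_imp_smooth, rule smooth_closure.mult) (auto intro: smooth_closure.base)

lemma smooth_compose:
  assumes "smooth f" "\<And>n x. (d n has_real_derivative d (Suc n) (f x)) (at (f x))"
  shows "smooth (\<lambda>x. d (0::nat) (f x))"
  by (rule smooth_closure_imp_smooth, rule smooth_closure.compose, rule smooth_closure.base) fact+

lemma smooth_sum: "finite I \<Longrightarrow> (\<And>i. i \<in> I \<Longrightarrow> smooth (f i)) \<Longrightarrow> smooth (\<lambda>x. \<Sum>i\<in>I. f i x)"
  by (induction rule: finite_induct) (auto simp: smooth_const intro!: smooth_add)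

lemma smooth_laplacian: "smooth f \<Longrightarrow> smooth (laplacian f)"
  unfolding laplacian_def[abs_def] by (intro smooth_sum smooth_partial_deriv) simp_all

lemma partial_deriv_affine:
  fixes f :: "real^'n::finite \<Rightarrow> real"
  assumes "\<And>x. f differentiable (at x)"
  shows "partial_deriv i (\<lambda>x. f (a + c *\<^sub>R x)) x = c * partial_deriv i f (a + c *\<^sub>R x)"
    and "(\<lambda>x. f (a + c *\<^sub>R x)) differentiable (at x)"
proof -
  have d: "((\<lambda>x. a + c *\<^sub>R x) has_derivative (\<lambda>h. c *\<^sub>R h)) (at x)"
    by (auto intro!: derivative_eq_intros)
  have "(f has_derivative frechet_derivative f (at (a + c *\<^sub>R x))) (at (a + c *\<^sub>R x))"
    using assms frechet_derivative_works by blast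
  from diff_chain_at[OF d this]
  have D: "((\<lambda>x. f (a + c *\<^sub>R x)) has_derivative (\<lambda>h. frechet_derivative f (at (a + c *\<^sub>R x)) (c *\<^sub>R h))) (at x)"
    by (simp add: o_def)
  show "partial_deriv i (\<lambda>x. f (a + c *\<^sub>R x)) x = c * partial_deriv i f (a + c *\<^sub>R x)"
    unfolding partial_deriv_eq[OF D]
    by (simp add: partial_deriv_def linear_cmul[OF linear_frechet_derivative[OF assms]])
  show "(\<lambda>x. f (a + c *\<^sub>R x)) differentiable (at x)" using D by (rule differentiableI)
qed

lemma smooth_affine:
  fixes f :: "real^'n::finite \<Rightarrow> real"
  assumes "smooth f" shows "smooth (\<lambda>x. f (a + c *\<^sub>R x))"
proof (rule smooth_coinduct[where S = "\<lambda>g. \<exists>f b. smooth f \<and> g = (\<lambda>x. b * f (a + c *\<^sub>R x))"])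
  show "\<exists>g b. smooth g \<and> (\<lambda>x. f (a + c *\<^sub>R x)) = (\<lambda>x. b * g (a + c *\<^sub>R x))"
    using assms by (intro exI[of _ f] exI[of _ 1]) auto
next
  fix g :: "real^'n \<Rightarrow> real" assume "\<exists>f b. smooth f \<and> g = (\<lambda>x. b * f (a + c *\<^sub>R x))"
  then obtain f b where f: "smooth f" and g: "g = (\<lambda>x. b * f (a + c *\<^sub>R x))" by blast
  note d = partial_deriv_affine[OF smooth_differentiable[OF f]]
  have "partial_deriv i g = (\<lambda>x. (b * c) * partial_deriv i f (a + c *\<^sub>R x))" for i
    by (simp add: g fun_eq_iff partial_deriv_mult d partial_deriv_const)
  moreover have "g differentiable (at x)" for x
    unfolding g by (intro differentiable_mult d) auto
  ultimately show "(\<forall>x. g differentiable (at x)) \<and>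
      (\<forall>i. \<exists>f b. smooth f \<and> partial_deriv i g = (\<lambda>x. b * f (a + c *\<^sub>R x)))"
    using smooth_partial_deriv[OF f] by blast
qed

lemma laplacian_affine:
  assumes "smooth f"
  shows "laplacian (\<lambda>x. f (a + c *\<^sub>R x)) x = c\<^sup>2 * laplacian f (a + c *\<^sub>R x)"
proof -
  note d = partial_deriv_affine[OF smooth_differentiable[OF assms]]
  have "partial_deriv i (partial_deriv i (\<lambda>x. f (a + c *\<^sub>R x))) x = c\<^sup>2 * partial_deriv i (partial_deriv i f) (a + c *\<^sub>R x)" for i
  proof -
    have "partial_deriv i (\<lambda>x. f (a + c *\<^sub>R x)) = (\<lambda>x. c * partial_deriv i f (a + c *\<^sub>R x))"
      by (simp add: fun_eq_iff d)
    then show ?thesis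
      using partial_deriv_affine[OF smooth_differentiable[OF smooth_partial_deriv[OF assms]]]
      by (simp add: partial_deriv_mult partial_deriv_const power2_eq_square)
  qed
  then show ?thesis by (simp add: laplacian_def sum_distrib_left)
qed

lemma laplacian_compose:
  fixes f :: "real^'n::finite \<Rightarrow> real"
  assumes f: "smooth f"
    and h: "\<And>x. (h has_real_derivative h' (f x)) (at (f x))"
    and h': "\<And>x. (h' has_real_derivative h'' (f x)) (at (f x))"
  shows "laplacian (\<lambda>x. h (f x)) x =
    h' (f x) * laplacian f x + h'' (f x) * (\<Sum>i\<in>UNIV. (partial_deriv i f x)\<^sup>2)"
proof -
  note fd = smooth_differentiable[OF f]
  have 1: "partial_deriv i (\<lambda>x. h (f x)) = (\<lambda>x. h' (f x) * partial_deriv i f x)" for i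
    using partial_deriv_compose[OF fd h] by (simp add: fun_eq_iff)
  have d': "(\<lambda>x. h' (f x)) differentiable (at x)" for x
    using has_derivative_compose_real[OF fd h'] by (rule differentiableI)
  have "partial_deriv i (partial_deriv i (\<lambda>x. h (f x))) x =
     h' (f x) * partial_deriv i (partial_deriv i f) x + h'' (f x) * (partial_deriv i f x)\<^sup>2" for i
    unfolding 1 using partial_deriv_compose[OF fd h']
    by (simp add: partial_deriv_mult d' smooth_differentiable smooth_partial_deriv f power2_eq_square)
  then show ?thesis by (simp add: laplacian_def sum.distrib sum_distrib_left)
qed

section \<open>Test functions\<close>

lemma smooth_cmult: "smooth f \<Longrightarrow> smooth (\<lambda>x. c * f x)"
  by (rule smooth_mult[OF smooth_const])

lemma partial_deriv_cmult: "f differentiable (at x) \<Longrightarrow> partial_deriv i (\<lambda>x. c * f x) x = c * partial_deriv i f x"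
  by (simp add: partial_deriv_mult partial_deriv_const)

lemma test_function_iff:
  "test_function \<phi> \<longleftrightarrow> smooth \<phi> \<and> (\<exists>r. \<forall>x. r \<le> norm x \<longrightarrow> \<phi> x = 0)"
proof -
  have "compact (closure {x. \<phi> x \<noteq> 0}) \<longleftrightarrow> (\<exists>r. \<forall>x. r \<le> norm x \<longrightarrow> \<phi> x = 0)"
  proof -
    have "bounded {x. \<phi> x \<noteq> 0} \<longleftrightarrow> (\<exists>r. \<forall>x. r \<le> norm x \<longrightarrow> \<phi> x = 0)"
    proof
      assume "bounded {x. \<phi> x \<noteq> 0}"
      then obtain b where "\<forall>x\<in>{x. \<phi> x \<noteq> 0}. norm x \<le> b" unfolding bounded_iff by blast
      then have "\<forall>x. b + 1 \<le> norm x \<longrightarrow> \<phi> x = 0" by force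
      then show "\<exists>r. \<forall>x. r \<le> norm x \<longrightarrow> \<phi> x = 0" by blast
    next
      assume "\<exists>r. \<forall>x. r \<le> norm x \<longrightarrow> \<phi> x = 0"
      then obtain r where "\<forall>x. r \<le> norm x \<longrightarrow> \<phi> x = 0" by blast
      then have "\<forall>x\<in>{x. \<phi> x \<noteq> 0}. norm x \<le> r" by force
      then show "bounded {x. \<phi> x \<noteq> 0}" unfolding bounded_iff by blast
    qed
    then show ?thesis by simp
  qed
  then show ?thesis unfolding test_function_def by simp
qed

lemma test_function_smooth: "test_function \<phi> \<Longrightarrow> smooth \<phi>"
  by (simp add: test_function_def)

lemma test_function_mult: "smooth a \<Longrightarrow> test_function \<phi> \<Longrightarrow> test_function (\<lambda>x. a x * \<phi> x)"
  unfolding test_function_iff using smooth_mult by fastforce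

lemma partial_deriv_eq_0_outside:
  assumes "\<And>x. r \<le> norm x \<Longrightarrow> \<phi> x = 0" "r < norm x"
  shows "partial_deriv i \<phi> x = 0"
proof -
  have "open {x::real^'n. r < norm x}" by (intro open_Collect_less continuous_intros)
  then have "(\<phi> has_derivative (\<lambda>h. 0)) (at x)"
    using assms by (intro has_derivative_transform_within_open[OF has_derivative_const[of 0]]) auto
  then show ?thesis by (simp add: partial_deriv_eq)
qed

lemma test_function_partial_deriv:
  assumes "test_function \<phi>" shows "test_function (partial_deriv i \<phi>)"
proof -
  obtain r where r: "\<And>x. r \<le> norm x \<Longrightarrow> \<phi> x = 0" using assms unfolding test_function_iff by blast
  have "partial_deriv i \<phi> x = 0" if "r + 1 \<le> norm x" for x
    using partial_deriv_eq_0_outside[of r \<phi> x] r that by simp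
  then show ?thesis
    using smooth_partial_deriv[OF test_function_smooth[OF assms]] unfolding test_function_iff by blast
qed

lemma test_function_add:
  assumes "test_function f" "test_function g"
  shows "test_function (\<lambda>x. f x + g x)"
proof -
  obtain r1 where 1: "\<And>x. r1 \<le> norm x \<Longrightarrow> f x = 0" using assms(1) unfolding test_function_iff by blast
  obtain r2 where 2: "\<And>x. r2 \<le> norm x \<Longrightarrow> g x = 0" using assms(2) unfolding test_function_iff by blast
  have "\<forall>x. max r1 r2 \<le> norm x \<longrightarrow> f x + g x = 0" using 1 2 by simp
  moreover have "smooth (\<lambda>x. f x + g x)"
    using assms by (intro smooth_add test_function_smooth)
  ultimately show ?thesis unfolding test_function_iff by blast
qed

lemma test_function_sum:
  assumes "finite I" "\<And>i. i \<in> I \<Longrightarrow> test_function (f i)"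
  shows "test_function (\<lambda>x. \<Sum>i\<in>I. f i x)"
  using assms
proof (induction rule: finite_induct)
  case empty
  have "smooth (\<lambda>x. 0)" by (rule smooth_const)
  then show ?case unfolding test_function_iff by simp
next
  case (insert i I)
  have "test_function (\<lambda>x. f i x + (\<Sum>i\<in>I. f i x))"
    by (intro test_function_add insert.IH insert.prems) auto
  then show ?case using insert.hyps by simp
qed

lemma test_function_laplacian: "test_function \<phi> \<Longrightarrow> test_function (laplacian \<phi>)"
  unfolding laplacian_def[abs_def] by (intro test_function_sum test_function_partial_deriv) simp_all

lemma test_function_affine:
  assumes "test_function \<phi>" "c \<noteq> 0" shows "test_function (\<lambda>x. \<phi> (a + c *\<^sub>R x))"
proof -
  obtain r where r: "\<And>x. r \<le> norm x \<Longrightarrow> \<phi> x = 0" using assms(1) unfolding test_function_iff by blast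
  have "\<phi> (a + c *\<^sub>R x) = 0" if "(r + norm a) / \<bar>c\<bar> \<le> norm x" for x
  proof (rule r)
    have "r + norm a \<le> norm (c *\<^sub>R x)" using that assms(2) by (simp add: field_simps)
    then show "r \<le> norm (a + c *\<^sub>R x)" using norm_diff_ineq[of "c *\<^sub>R x" a] by (simp add: add.commute)
  qed
  then show ?thesis using assms(1) smooth_affine unfolding test_function_iff by blast
qed

lemma test_function_bounded:
  assumes "test_function \<phi>" obtains C where "C > 0" "\<And>x. \<bar>\<phi> x\<bar> \<le> C"
proof -
  obtain r where r: "\<And>x. r \<le> norm x \<Longrightarrow> \<phi> x = 0" and s: "smooth \<phi>"
    using assms unfolding test_function_iff by blast
  have "compact (\<phi> ` cball 0 r)"
    by (intro compact_continuous_image smooth_continuous_on s compact_cball)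
  then obtain C where C: "\<And>x. x \<in> cball 0 r \<Longrightarrow> \<bar>\<phi> x\<bar> \<le> C"
    using compact_imp_bounded[of "\<phi> ` cball 0 r"] unfolding bounded_iff real_norm_def by blast
  show ?thesis
  proof (rule that[of "max C 1"])
    show "\<bar>\<phi> x\<bar> \<le> max C 1" for x using C[of x] r[of x] by (cases "norm x \<le> r") auto
  qed simp
qed

text \<open>Turns bounds for each of the finitely many derivatives of a given order into a single one.\<close>
lemma finite_family_bounded:
  fixes g :: "'i \<Rightarrow> 'a \<Rightarrow> real"
  assumes "finite I" "\<And>i. i \<in> I \<Longrightarrow> \<exists>C. \<forall>x. \<bar>g i x\<bar> \<le> C"
  shows "\<exists>C. \<forall>i\<in>I. \<forall>x. \<bar>g i x\<bar> \<le> C"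
  using assms
proof (induction rule: finite_induct)
  case (insert i I)
  obtain C1 where "\<forall>x. \<bar>g i x\<bar> \<le> C1" using insert.prems[of i] by auto
  moreover obtain C2 where "\<forall>i\<in>I. \<forall>x. \<bar>g i x\<bar> \<le> C2" using insert.IH insert.prems by auto
  ultimately have "\<forall>i\<in>insert i I. \<forall>x. \<bar>g i x\<bar> \<le> max C1 C2" by (simp add: le_max_iff_disj)
  then show ?case by blast
qed simp

lemma test_function_bounded_ex: "test_function \<phi> \<Longrightarrow> \<exists>C. \<forall>x. \<bar>\<phi> x\<bar> \<le> C"
  using test_function_bounded[of \<phi>] by blast

lemma test_function_C2_bounded:
  fixes \<kappa> :: "real^'n::finite \<Rightarrow> real"
  assumes "test_function \<kappa>"
  shows "\<exists>C. \<forall>x i j. \<bar>\<kappa> x\<bar> \<le> C \<and> \<bar>partial_deriv i \<kappa> x\<bar> \<le> C \<and> \<bar>partial_deriv j (partial_deriv i \<kappa>) x\<bar> \<le> C"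
proof -
  obtain C0 where 0: "\<forall>x. \<bar>\<kappa> x\<bar> \<le> C0" using test_function_bounded_ex[OF assms] by blast
  obtain C1 where 1: "\<forall>i\<in>UNIV. \<forall>x. \<bar>partial_deriv i \<kappa> x\<bar> \<le> C1"
    using finite_family_bounded[of UNIV "\<lambda>i. partial_deriv i \<kappa>"]
      test_function_bounded_ex[OF test_function_partial_deriv[OF assms]] by auto
  obtain C2 where 2: "\<forall>p\<in>UNIV. \<forall>x. \<bar>partial_deriv (fst p) (partial_deriv (snd p) \<kappa>) x\<bar> \<le> C2"
    using finite_family_bounded[of UNIV "\<lambda>p. partial_deriv (fst p) (partial_deriv (snd p) \<kappa>)"]
      test_function_bounded_ex[OF test_function_partial_deriv[OF test_function_partial_deriv[OF assms]]] by auto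
  have "\<bar>\<kappa> x\<bar> \<le> max C0 (max C1 C2) \<and> \<bar>partial_deriv i \<kappa> x\<bar> \<le> max C0 (max C1 C2)
      \<and> \<bar>partial_deriv j (partial_deriv i \<kappa>) x\<bar> \<le> max C0 (max C1 C2)" for x i j
    using 0[rule_format, of x] 1[rule_format, of i x] 2[rule_format, of "(j, i)" x] by (auto simp: le_max_iff_disj)
  then show ?thesis by blast
qed

section \<open>Locally integrable functions\<close>

lemma borel_lebesgue: "f \<in> borel_measurable borel \<Longrightarrow> f \<in> borel_measurable lebesgue"
  by (intro measurable_completion) simp

lemma smooth_borel: "smooth f \<Longrightarrow> f \<in> borel_measurable borel"
  by (rule borel_measurable_continuous_onI) (rule smooth_continuous_on)

lemma integral_lebesgue_affine:
  fixes f :: "real^'n::finite \<Rightarrow> real"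
  assumes "f \<in> borel_measurable borel" "c \<noteq> 0"
  shows "(LINT x|lebesgue. f x) = \<bar>c\<bar> ^ CARD('n) * (LINT x|lebesgue. f (a + c *\<^sub>R x))"
proof -
  have [measurable]: "f \<in> borel_measurable borel" by fact
  have "(LINT x|lborel. f x) = (LINT x|density (distr lborel borel (\<lambda>x. a + c *\<^sub>R x)) (\<lambda>_. ennreal (\<bar>c\<bar> ^ CARD('n))). f x)"
    using lborel_affine[OF assms(2), of a] by (simp add: ennreal_power)
  also have "\<dots> = \<bar>c\<bar> ^ CARD('n) * (LINT x|lborel. f (a + c *\<^sub>R x))"
    by (subst integral_density) (auto simp: integral_distr)
  finally show ?thesis by (simp add: integral_completion)
qed

lemma locally_integrable_measurable:
  assumes "locally_integrable h" shows "h \<in> borel_measurable lebesgue"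
proof (rule borel_measurable_LIMSEQ_real)
  show "(\<lambda>x. indicator (cball 0 (real n)) x *\<^sub>R h x) \<in> borel_measurable lebesgue" for n
  proof -
    have "set_integrable lebesgue (cball 0 (real n)) h" using assms by (simp add: locally_integrable_def)
    then show ?thesis unfolding set_integrable_def by (rule borel_measurable_integrable)
  qed
  fix x :: "real^'a"
  have "\<forall>\<^sub>F n in sequentially. indicator (cball 0 (real n)) x *\<^sub>R h x = h x"
    using eventually_ge_at_top[of "nat \<lceil>norm x\<rceil>"]
    by eventually_elim (simp add: indicator_def nat_ceiling_le_eq)
  then show "(\<lambda>n. indicator (cball 0 (real n)) x *\<^sub>R h x) \<longlonglongrightarrow> h x"
    by (rule tendsto_eventually)
qed

lemma locally_integrable_cball:
  "locally_integrable h \<Longrightarrow> integrable lebesgue (\<lambda>x. indicator (cball a r) x * h x)"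
  unfolding locally_integrable_def set_integrable_def by simp

lemma locally_integrable_mult_bounded:
  assumes h: "locally_integrable h" and b: "b \<in> borel_measurable lebesgue"
    and C: "\<And>y. \<bar>b y\<bar> \<le> C" and supp: "\<And>y. y \<notin> cball a r \<Longrightarrow> b y = 0"
  shows "integrable lebesgue (\<lambda>y. h y * b y)"
proof (rule Bochner_Integration.integrable_bound)
  show "integrable lebesgue (\<lambda>x. C * (indicator (cball a r) x * h x))"
    by (intro integrable_mult_right locally_integrable_cball h)
  show "(\<lambda>y. h y * b y) \<in> borel_measurable lebesgue"
    using locally_integrable_measurable[OF h] b by simp
  show "AE x in lebesgue. norm (h x * b x) \<le> norm (C * (indicator (cball a r) x * h x))"
  proof (rule AE_I2)
    fix x
    have "0 \<le> C" using C[of x] by linarith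
    then show "norm (h x * b x) \<le> norm (C * (indicator (cball a r) x * h x))"
      using supp[of x] C[of x]
      by (cases "x \<in> cball a r") (auto simp: abs_mult mult.commute intro!: mult_right_mono)
  qed
qed

lemma continuous_locally_integrable:
  assumes "continuous_on UNIV h" shows "locally_integrable h"
  unfolding locally_integrable_def
proof (intro allI impI)
  fix S :: "(real^'a) set" assume "compact S"
  then have "set_integrable lborel S h"
    unfolding set_integrable_def
    by (intro borel_integrable_compact continuous_on_subset[OF assms]) simp_all
  then show "set_integrable lebesgue S h"
    using \<open>compact S\<close> unfolding set_integrable_def
    by (subst integrable_completion) (auto intro!: borel_measurable_continuous_onI assms simp: borel_compact)
qed

lemma locally_integrable_const: "locally_integrable (\<lambda>x. c)"
  by (intro continuous_locally_integrable continuous_intros)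

lemma locally_integrable_cong_AE:
  assumes "locally_integrable f" "AE x in lebesgue. f x = g x" "g \<in> borel_measurable lebesgue"
  shows "locally_integrable g"
  unfolding locally_integrable_def
proof (intro allI impI)
  fix S :: "(real^'a) set" assume S: "compact S"
  have "set_integrable lebesgue S f" using assms(1) S unfolding locally_integrable_def by blast
  moreover have "S \<in> sets lebesgue" using S by (simp add: borel_compact)
  ultimately show "set_integrable lebesgue S g"
    using assms(2,3) locally_integrable_measurable[OF assms(1)]
    unfolding set_integrable_def
    by (subst integrable_cong_AE[of _ _ "\<lambda>x. indicator S x *\<^sub>R f x"])
       (simp_all, erule eventually_mono, simp)
qed

lemma locally_integrable_add:
  "locally_integrable f \<Longrightarrow> locally_integrable g \<Longrightarrow> locally_integrable (\<lambda>x. f x + g x)"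
  unfolding locally_integrable_def by (simp add: set_integral_add)

lemma locally_integrable_cmult: "locally_integrable f \<Longrightarrow> locally_integrable (\<lambda>x. c * f x)"
  unfolding locally_integrable_def by simp

lemma locally_integrable_abs: "locally_integrable f \<Longrightarrow> locally_integrable (\<lambda>x. \<bar>f x\<bar>)"
  unfolding locally_integrable_def by (simp add: set_integrable_abs)

lemma test_function_borel: "test_function \<phi> \<Longrightarrow> \<phi> \<in> borel_measurable borel"
  by (rule smooth_borel) (rule test_function_smooth)

lemma integrable_mult_test:
  assumes "locally_integrable h" "test_function \<phi>"
  shows "integrable lebesgue (\<lambda>y. h y * \<phi> y)"
proof -
  obtain C where "\<And>x. \<bar>\<phi> x\<bar> \<le> C" using test_function_bounded[OF assms(2)] by blast
  moreover obtain r where "\<And>x. r \<le> norm x \<Longrightarrow> \<phi> x = 0" using assms(2) unfolding test_function_iff by blast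
  ultimately show ?thesis
    using assms(1) borel_lebesgue[OF test_function_borel[OF assms(2)]]
    by (intro locally_integrable_mult_bounded[where a = 0 and r = r and C = C]) simp_all
qed

section \<open>Convolution\<close>

definition conv :: "(real^'n::finite \<Rightarrow> real) \<Rightarrow> (real^'n \<Rightarrow> real) \<Rightarrow> real^'n \<Rightarrow> real" where
  "conv h \<kappa> x = (LINT y|lebesgue. h y * \<kappa> (x - y))"

lemma test_function_reflect: "test_function \<kappa> \<Longrightarrow> test_function (\<lambda>y. \<kappa> (x - y))"
  using test_function_affine[of \<kappa> "-1" x] by simp

lemma integrable_conv:
  "locally_integrable h \<Longrightarrow> test_function \<kappa> \<Longrightarrow> integrable lebesgue (\<lambda>y. h y * \<kappa> (x - y))"
  by (intro integrable_mult_test test_function_reflect)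

lemma conv_cong_AE:
  assumes "AE y in lebesgue. h y = h' y" "h \<in> borel_measurable lebesgue" "h' \<in> borel_measurable lebesgue"
    "test_function \<kappa>"
  shows "conv h \<kappa> x = conv h' \<kappa> x"
  unfolding conv_def
  using assms(1-3) test_function_borel[OF test_function_reflect[OF assms(4), of x], THEN borel_lebesgue]
  by (intro integral_cong_AE) (simp_all, erule eventually_mono, simp)

lemma bounded_linear_coefficients: "bounded_linear (\<lambda>h::real^'n::finite. \<Sum>i\<in>UNIV. h $ i * a i)"
  by (intro bounded_linear_sum bounded_linear_compose[OF bounded_linear_mult_left bounded_linear_vec_nth])

lemma onorm_coefficients:
  fixes a :: "'n::finite \<Rightarrow> real" and C :: real
  assumes "\<And>i. \<bar>a i\<bar> \<le> C"
  shows "onorm (\<lambda>h::real^'n. \<Sum>i\<in>UNIV. h $ i * a i) \<le> CARD('n) * C"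
proof (rule onorm_le)
  fix h :: "real^'n"
  have "norm (\<Sum>i\<in>UNIV. h $ i * a i) \<le> (\<Sum>i\<in>(UNIV::'n set). norm h * C)"
    by (rule order_trans[OF norm_sum], rule sum_mono)
      (auto simp: abs_mult component_le_norm_cart intro!: mult_mono assms)
  then show "norm (\<Sum>i\<in>UNIV. h $ i * a i) \<le> CARD('n) * C * norm h" by (simp add: mult_ac)
qed

lemma lipschitz_of_partials:
  fixes f :: "real^'n::finite \<Rightarrow> real" and C :: real
  assumes "convex S" "\<And>x. x \<in> S \<Longrightarrow> f differentiable (at x)"
    and C: "\<And>i x. x \<in> S \<Longrightarrow> \<bar>partial_deriv i f x\<bar> \<le> C" and "x \<in> S" "y \<in> S"
  shows "\<bar>f x - f y\<bar> \<le> CARD('n) * C * norm (x - y)"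
proof -
  have "norm (f x - f y) \<le> CARD('n) * C * norm (x - y)"
  proof (rule differentiable_bound[where S = S and f = f and x = x and y = y and B = "CARD('n) * C"
        and f' = "\<lambda>z h. \<Sum>i\<in>UNIV. h $ i * partial_deriv i f z"])
    show "(f has_derivative (\<lambda>h. \<Sum>i\<in>UNIV. h $ i * partial_deriv i f z)) (at z within S)" if "z \<in> S" for z
      by (rule has_derivative_at_withinI[OF has_derivative_partials[OF assms(2)[OF that]]])
    show "onorm (\<lambda>h::real^'n. \<Sum>i\<in>UNIV. h $ i * partial_deriv i f z) \<le> CARD('n) * C" if "z \<in> S" for z
      by (intro onorm_coefficients C that)
  qed (use assms(1,4,5) in simp_all)
  then show ?thesis by simp
qed

text \<open>The first partial derivatives are Lipschitz since the second ones are bounded. This makes the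
  first-order remainder quadratic, uniformly in the base point, which is what differentiation under
  a convolution integral needs.\<close>
lemma test_function_taylor:
  fixes \<kappa> :: "real^'n::finite \<Rightarrow> real"
  assumes "test_function \<kappa>"
  obtains C where "C > 0"
    "\<And>z v. \<bar>\<kappa> (z + v) - \<kappa> z - (\<Sum>i\<in>UNIV. v $ i * partial_deriv i \<kappa> z)\<bar> \<le> C * (norm v)\<^sup>2"
proof -
  have sm: "smooth \<kappa>" by (rule test_function_smooth) fact
  obtain C' where C': "\<forall>x i j. \<bar>\<kappa> x\<bar> \<le> C' \<and> \<bar>partial_deriv i \<kappa> x\<bar> \<le> C'
      \<and> \<bar>partial_deriv j (partial_deriv i \<kappa>) x\<bar> \<le> C'"
    using test_function_C2_bounded[OF assms] by blast
  define C where "C = max 1 C'"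
  have C0: "C > 0" unfolding C_def by simp
  have C: "\<bar>partial_deriv j (partial_deriv i \<kappa>) x\<bar> \<le> C" for i j x
    using C' unfolding C_def by (simp add: le_max_iff_disj)
  have lip: "\<bar>partial_deriv i \<kappa> x - partial_deriv i \<kappa> y\<bar> \<le> CARD('n) * C * norm (x - y)" for i x y
    by (rule lipschitz_of_partials[of UNIV])
      (simp_all add: C smooth_differentiable[OF smooth_partial_deriv[OF sm]])
  show ?thesis
  proof (rule that[of "CARD('n) * (CARD('n) * C)"])
    fix z v :: "real^'n"
    let ?D = "\<lambda>x h. \<Sum>i\<in>UNIV. h $ i * partial_deriv i \<kappa> x"
    have "norm (\<kappa> (z + v) - \<kappa> z - ?D z (z + v - z)) \<le> norm (z + v - z) * (CARD('n) * (CARD('n) * C * norm v))"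
    proof (rule differentiable_bound_linearization[where f = \<kappa> and f' = ?D and S = "cball z (norm v)"
          and ?x0.0 = z and a = z and b = "z + v" and B = "CARD('n) * (CARD('n) * C * norm v)"])
      show "z + t *\<^sub>R (z + v - z) \<in> cball z (norm v)" if "t \<in> {0..1}" for t
      proof -
        have "norm (t *\<^sub>R v) \<le> norm v" using that by (simp add: mult_left_le_one_le)
        then show ?thesis by (simp add: dist_norm)
      qed
      show "(\<kappa> has_derivative ?D x) (at x within cball z (norm v))" for x
        by (rule has_derivative_at_withinI[OF has_derivative_partials[OF smooth_differentiable[OF sm]]])
      fix x assume x: "x \<in> cball z (norm v)"
      have "norm (x - z) \<le> norm v" using x by (simp add: dist_norm norm_minus_commute)
      then have "\<bar>partial_deriv i \<kappa> x - partial_deriv i \<kappa> z\<bar> \<le> CARD('n) * C * norm v" for i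
        using order_trans[OF lip[of i x z] mult_left_mono] C0 by simp
      then have "onorm (\<lambda>h::real^'n. \<Sum>i\<in>UNIV. h $ i * (partial_deriv i \<kappa> x - partial_deriv i \<kappa> z)) \<le> CARD('n) * (CARD('n) * C * norm v)"
        by (rule onorm_coefficients)
      moreover have "?D x - ?D z = (\<lambda>h. \<Sum>i\<in>UNIV. h $ i * (partial_deriv i \<kappa> x - partial_deriv i \<kappa> z))"
        by (rule ext) (simp add: sum_subtractf right_diff_distrib)
      ultimately show "onorm (?D x - ?D z) \<le> CARD('n) * (CARD('n) * C * norm v)" by simp
    qed simp
    then show "\<bar>\<kappa> (z + v) - \<kappa> z - ?D z v\<bar> \<le> CARD('n) * (CARD('n) * C) * (norm v)\<^sup>2"
      by (simp add: power2_eq_square mult_ac)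
  qed (use C0 in simp)
qed

lemma abs_integral_mult_le:
  fixes h :: "real^'n::finite \<Rightarrow> real"
  assumes h: "locally_integrable h"
    and b: "\<And>y. \<bar>b y\<bar> \<le> C" "\<And>y. y \<notin> S \<Longrightarrow> b y = 0" and S: "bounded S" "S \<in> sets lebesgue"
  shows "\<bar>LINT y|lebesgue. h y * b y\<bar> \<le> C * (LINT y:S|lebesgue. \<bar>h y\<bar>)"
proof -
  have C: "0 \<le> C" using b(1)[of 0] by linarith
  obtain r where r: "\<And>x. x \<in> S \<Longrightarrow> norm x \<le> r" using S(1) unfolding bounded_iff by blast
  have int: "integrable lebesgue (\<lambda>y. indicator S y *\<^sub>R \<bar>h y\<bar>)"
  proof -
    have "integrable lebesgue (\<lambda>y. \<bar>h y\<bar> * indicator S y)"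
      using r S(2)
      by (intro locally_integrable_mult_bounded[OF locally_integrable_abs[OF h], where C = 1 and a = 0 and r = r])
         (auto simp: indicator_def)
    then show ?thesis by (simp add: mult.commute)
  qed
  have "\<bar>LINT y|lebesgue. h y * b y\<bar> \<le> (LINT y|lebesgue. C * (indicator S y *\<^sub>R \<bar>h y\<bar>))"
  proof (cases "integrable lebesgue (\<lambda>y. h y * b y)")
    case True
    then have "norm (LINT y|lebesgue. h y * b y) \<le> (LINT y|lebesgue. norm (h y * b y))"
      by (intro integral_norm_bound)
    also have "\<dots> \<le> (LINT y|lebesgue. C * (indicator S y *\<^sub>R \<bar>h y\<bar>))"
    proof (rule integral_mono)
      show "norm (h y * b y) \<le> C * (indicator S y *\<^sub>R \<bar>h y\<bar>)" for y
        using b[of y] by (cases "y \<in> S") (auto simp: abs_mult mult.commute intro!: mult_right_mono)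
    qed (use True int in auto)
    finally show ?thesis by simp
  next
    case False
    then show ?thesis using C by (simp add: not_integrable_integral_eq)
  qed
  then show ?thesis by (simp add: set_lebesgue_integral_def)
qed

text \<open>The quadratic remainder of the kernel is uniform, so \<open>h\<close> enters the remainder of the convolution
  only through the integral of \<open>\<bar>h\<bar>\<close> over a fixed ball containing the supports of all the nearby
  translates of the kernel.\<close>
lemma has_derivative_conv:
  fixes h :: "real^'n::finite \<Rightarrow> real"
  assumes h: "locally_integrable h" and \<kappa>: "test_function \<kappa>"
  shows "(conv h \<kappa> has_derivative (\<lambda>v. \<Sum>i\<in>UNIV. v $ i * conv h (partial_deriv i \<kappa>) x)) (at x)"
proof -
  obtain C where C: "C > 0"
    "\<And>z v. \<bar>\<kappa> (z + v) - \<kappa> z - (\<Sum>i\<in>UNIV. v $ i * partial_deriv i \<kappa> z)\<bar> \<le> C * (norm v)\<^sup>2"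
    using test_function_taylor[OF \<kappa>] by blast
  obtain r where r: "\<And>x. r \<le> norm x \<Longrightarrow> \<kappa> x = 0" using \<kappa> unfolding test_function_iff by blast
  define S where "S = cball x (r + 1)"
  define A where "A = (LINT y:S|lebesgue. \<bar>h y\<bar>)"
  have D: "integrable lebesgue (\<lambda>y. h y * partial_deriv i \<kappa> (x - y))" for i
    by (intro integrable_conv h test_function_partial_deriv \<kappa>)
  have main: "\<bar>conv h \<kappa> (x + v) - conv h \<kappa> x - (\<Sum>i\<in>UNIV. v $ i * conv h (partial_deriv i \<kappa>) x)\<bar> \<le> C * (norm v)\<^sup>2 * A"
    if v: "norm v < 1" for v
  proof -
    let ?b = "\<lambda>y. \<kappa> (x - y + v) - \<kappa> (x - y) - (\<Sum>i\<in>UNIV. v $ i * partial_deriv i \<kappa> (x - y))"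
    have "conv h \<kappa> (x + v) - conv h \<kappa> x - (\<Sum>i\<in>UNIV. v $ i * conv h (partial_deriv i \<kappa>) x)
      = (LINT y|lebesgue. h y * \<kappa> (x + v - y) - h y * \<kappa> (x - y) - (\<Sum>i\<in>UNIV. v $ i * (h y * partial_deriv i \<kappa> (x - y))))"
    proof -
      have 1: "integrable lebesgue (\<lambda>y. v $ i * (h y * partial_deriv i \<kappa> (x - y)))" for i
        by (intro integrable_mult_right D)
      have 2: "integrable lebesgue (\<lambda>y. h y * \<kappa> (x + v - y) - h y * \<kappa> (x - y))"
        by (intro Bochner_Integration.integrable_diff integrable_conv h \<kappa>)
      have "(LINT y|lebesgue. h y * \<kappa> (x + v - y) - h y * \<kappa> (x - y) - (\<Sum>i\<in>UNIV. v $ i * (h y * partial_deriv i \<kappa> (x - y))))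
        = (LINT y|lebesgue. h y * \<kappa> (x + v - y) - h y * \<kappa> (x - y))
          - (LINT y|lebesgue. (\<Sum>i\<in>UNIV. v $ i * (h y * partial_deriv i \<kappa> (x - y))))"
        by (intro Bochner_Integration.integral_diff 2 Bochner_Integration.integrable_sum 1)
      also have "(LINT y|lebesgue. h y * \<kappa> (x + v - y) - h y * \<kappa> (x - y)) = conv h \<kappa> (x + v) - conv h \<kappa> x"
        unfolding conv_def by (intro Bochner_Integration.integral_diff integrable_conv h \<kappa>)
      also have "(LINT y|lebesgue. (\<Sum>i\<in>UNIV. v $ i * (h y * partial_deriv i \<kappa> (x - y))))
        = (\<Sum>i\<in>UNIV. LINT y|lebesgue. v $ i * (h y * partial_deriv i \<kappa> (x - y)))"
        by (rule Bochner_Integration.integral_sum) (rule 1)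
      also have "\<dots> = (\<Sum>i\<in>UNIV. v $ i * conv h (partial_deriv i \<kappa>) x)"
        unfolding conv_def by (simp only: integral_mult_right_zero)
      finally show ?thesis by simp
    qed
    also have "\<dots> = (LINT y|lebesgue. h y * ?b y)"
    proof (rule Bochner_Integration.integral_cong[OF refl])
      fix y
      have e: "x + v - y = x - y + v" by simp
      show "h y * \<kappa> (x + v - y) - h y * \<kappa> (x - y) - (\<Sum>i\<in>UNIV. v $ i * (h y * partial_deriv i \<kappa> (x - y))) = h y * ?b y"
        unfolding e right_diff_distrib sum_distrib_left by (simp only: mult.left_commute)
    qed
    also have "\<bar>\<dots>\<bar> \<le> C * (norm v)\<^sup>2 * A"
      unfolding A_def
    proof (rule abs_integral_mult_le[OF h C(2)])
      fix y assume "y \<notin> S"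
      then have y: "r + 1 < norm (x - y)" by (simp add: S_def dist_norm)
      have "partial_deriv i \<kappa> (x - y) = 0" for i
        by (rule partial_deriv_eq_0_outside[of r]) (use r y in auto)
      moreover have "norm (x - y + v) \<ge> r" using y v norm_diff_ineq[of "x - y" v] by linarith
      ultimately show "?b y = 0" using r y by simp
    qed (auto simp: S_def)
    finally show ?thesis .
  qed
  show ?thesis
  proof (rule has_derivativeI_sandwich[of 1])
    show "bounded_linear (\<lambda>v. \<Sum>i\<in>UNIV. v $ i * conv h (partial_deriv i \<kappa>) x)"
      by (rule bounded_linear_coefficients)
    show "((\<lambda>y. C * A * norm (y - x)) \<longlongrightarrow> 0) (at x)"
      by (auto intro!: tendsto_eq_intros)
    fix y assume "y \<noteq> x" "dist y x < 1"
    then have "\<bar>conv h \<kappa> y - conv h \<kappa> x - (\<Sum>i\<in>UNIV. (y - x) $ i * conv h (partial_deriv i \<kappa>) x)\<bar> \<le> C * (norm (y - x))\<^sup>2 * A"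
      using main[of "y - x"] by (simp add: dist_norm)
    then show "norm (conv h \<kappa> y - conv h \<kappa> x - (\<Sum>i\<in>UNIV. (y - x) $ i * conv h (partial_deriv i \<kappa>) x)) / norm (y - x)
        \<le> C * A * norm (y - x)"
      using \<open>y \<noteq> x\<close> by (simp add: divide_le_eq power2_eq_square mult_ac)
  qed simp
qed

lemma partial_deriv_conv:
  "locally_integrable h \<Longrightarrow> test_function \<kappa> \<Longrightarrow> partial_deriv i (conv h \<kappa>) = conv h (partial_deriv i \<kappa>)"
  by (rule ext, subst partial_deriv_eq[OF has_derivative_conv])
     (auto simp: axis_def if_distrib[of "\<lambda>x. x * _"] cong: if_cong)

lemma smooth_conv:
  assumes h: "locally_integrable h" and "test_function \<kappa>" shows "smooth (conv h \<kappa>)"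
proof (rule smooth_coinduct[where S = "\<lambda>g. \<exists>\<kappa>. test_function \<kappa> \<and> g = conv h \<kappa>"])
  show "\<exists>\<kappa>'. test_function \<kappa>' \<and> conv h \<kappa> = conv h \<kappa>'" using assms by blast
  fix g assume "\<exists>\<kappa>. test_function \<kappa> \<and> g = conv h \<kappa>"
  then obtain \<kappa> where \<kappa>: "test_function \<kappa>" and g: "g = conv h \<kappa>" by blast
  have "g differentiable (at x)" for x
    unfolding g using has_derivative_conv[OF h \<kappa>] by (rule differentiableI)
  moreover have "partial_deriv i g = conv h (partial_deriv i \<kappa>)" for i
    unfolding g by (rule partial_deriv_conv[OF h \<kappa>])
  ultimately show "(\<forall>x. g differentiable (at x)) \<and> (\<forall>i. \<exists>\<kappa>. test_function \<kappa> \<and> partial_deriv i g = conv h \<kappa>)"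
    using test_function_partial_deriv[OF \<kappa>] by blast
qed

lemma laplacian_conv:
  assumes h: "locally_integrable h" and \<kappa>: "test_function \<kappa>"
  shows "laplacian (conv h \<kappa>) x = conv h (laplacian \<kappa>) x"
proof -
  have t: "test_function (partial_deriv i (partial_deriv i \<kappa>))" for i
    by (intro test_function_partial_deriv \<kappa>)
  have "laplacian (conv h \<kappa>) x = (\<Sum>i\<in>UNIV. conv h (partial_deriv i (partial_deriv i \<kappa>)) x)"
    by (simp add: laplacian_def partial_deriv_conv[OF h] \<kappa> test_function_partial_deriv)
  also have "\<dots> = conv h (laplacian \<kappa>) x"
    unfolding conv_def laplacian_def sum_distrib_left
    by (rule Bochner_Integration.integral_sum[symmetric]) (rule integrable_conv[OF h t])
  finally show ?thesis .
qed

section \<open>Integration by parts\<close>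

lemma integral_reflect:
  assumes "test_function \<phi>" shows "(LINT y|lebesgue. \<phi> (x - y)) = (LINT y|lebesgue. \<phi> y)"
  using integral_lebesgue_affine[OF test_function_borel[OF assms], of "-1" x] by simp

text \<open>The convolution with the constant 1 is constant by translation invariance, so its derivative
  vanishes.\<close>
lemma integral_partial_deriv:
  fixes \<phi> :: "real^'n::finite \<Rightarrow> real"
  assumes "test_function \<phi>" shows "(LINT x|lebesgue. partial_deriv i \<phi> x) = 0"
proof -
  have "conv (\<lambda>_. 1) \<phi> = (\<lambda>x. LINT y|lebesgue. \<phi> y)"
    by (simp add: conv_def fun_eq_iff integral_reflect assms)
  then have "partial_deriv i (conv (\<lambda>_. 1) \<phi>) 0 = 0" by (simp add: partial_deriv_const)
  then show ?thesis
    by (simp add: partial_deriv_conv[OF locally_integrable_const assms] conv_def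
        integral_reflect[OF test_function_partial_deriv[OF assms], of i 0, simplified])
qed

lemma smooth_locally_integrable: "smooth f \<Longrightarrow> locally_integrable f"
  by (intro continuous_locally_integrable smooth_continuous_on)

lemma integration_by_parts:
  assumes a: "smooth a" and \<phi>: "test_function \<phi>"
  shows "(LINT x|lebesgue. a x * partial_deriv i \<phi> x) = - (LINT x|lebesgue. partial_deriv i a x * \<phi> x)"
proof -
  have "(LINT x|lebesgue. partial_deriv i (\<lambda>x. a x * \<phi> x) x) = 0"
    by (intro integral_partial_deriv test_function_mult a \<phi>)
  also have "partial_deriv i (\<lambda>x. a x * \<phi> x) = (\<lambda>x. a x * partial_deriv i \<phi> x + partial_deriv i a x * \<phi> x)"
    by (simp add: fun_eq_iff partial_deriv_mult smooth_differentiable a \<phi> test_function_smooth)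
  also have "(LINT x|lebesgue. a x * partial_deriv i \<phi> x + partial_deriv i a x * \<phi> x) =
      (LINT x|lebesgue. a x * partial_deriv i \<phi> x) + (LINT x|lebesgue. partial_deriv i a x * \<phi> x)"
    by (intro Bochner_Integration.integral_add integrable_mult_test smooth_locally_integrable
        smooth_partial_deriv test_function_partial_deriv a \<phi>)
  finally show ?thesis by simp
qed

lemma green_identity:
  assumes a: "smooth a" and \<phi>: "test_function \<phi>"
  shows "(LINT x|lebesgue. a x * laplacian \<phi> x) = (LINT x|lebesgue. laplacian a x * \<phi> x)"
proof -
  have t: "test_function (partial_deriv i (partial_deriv i \<phi>))" for i
    by (intro test_function_partial_deriv \<phi>)
  have s: "smooth (partial_deriv i (partial_deriv i a))" for i
    by (intro smooth_partial_deriv a)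
  have "(LINT x|lebesgue. a x * laplacian \<phi> x) = (\<Sum>i\<in>UNIV. LINT x|lebesgue. a x * partial_deriv i (partial_deriv i \<phi>) x)"
    unfolding laplacian_def sum_distrib_left
    by (rule Bochner_Integration.integral_sum) (intro integrable_mult_test smooth_locally_integrable a t)
  also have "\<dots> = (\<Sum>i\<in>UNIV. LINT x|lebesgue. partial_deriv i (partial_deriv i a) x * \<phi> x)"
    by (simp add: integration_by_parts a \<phi> smooth_partial_deriv test_function_partial_deriv)
  also have "\<dots> = (LINT x|lebesgue. laplacian a x * \<phi> x)"
    unfolding laplacian_def sum_distrib_right
    by (rule Bochner_Integration.integral_sum[symmetric])
       (intro integrable_mult_test smooth_locally_integrable s \<phi>)
  finally show ?thesis .
qed

section \<open>The Poisson equation in the sense of distributions\<close>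

text \<open>\<open>\<Delta>v = f\<close> in the sense of distributions.\<close>
definition poisson :: "(real^'n::finite \<Rightarrow> real) \<Rightarrow> (real^'n \<Rightarrow> real) \<Rightarrow> bool" where
  "poisson w f \<longleftrightarrow> locally_integrable w \<and> locally_integrable f \<and>
     (\<forall>\<phi>. test_function \<phi> \<longrightarrow> (LINT x|lebesgue. w x * laplacian \<phi> x) = (LINT x|lebesgue. f x * \<phi> x))"

lemma poisson_smooth: "smooth v \<Longrightarrow> poisson v (laplacian v)"
  by (simp add: poisson_def smooth_locally_integrable smooth_laplacian green_identity)

text \<open>The kernel reflected and translated to \<open>x\<close> is an admissible test function.\<close>
lemma conv_laplacian:
  assumes "poisson w f" "test_function \<kappa>"
  shows "conv w (laplacian \<kappa>) x = conv f \<kappa> x"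
proof -
  have "laplacian (\<lambda>y. \<kappa> (x - y)) y = laplacian \<kappa> (x - y)" for y
    using laplacian_affine[OF test_function_smooth[OF assms(2)], of x "-1" y] by simp
  then show ?thesis
    using assms test_function_reflect[OF assms(2), of x] by (auto simp: poisson_def conv_def)
qed

lemma conv_partial_deriv_smooth:
  assumes v: "smooth v" and \<kappa>: "test_function \<kappa>"
  shows "conv v (partial_deriv i \<kappa>) x = conv (partial_deriv i v) \<kappa> x"
proof -
  have "partial_deriv i (\<lambda>y. \<kappa> (x - y)) y = - partial_deriv i \<kappa> (x - y)" for y
    using partial_deriv_affine(1)[OF smooth_differentiable[OF test_function_smooth[OF \<kappa>]], of i x "-1" y] by simp
  then show ?thesis
    using integration_by_parts[OF v test_function_reflect[OF \<kappa>, of x], of i]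
    by (simp add: conv_def)
qed

section \<open>A smooth profile\<close>

text \<open>The functions \<open>p(1/t) exp(-1/t)\<close> for \<open>t > 0\<close>, extended by \<open>0\<close>. They are closed under
  differentiation, even at \<open>0\<close>, because exponential decay beats every power of \<open>1/t\<close>.\<close>
definition flat :: "real poly \<Rightarrow> real \<Rightarrow> real" where
  "flat p t = (if t > 0 then poly p (1 / t) * exp (- (1 / t)) else 0)"

lemma tendsto_poly_exp: "((\<lambda>s. poly p s * exp (- s)) \<longlongrightarrow> 0) at_top" for p :: "real poly"
proof -
  have "((\<lambda>s. \<Sum>i\<le>degree p. coeff p i * (s ^ i / exp s)) \<longlongrightarrow> (\<Sum>i\<le>degree p. coeff p i * 0)) at_top"
    by (intro tendsto_sum tendsto_mult tendsto_const tendsto_power_div_exp_0)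
  moreover have "(\<Sum>i\<le>degree p. coeff p i * (s ^ i / exp s)) = poly p s * exp (- s)" for s
    by (simp add: poly_altdef sum_distrib_left exp_minus divide_inverse mult_ac)
  ultimately show ?thesis by simp
qed

lemma tendsto_flat: "(flat p \<longlongrightarrow> 0) (at 0)"
proof -
  have "((\<lambda>t. poly p (inverse t) * exp (- inverse t)) \<longlongrightarrow> 0) (at_right 0)"
    by (rule filterlim_compose[OF tendsto_poly_exp filterlim_inverse_at_top_right])
  then have "(flat p \<longlongrightarrow> 0) (at_right 0)"
    by (rule Lim_transform_eventually)
       (simp add: flat_def eventually_at_right_less inverse_eq_divide eventually_mono[OF eventually_at_right_less])
  moreover have "(flat p \<longlongrightarrow> 0) (at_left 0)"
    by (rule tendsto_eventually)
       (auto simp: flat_def eventually_at_left_field intro!: exI[of _ "-1"])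
  ultimately show ?thesis by (simp add: filterlim_at_split)
qed

lemma DERIV_flat: "(flat p has_real_derivative flat ([:0, 0, 1:] * (p - pderiv p)) t) (at t)"
proof -
  consider "t > 0" | "t < 0" | "t = 0" by linarith
  then show ?thesis
  proof cases
    case 1
    have "((\<lambda>t. poly p (1 / t) * exp (- (1 / t))) has_real_derivative flat ([:0, 0, 1:] * (p - pderiv p)) t) (at t)"
    proof -
      have inv: "((\<lambda>t. 1 / t) has_real_derivative - (1 / t * (1 / t))) (at t)"
        using DERIV_inverse[of t] 1 by (simp add: inverse_eq_divide power2_eq_square)
      show ?thesis
        by (rule DERIV_cong[OF DERIV_mult[OF DERIV_chain2[OF poly_DERIV inv] DERIV_chain2[OF DERIV_exp DERIV_minus[OF inv]]]])
          (use 1 in \<open>simp add: flat_def algebra_simps\<close>)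
    qed
    then show ?thesis
      by (rule has_field_derivative_transform_within_open[where S = "{0<..}"]) (use 1 in \<open>auto simp: flat_def\<close>)
  next
    case 2
    have "((\<lambda>t. 0) has_real_derivative flat ([:0, 0, 1:] * (p - pderiv p)) t) (at t)"
      using 2 by (simp add: flat_def)
    then show ?thesis
      by (rule has_field_derivative_transform_within_open[where S = "{..<0}"]) (use 2 in \<open>auto simp: flat_def\<close>)
  next
    case 3
    have "((\<lambda>h. (flat p h - flat p 0) / (h - 0)) \<longlongrightarrow> 0) (at 0)"
      using tendsto_flat[of "[:0, 1:] * p"]
      by (rule Lim_transform_eventually) (auto simp: eventually_at_filter flat_def)
    then show ?thesis using 3 by (simp add: has_field_derivative_iff flat_def)
  qed
qed

definition flat_poly :: "nat \<Rightarrow> real poly" where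
  "flat_poly n = ((\<lambda>p. [:0, 0, 1:] * (p - pderiv p)) ^^ n) 1"

text \<open>The \<open>n\<close>-th derivative of a nonincreasing function that is positive for \<open>t < 1\<close> and vanishes for
  \<open>t \<ge> 1\<close>.\<close>
definition profile :: "nat \<Rightarrow> real \<Rightarrow> real" where
  "profile n t = (-1) ^ n * flat (flat_poly n) (1 - t)"

lemma DERIV_profile: "(profile n has_real_derivative profile (Suc n) t) (at t)"
  unfolding profile_def[abs_def]
  by (rule derivative_eq_intros DERIV_chain2[OF DERIV_flat] refl)+ (simp add: flat_poly_def)

lemma continuous_on_profile: "continuous_on A (profile n)"
  by (rule DERIV_continuous_on) (rule has_field_derivative_at_within[OF DERIV_profile])

lemma profile_nonneg: "0 \<le> profile 0 t"
  and profile_eq_0: "1 \<le> t \<Longrightarrow> profile 0 t = 0"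
  and profile_pos: "t < 1 \<Longrightarrow> 0 < profile 0 t"
  and profile_antimono: "s \<le> t \<Longrightarrow> profile 0 t \<le> profile 0 s"
  by (auto simp: profile_def flat_poly_def flat_def frac_le)

text \<open>The \<open>n\<close>-th derivative of \<open>t \<mapsto> (1/t) \<integral>(t/4 .. t) profile 0\<close>. The average over
  \<open>\<sigma> \<in> [1/4, 1]\<close> is the same function in a form that is visibly smooth at \<open>t = 0\<close>.\<close>
definition profile_mean :: "nat \<Rightarrow> real \<Rightarrow> real" where
  "profile_mean n t = integral {1/4..1} (\<lambda>\<sigma>. \<sigma> ^ n * profile n (\<sigma> * t))"

lemma continuous_on_profile_scaled: "continuous_on A (\<lambda>\<sigma>. \<sigma> ^ n * profile n (\<sigma> * t))"
  by (intro continuous_intros continuous_on_compose2[OF continuous_on_profile[of UNIV]]) auto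

lemma DERIV_profile_mean: "(profile_mean n has_real_derivative profile_mean (Suc n) t) (at t)"
proof -
  have "((\<lambda>t. integral (cbox (1/4) 1) (\<lambda>\<sigma>. \<sigma> ^ n * profile n (\<sigma> * t))) has_field_derivative
      integral (cbox (1/4) 1) (\<lambda>\<sigma>. \<sigma> ^ Suc n * profile (Suc n) (\<sigma> * t))) (at t within UNIV)"
  proof (rule leibniz_rule_field_derivative)
    show "((\<lambda>t. \<sigma> ^ n * profile n (\<sigma> * t)) has_real_derivative \<sigma> ^ Suc n * profile (Suc n) (\<sigma> * t)) (at t within UNIV)"
      for t \<sigma> :: real
      by (rule derivative_eq_intros DERIV_chain2[OF DERIV_profile] refl)+ simp
    show "(\<lambda>\<sigma>. \<sigma> ^ n * profile n (\<sigma> * t)) integrable_on cbox (1/4) 1" for t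
      by (intro integrable_continuous continuous_on_profile_scaled)
    show "continuous_on (UNIV \<times> cbox (1/4) 1) (\<lambda>(t, \<sigma>). \<sigma> ^ Suc n * profile (Suc n) (\<sigma> * t))"
      unfolding split_beta
      by (intro continuous_intros continuous_on_compose2[OF continuous_on_profile[of UNIV]]) auto
  qed auto
  then show ?thesis unfolding profile_mean_def[abs_def] by simp
qed

text \<open>Both sides are the derivative of \<open>t profile_mean 0 t = \<integral>(t/4 .. t) profile 0\<close>. The proof
  applies the fundamental theorem in \<open>\<sigma>\<close> instead of \<open>t\<close>.\<close>
lemma profile_mean_identity: "profile_mean 0 t + t * profile_mean 1 t = profile 0 t - profile 0 (t / 4) / 4"
proof -
  have "((\<lambda>\<sigma>. profile 0 (\<sigma> * t) + t * (\<sigma> * profile 1 (\<sigma> * t))) has_integral (1 * profile 0 (1 * t) - 1/4 * profile 0 (1/4 * t))) {1/4..1}"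
  proof (rule fundamental_theorem_of_calculus)
    fix \<sigma> :: real
    have "((\<lambda>\<sigma>. \<sigma> * profile 0 (\<sigma> * t)) has_real_derivative profile 0 (\<sigma> * t) + t * (\<sigma> * profile 1 (\<sigma> * t))) (at \<sigma>)"
      by (rule derivative_eq_intros DERIV_chain2[OF DERIV_profile] refl)+ (simp add: mult_ac)
    then show "((\<lambda>\<sigma>. \<sigma> * profile 0 (\<sigma> * t)) has_vector_derivative profile 0 (\<sigma> * t) + t * (\<sigma> * profile 1 (\<sigma> * t))) (at \<sigma> within {1/4..1})"
      by (simp add: has_real_derivative_iff_has_vector_derivative has_vector_derivative_at_within)
  qed simp
  moreover have "((\<lambda>\<sigma>. profile 0 (\<sigma> * t) + t * (\<sigma> * profile 1 (\<sigma> * t))) has_integral (profile_mean 0 t + t * profile_mean 1 t)) {1/4..1}"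
    unfolding profile_mean_def
    using continuous_on_profile_scaled[of "{1/4..1}" 0 t] continuous_on_profile_scaled[of "{1/4..1}" 1 t]
    by (intro has_integral_add has_integral_mult_right) (auto intro!: integrable_integral integrable_continuous_real)
  ultimately have "1 * profile 0 (1 * t) - 1/4 * profile 0 (1/4 * t) = profile_mean 0 t + t * profile_mean 1 t"
    by (rule has_integral_unique)
  then show ?thesis by simp
qed

lemma profile_mean_nonneg: "0 \<le> profile_mean 0 t"
  unfolding profile_mean_def by (rule integral_nonneg)
    (auto intro!: integrable_continuous_real continuous_on_profile_scaled[of _ 0, simplified] profile_nonneg)

lemma profile_mean_eq_0: assumes "4 \<le> t" shows "profile_mean 0 t = 0"
proof -
  have "profile_mean 0 t = integral {1/4..1} (\<lambda>\<sigma>::real. 0)"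
    unfolding profile_mean_def
  proof (rule integral_cong)
    fix \<sigma> :: real assume "\<sigma> \<in> {1/4..1}"
    then have "1/4 * 4 \<le> \<sigma> * t" using assms by (intro mult_mono) auto
    then show "\<sigma> ^ 0 * profile 0 (\<sigma> * t) = 0" by (simp add: profile_eq_0)
  qed
  then show ?thesis by simp
qed

lemma profile_mean_pos: assumes "t < 4" shows "0 < profile_mean 0 t"
proof -
  have "profile_mean 0 t \<noteq> 0"
  proof
    assume "profile_mean 0 t = 0"
    then have "integral {1/4..1} (\<lambda>\<sigma>. profile 0 (\<sigma> * t)) = 0" by (simp add: profile_mean_def)
    moreover have "continuous_on {1/4..1} (\<lambda>\<sigma>. profile 0 (\<sigma> * t))"
      using continuous_on_profile_scaled[of _ 0 t] by simp
    ultimately have "\<forall>\<sigma>\<in>{1/4..1}. profile 0 (\<sigma> * t) = 0"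
      by (subst (asm) integral_eq_0_iff) (auto simp: profile_nonneg)
    then have "profile 0 (1/4 * t) = 0" by (rule bspec) simp
    then show False using profile_pos[of "1/4 * t"] assms by simp
  qed
  then show ?thesis using profile_mean_nonneg[of t] by linarith
qed

text \<open>The primitive of \<open>profile_mean 0\<close> that vanishes for \<open>t \<ge> 4\<close>. The lower limit \<open>-1\<close> keeps
  \<open>t = 0\<close>, the value at the origin of the plane, in the interior of the interval of integration, where
  the derivative is two-sided.\<close>
definition green_profile :: "real \<Rightarrow> real" where
  "green_profile t = integral {-1..t} (profile_mean 0) - integral {-1..4} (profile_mean 0)"

lemma continuous_on_profile_mean: "continuous_on A (profile_mean n)"
  by (rule DERIV_continuous_on) (rule has_field_derivative_at_within[OF DERIV_profile_mean])

lemma DERIV_green_profile: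
  assumes "t > -1" shows "(green_profile has_real_derivative profile_mean 0 t) (at t)"
proof -
  have "((\<lambda>t. integral {-1..t} (profile_mean 0)) has_real_derivative profile_mean 0 t) (at t within {-1..t + 1})"
    by (rule integral_has_real_derivative) (use assms in \<open>auto intro: continuous_on_profile_mean\<close>)
  then have "((\<lambda>t. integral {-1..t} (profile_mean 0)) has_real_derivative profile_mean 0 t) (at t)"
    using assms by (simp add: at_within_Icc_at)
  then show ?thesis unfolding green_profile_def[abs_def]
    by (rule DERIV_cong[OF DERIV_diff[OF _ DERIV_const]]) simp
qed

lemma green_profile_eq_0: assumes "4 \<le> t" shows "green_profile t = 0"
proof -
  have "integral {-1..4} (profile_mean 0) + integral {4..t} (profile_mean 0) = integral {-1..t} (profile_mean 0)"
    by (rule Henstock_Kurzweil_Integration.integral_combine)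
       (use assms in \<open>auto intro: integrable_continuous_real continuous_on_profile_mean\<close>)
  moreover have "integral {4..t} (profile_mean 0) = integral {4..t} (\<lambda>_. 0::real)"
    by (rule integral_cong) (simp add: profile_mean_eq_0)
  ultimately show ?thesis by (simp add: green_profile_def)
qed

lemma green_profile_mono: assumes "0 \<le> s" "s \<le> t" shows "green_profile s \<le> green_profile t"
proof (rule DERIV_nonneg_imp_nondecreasing[OF assms(2)])
  fix x assume "s \<le> x" "x \<le> t"
  then show "\<exists>y. (green_profile has_real_derivative y) (at x) \<and> 0 \<le> y"
    using DERIV_green_profile[of x] profile_mean_nonneg[of x] assms(1) by (intro exI[of _ "profile_mean 0 x"]) simp
qed

lemma green_profile_nonpos: assumes "0 \<le> t" shows "green_profile t \<le> 0"
  using green_profile_mono[of t 4] green_profile_eq_0[of 4] green_profile_eq_0[of t] assms by (cases "t \<le> 4") auto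

lemma green_profile_neg: "green_profile 1 < 0"
proof -
  have "green_profile 1 < green_profile 4"
  proof (rule DERIV_pos_imp_increasing_open[where f = green_profile])
    show "\<exists>y. (green_profile has_real_derivative y) (at x) \<and> 0 < y" if "1 < x" "x < 4" for x
      using DERIV_green_profile[of x] profile_mean_pos[of x] that by (intro exI[of _ "profile_mean 0 x"]) simp
    show "continuous_on {1..4} green_profile"
      by (rule DERIV_continuous_on[where D = "profile_mean 0"])
         (rule has_field_derivative_at_within[OF DERIV_green_profile], simp)
  qed simp
  then show ?thesis by (simp add: green_profile_eq_0)
qed

section \<open>The kernels\<close>

lemma smooth_norm_sq: "smooth (\<lambda>x::real^'n::finite. (norm x)\<^sup>2)"
proof -
  have "(\<lambda>x::real^'n. (norm x)\<^sup>2) = (\<lambda>x. \<Sum>i\<in>UNIV. x $ i * x $ i)"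
    by (simp add: power2_norm_eq_inner inner_vec_def)
  then show ?thesis by (simp add: smooth_sum smooth_mult smooth_nth)
qed

lemma partial_deriv_norm_sq: "partial_deriv i (\<lambda>x::real^'n::finite. (norm x)\<^sup>2) = (\<lambda>x. 2 * x $ i)"
proof
  fix x :: "real^'n"
  have "((\<lambda>x::real^'n. (norm x)\<^sup>2) has_derivative (\<lambda>h. 2 * (x \<bullet> h))) (at x)"
    unfolding power2_norm_eq_inner by (auto intro!: derivative_eq_intros simp: inner_commute)
  from partial_deriv_eq[OF this, of i]
  show "partial_deriv i (\<lambda>x::real^'n. (norm x)\<^sup>2) x = 2 * x $ i" by (simp add: inner_axis)
qed

lemma laplacian_norm_sq: "laplacian (\<lambda>x::real^'n::finite. (norm x)\<^sup>2) x = 2 * CARD('n)"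
  by (simp add: laplacian_def partial_deriv_norm_sq partial_deriv_cmult differentiable_nth partial_deriv_nth)

lemma sum_partial_deriv_norm_sq:
  "(\<Sum>i\<in>UNIV. (partial_deriv i (\<lambda>x::real^'n::finite. (norm x)\<^sup>2) x)\<^sup>2) = 4 * (norm x)\<^sup>2"
  unfolding partial_deriv_norm_sq
  by (simp add: power_mult_distrib sum_distrib_left[symmetric]
      power2_norm_eq_inner inner_vec_def power2_eq_square[of "_ $ _"])

text \<open>The factor 4 is that of the planar formula \<open>\<Delta> e(\<bar>x\<bar>\<^sup>2) = 4 (t e'(t))'\<close> at \<open>t = \<bar>x\<bar>\<^sup>2\<close>.\<close>
definition bump :: "real^2 \<Rightarrow> real" where
  "bump x = 4 * profile 0 ((norm x)\<^sup>2)"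

definition mollifier :: "real^2 \<Rightarrow> real" where
  "mollifier x = bump x / (LINT y|lebesgue. bump y)"

text \<open>A truncated version of the fundamental solution: the difference of the logarithmic potentials of
  the mollifier at the scales 1 and 2.\<close>
definition green :: "real^2 \<Rightarrow> real" where
  "green x = green_profile ((norm x)\<^sup>2) / (LINT y|lebesgue. bump y)"

lemma test_function_bump: "test_function bump"
proof -
  have "smooth (\<lambda>x::real^2. profile 0 ((norm x)\<^sup>2))"
    by (rule smooth_compose[OF smooth_norm_sq]) (rule DERIV_profile)
  then have "smooth bump" unfolding bump_def[abs_def] by (rule smooth_cmult)
  moreover have "\<forall>x. 1 \<le> norm x \<longrightarrow> bump x = 0" by (simp add: bump_def profile_eq_0)
  ultimately show ?thesis unfolding test_function_iff by blast
qed

lemma integral_bump_pos: "0 < (LINT y|lebesgue. bump y)"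
proof -
  let ?c = "4 * profile 0 (1/4)"
  have c: "0 < ?c" using profile_pos[of "1/4"] by simp
  have "?c * measure lebesgue (cball (0::real^2) (1/2)) = (LINT y|lebesgue. ?c * indicator (cball (0::real^2) (1/2)) y)"
    by simp
  also have "\<dots> \<le> (LINT y|lebesgue. bump y)"
  proof (rule integral_mono)
    show "integrable lebesgue (\<lambda>y. ?c * indicator (cball (0::real^2) (1/2)) y)"
      using emeasure_bounded_finite[of "cball (0::real^2) (1/2)"]
      by (intro integrable_mult_right integrable_real_indicator) simp_all
    show "integrable lebesgue bump"
      using integrable_mult_test[OF locally_integrable_const[of 1] test_function_bump] by simp
    fix y :: "real^2"
    show "?c * indicator (cball 0 (1/2)) y \<le> bump y"
    proof (cases "y \<in> cball 0 (1/2)")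
      case True
      then have "(norm y)\<^sup>2 \<le> (1/2)\<^sup>2" by (intro power_mono) auto
      then have "(norm y)\<^sup>2 \<le> 1/4" by (simp add: power2_eq_square)
      then show ?thesis using True by (simp add: bump_def profile_antimono)
    qed (simp add: bump_def profile_nonneg)
  qed
  finally have "?c * measure lebesgue (cball (0::real^2) (1/2)) \<le> (LINT y|lebesgue. bump y)" .
  moreover have "0 < measure lebesgue (cball (0::real^2) (1/2))" by (simp add: content_cball_pos)
  ultimately show ?thesis using c by (meson less_le_trans mult_pos_pos)
qed

lemma test_function_cmult: "test_function \<phi> \<Longrightarrow> test_function (\<lambda>x. c * \<phi> x)"
  by (rule test_function_mult[OF smooth_const])

lemma test_function_mollifier: "test_function mollifier"
  unfolding mollifier_def[abs_def] divide_inverse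
  using test_function_cmult[OF test_function_bump, of "inverse (LINT y|lebesgue. bump y)"]
  by (simp add: mult.commute)

lemma mollifier_nonneg: "0 \<le> mollifier x"
  using integral_bump_pos by (simp add: mollifier_def bump_def profile_nonneg)

lemma mollifier_eq_0: "1 \<le> norm x \<Longrightarrow> mollifier x = 0"
  by (simp add: mollifier_def bump_def profile_eq_0)

lemma integral_mollifier: "(LINT x|lebesgue. mollifier x) = 1"
  using integral_bump_pos by (simp add: mollifier_def)

lemma mollifier_lower_bound:
  obtains c where "0 < c" "\<And>x. norm x \<le> 1/2 \<Longrightarrow> c \<le> mollifier x"
proof (rule that[of "4 * profile 0 (1/4) / (LINT y|lebesgue. bump y)"])
  show "0 < 4 * profile 0 (1/4) / (LINT y|lebesgue. bump y)"
    using integral_bump_pos profile_pos[of "1/4"] by simp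
  fix x :: "real^2" assume "norm x \<le> 1/2"
  then have "(norm x)\<^sup>2 \<le> (1/2)\<^sup>2" by (intro power_mono) auto
  then have "(norm x)\<^sup>2 \<le> 1/4" by (simp add: power2_eq_square)
  then show "4 * profile 0 (1/4) / (LINT y|lebesgue. bump y) \<le> mollifier x"
    using integral_bump_pos by (simp add: mollifier_def bump_def divide_right_mono profile_antimono)
qed

lemma green_derivatives:
  "((case n of 0 \<Rightarrow> green_profile | Suc n \<Rightarrow> profile_mean n) has_real_derivative profile_mean n t) (at t)"
  if "t \<ge> 0" using that DERIV_green_profile[of t] DERIV_profile_mean by (cases n) simp_all

lemma test_function_green: "test_function green"
proof -
  have "smooth (\<lambda>x::real^2. (case 0 of 0 \<Rightarrow> green_profile | Suc n \<Rightarrow> profile_mean n) ((norm x)\<^sup>2))"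
    by (rule smooth_compose[OF smooth_norm_sq, where d = "\<lambda>n. case n of 0 \<Rightarrow> green_profile | Suc n \<Rightarrow> profile_mean n"])
       (use green_derivatives in simp)
  then have "smooth (\<lambda>x::real^2. inverse (LINT y|lebesgue. bump y) * green_profile ((norm x)\<^sup>2))"
    by (intro smooth_cmult) simp
  then have "smooth green" unfolding green_def[abs_def] by (simp add: divide_inverse mult.commute)
  moreover have "\<forall>x. 2 \<le> norm x \<longrightarrow> green x = 0"
  proof (intro allI impI)
    fix x :: "real^2" assume "2 \<le> norm x"
    then have "2\<^sup>2 \<le> (norm x)\<^sup>2" by (intro power_mono) auto
    then show "green x = 0" by (simp add: green_def green_profile_eq_0)
  qed
  ultimately show ?thesis unfolding test_function_iff by blast
qed

lemma green_nonpos: "green x \<le> 0"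
  using integral_bump_pos green_profile_nonpos[of "(norm x)\<^sup>2"] by (simp add: green_def divide_nonpos_pos)

lemma green_eq_0: assumes "2 \<le> norm x" shows "green x = 0"
proof -
  have "2\<^sup>2 \<le> (norm x)\<^sup>2" using assms by (intro power_mono) auto
  then show "green x = 0" by (simp add: green_def green_profile_eq_0)
qed

lemma green_upper_bound:
  obtains c where "0 < c" "\<And>x. norm x \<le> 1 \<Longrightarrow> c \<le> - green x"
proof (rule that[of "- green_profile 1 / (LINT y|lebesgue. bump y)"])
  show "0 < - green_profile 1 / (LINT y|lebesgue. bump y)"
    using integral_bump_pos green_profile_neg by (simp add: divide_neg_pos)
  fix x :: "real^2" assume "norm x \<le> 1"
  then have "(norm x)\<^sup>2 \<le> 1" by (simp add: power_le_one)
  then have "green_profile ((norm x)\<^sup>2) \<le> green_profile 1" by (intro green_profile_mono) auto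
  then show "- green_profile 1 / (LINT y|lebesgue. bump y) \<le> - green x"
    using integral_bump_pos by (simp add: green_def divide_right_mono)
qed

text \<open>For a radial function \<open>e(\<bar>x\<bar>\<^sup>2)\<close> the Laplacian is \<open>4 (t e'(t))'\<close> at \<open>t = \<bar>x\<bar>\<^sup>2\<close>. Here \<open>e'\<close> is
  \<open>profile_mean 0\<close>, and \<open>profile_mean_identity\<close> evaluates the derivative.\<close>
lemma laplacian_green: "laplacian green x = mollifier x - mollifier (x /\<^sub>R 2) / 4"
proof -
  let ?c = "LINT y|lebesgue. bump y"
  have e: "green = (\<lambda>x. (\<lambda>t. green_profile t / ?c) ((norm x)\<^sup>2))" by (simp add: green_def[abs_def])
  have "laplacian green x = profile_mean 0 ((norm x)\<^sup>2) / ?c * laplacian (\<lambda>x::real^2. (norm x)\<^sup>2) x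
     + profile_mean 1 ((norm x)\<^sup>2) / ?c * (\<Sum>i\<in>UNIV. (partial_deriv i (\<lambda>x::real^2. (norm x)\<^sup>2) x)\<^sup>2)"
    unfolding e
  proof (rule laplacian_compose[OF smooth_norm_sq, where h' = "\<lambda>t. profile_mean 0 t / ?c" and h'' = "\<lambda>t. profile_mean 1 t / ?c"])
    show "((\<lambda>t. green_profile t / ?c) has_real_derivative profile_mean 0 ((norm x)\<^sup>2) / ?c) (at ((norm x)\<^sup>2))" for x :: "real^2"
      by (intro DERIV_cdivide DERIV_green_profile) (meson less_le_trans neg_less_0_iff_less zero_le_power2 zero_less_one)
    show "((\<lambda>t. profile_mean 0 t / ?c) has_real_derivative profile_mean 1 ((norm x)\<^sup>2) / ?c) (at ((norm x)\<^sup>2))" for x :: "real^2"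
      using DERIV_cdivide[OF DERIV_profile_mean[of 0]] by simp
  qed
  also have "\<dots> = 4 * (profile_mean 0 ((norm x)\<^sup>2) + (norm x)\<^sup>2 * profile_mean 1 ((norm x)\<^sup>2)) / ?c"
    by (simp add: laplacian_norm_sq sum_partial_deriv_norm_sq field_simps add_divide_distrib)
  also have "\<dots> = mollifier x - mollifier (x /\<^sub>R 2) / 4"
  proof -
    have "bump (x /\<^sub>R 2) = 4 * profile 0 ((norm x)\<^sup>2 / 4)"
      by (simp add: bump_def power_divide)
    moreover have "bump x = 4 * profile 0 ((norm x)\<^sup>2)" by (simp add: bump_def)
    ultimately show ?thesis
      unfolding profile_mean_identity mollifier_def
      by (simp add: diff_divide_distrib right_diff_distrib)
  qed
  finally show ?thesis .
qed

section \<open>Fubini's theorem and functions with vanishing integrals\<close>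

lemma locally_integrable_borel_version:
  fixes h :: "real^'n::finite \<Rightarrow> real"
  assumes "locally_integrable h"
  obtains h' where "h' \<in> borel_measurable borel" "AE x in lebesgue. h x = h' x" "locally_integrable h'"
proof -
  obtain h' where h': "h' \<in> borel_measurable lborel" "AE x in lborel. h x = h' x"
    using completion_ex_borel_measurable_real[OF locally_integrable_measurable[OF assms]] by blast
  have b: "h' \<in> borel_measurable borel" using h'(1) by simp
  have ae: "AE x in lebesgue. h x = h' x" using AE_completion[OF h'(2)] .
  have "locally_integrable h'"
    by (rule locally_integrable_cong_AE[OF assms ae borel_lebesgue[OF b]])
  then show thesis using that b ae by blast
qed

lemma integral_lebesgue_lborel:
  "f \<in> borel_measurable borel \<Longrightarrow> (LINT x|lebesgue. f x) = (LINT x|lborel. f x)"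
  for f :: "real^'n::finite \<Rightarrow> real"
  by (rule integral_completion) simp

lemma integrable_lebesgue_lborel:
  "f \<in> borel_measurable borel \<Longrightarrow> integrable lebesgue f = integrable lborel f"
  for f :: "real^'n::finite \<Rightarrow> real"
  by (rule integrable_completion) simp

lemma integrable_product_lborel:
  fixes k g :: "real^'n::finite \<Rightarrow> real"
  assumes k: "integrable lborel k" and g: "integrable lborel g"
  shows "integrable (lborel \<Otimes>\<^sub>M lborel) (\<lambda>p. k (fst p) * g (snd p))"
proof (rule lborel_pair.Fubini_integrable)
  have [measurable]: "k \<in> borel_measurable lborel" "g \<in> borel_measurable lborel" using k g by auto
  show "(\<lambda>p. k (fst p) * g (snd p)) \<in> borel_measurable (lborel \<Otimes>\<^sub>M lborel)" by measurable
  have "integrable lborel (\<lambda>x. \<bar>k x\<bar> * (LINT y|lborel. \<bar>g y\<bar>))" using k by simp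
  then show "integrable lborel (\<lambda>x. LINT y|lborel. norm (k (fst (x, y)) * g (snd (x, y))))"
    by (simp add: abs_mult)
  show "AE x in lborel. integrable lborel (\<lambda>y. k (fst (x, y)) * g (snd (x, y)))" using g by simp
qed

text \<open>The integrand in both variables is measurable for the product of the Borel algebras only if \<open>h\<close> is
  Borel measurable, so \<open>h\<close> is first modified on a null set.\<close>
lemma conv_Fubini:
  fixes h :: "real^'n::finite \<Rightarrow> real"
  assumes h: "locally_integrable h" and \<kappa>: "test_function \<kappa>"
    and b: "b \<in> borel_measurable borel" "\<And>x. \<bar>b x\<bar> \<le> B" "\<And>x. x \<notin> cball 0 R \<Longrightarrow> b x = 0"
  shows "(LINT x|lebesgue. conv h \<kappa> x * b x) = (LINT y|lebesgue. h y * (LINT x|lebesgue. \<kappa> (x - y) * b x))"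
proof -
  obtain h' where h': "h' \<in> borel_measurable borel" "AE x in lebesgue. h x = h' x" "locally_integrable h'"
    by (rule locally_integrable_borel_version[OF h])
  obtain r where r: "\<And>x. r \<le> norm x \<Longrightarrow> \<kappa> x = 0" using \<kappa> unfolding test_function_iff by blast
  obtain C where C: "C > 0" "\<And>x. \<bar>\<kappa> x\<bar> \<le> C" using test_function_bounded[OF \<kappa>] by blast
  have \<kappa>b: "\<kappa> \<in> borel_measurable borel" by (rule test_function_borel[OF \<kappa>])
  note [measurable] = h'(1) b(1) \<kappa>b
  have B: "0 \<le> B" using b(2)[of 0] by linarith
  let ?k = "\<lambda>x::real^'n. C * B * indicator (cball 0 R) x"
  let ?g = "\<lambda>y. indicator (cball 0 (R + r)) y * h' y"
  let ?F = "\<lambda>x y. h' y * \<kappa> (x - y) * b x"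
  have int_k: "integrable lborel ?k"
    using emeasure_bounded_finite[of "cball (0::real^'n) R"]
    by (intro integrable_mult_right integrable_real_indicator) simp_all
  have int_g: "integrable lborel ?g"
  proof -
    have "?g \<in> borel_measurable borel"
      by (intro borel_measurable_times h'(1) borel_measurable_indicator) simp
    then show ?thesis
      using locally_integrable_cball[OF h'(3), of 0 "R + r"] integrable_lebesgue_lborel by blast
  qed
  have F: "integrable (lborel \<Otimes>\<^sub>M lborel) (case_prod ?F)"
  proof (rule Bochner_Integration.integrable_bound[OF integrable_product_lborel[OF int_k int_g]])
    show "(\<lambda>(x, y). ?F x y) \<in> borel_measurable (lborel \<Otimes>\<^sub>M lborel)" by measurable
    show "AE p in lborel \<Otimes>\<^sub>M lborel. norm (case p of (x, y) \<Rightarrow> ?F x y) \<le> norm (?k (fst p) * ?g (snd p))"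
    proof (rule AE_I2)
      fix p :: "(real^'n) \<times> (real^'n)"
      obtain x y where p: "p = (x, y)" by (cases p)
      have "\<bar>?F x y\<bar> \<le> \<bar>?k x * ?g y\<bar>"
      proof (cases "x \<in> cball 0 R \<and> y \<in> cball 0 (R + r)")
        case True
        have "\<bar>?F x y\<bar> = (\<bar>\<kappa> (x - y)\<bar> * \<bar>b x\<bar>) * \<bar>h' y\<bar>" by (simp add: abs_mult)
        also have "\<dots> \<le> (C * B) * \<bar>h' y\<bar>" using C b(2)[of x] by (intro mult_right_mono mult_mono) auto
        finally show ?thesis using True C(1) B by (simp add: abs_mult)
      next
        case False
        have "?F x y = 0"
        proof (cases "x \<in> cball 0 R")
          case True
          then have y: "R + r < norm y" "norm x \<le> R" using False by auto
          have "norm y - norm x \<le> norm (x - y)" by (metis norm_minus_commute norm_triangle_ineq2)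
          then have "r \<le> norm (x - y)" using y by linarith
          then show ?thesis using r by simp
        qed (simp add: b(3))
        then show ?thesis by (simp only: abs_zero abs_ge_zero)
      qed
      then show "norm (case p of (x, y) \<Rightarrow> ?F x y) \<le> norm (?k (fst p) * ?g (snd p))" by (simp add: p)
    qed
  qed
  have 1: "conv h \<kappa> x = (LINT y|lborel. h' y * \<kappa> (x - y))" for x
  proof -
    have "conv h \<kappa> x = conv h' \<kappa> x"
      by (rule conv_cong_AE[OF h'(2) locally_integrable_measurable[OF h] borel_lebesgue[OF h'(1)] \<kappa>])
    also have "\<dots> = (LINT y|lborel. h' y * \<kappa> (x - y))" unfolding conv_def by (rule integral_lebesgue_lborel) simp
    finally show ?thesis .
  qed
  have 2: "(LINT x|lebesgue. \<kappa> (x - y) * b x) = (LINT x|lborel. \<kappa> (x - y) * b x)" for y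
    by (rule integral_lebesgue_lborel) simp
  have 3: "(\<lambda>y. LINT x|lborel. \<kappa> (x - y) * b x) \<in> borel_measurable borel"
    using lborel.borel_measurable_lebesgue_integral[of "\<lambda>y x. \<kappa> (x - y) * b x" borel] by measurable
  have "(LINT x|lebesgue. conv h \<kappa> x * b x) = (LINT x|lborel. conv h \<kappa> x * b x)"
    by (rule integral_lebesgue_lborel)
       (use b(1) smooth_borel[OF smooth_conv[OF h \<kappa>]] in \<open>intro borel_measurable_times\<close>)
  also have "\<dots> = (LINT x|lborel. (LINT y|lborel. ?F x y))" by (simp add: 1 mult.commute[of _ "b _"])
  also have "\<dots> = (LINT y|lborel. (LINT x|lborel. ?F x y))"
    by (rule lborel_pair.Fubini_integral[OF F, symmetric])
  also have "\<dots> = (LINT y|lborel. h' y * (LINT x|lborel. \<kappa> (x - y) * b x))" by (simp add: mult.assoc)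
  also have "\<dots> = (LINT y|lebesgue. h' y * (LINT x|lborel. \<kappa> (x - y) * b x))"
    by (rule integral_lebesgue_lborel[symmetric]) (intro borel_measurable_times h'(1) 3)
  also have "\<dots> = (LINT y|lebesgue. h y * (LINT x|lborel. \<kappa> (x - y) * b x))"
  proof (rule integral_cong_AE)
    show "AE y in lebesgue. h' y * (LINT x|lborel. \<kappa> (x - y) * b x) = h y * (LINT x|lborel. \<kappa> (x - y) * b x)"
      using h'(2) by (rule eventually_mono) simp
    show "(\<lambda>y. h' y * (LINT x|lborel. \<kappa> (x - y) * b x)) \<in> borel_measurable lebesgue"
      by (intro borel_measurable_times borel_lebesgue h'(1) 3)
    show "(\<lambda>y. h y * (LINT x|lborel. \<kappa> (x - y) * b x)) \<in> borel_measurable lebesgue"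
      by (intro borel_measurable_times borel_lebesgue[OF 3] locally_integrable_measurable[OF h])
  qed
  finally show ?thesis by (simp only: 2)
qed

text \<open>On a fixed box the positive and the negative part of \<open>h\<close> are densities of two finite measures
  that agree on all open boxes. Open boxes are stable under intersection and generate the Borel sets,
  so the measures and therefore the densities coincide.\<close>
lemma AE_eq_0_if_box_integrals_eq_0:
  fixes h :: "real^'n::finite \<Rightarrow> real"
  assumes h: "locally_integrable h" and z: "\<And>a b. (LINT x:box a b|lebesgue. h x) = 0"
  shows "AE x in lebesgue. h x = 0"
proof -
  obtain h' where h': "h' \<in> borel_measurable borel" "AE x in lebesgue. h x = h' x" "locally_integrable h'"
    by (rule locally_integrable_borel_version[OF h])
  note [measurable] = h'(1)
  have set_int: "integrable lborel (\<lambda>x. indicator (box a b) x * h' x)" for a b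
  proof -
    have "set_integrable lebesgue (cbox a b) h'" using h'(3) unfolding locally_integrable_def by simp
    then have "set_integrable lebesgue (box a b) h'"
      by (rule set_integrable_subset) (auto simp: box_subset_cbox)
    then show ?thesis unfolding set_integrable_def by (subst integrable_lebesgue_lborel[symmetric]) simp_all
  qed
  have z': "(LINT x|lborel. indicator (box a b) x * h' x) = 0" for a b
  proof -
    have "(LINT x|lebesgue. indicator (box a b) x * h' x) = (LINT x|lebesgue. indicator (box a b) x * h x)"
    proof (rule integral_cong_AE)
      show "AE x in lebesgue. indicator (box a b) x * h' x = indicator (box a b) x * h x"
        using h'(2) by (rule eventually_mono) simp
      show "(\<lambda>x. indicator (box a b) x * h' x) \<in> borel_measurable lebesgue"
        by (rule borel_lebesgue) measurable
      show "(\<lambda>x. indicator (box a b) x * h x) \<in> borel_measurable lebesgue"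
        by (intro borel_measurable_times locally_integrable_measurable[OF h] borel_lebesgue) measurable
    qed
    also have "\<dots> = 0" using z[of a b] by (simp add: set_lebesgue_integral_def)
    finally show ?thesis by (subst (asm) integral_lebesgue_lborel) simp_all
  qed
  have main: "AE x in lborel. x \<in> box l u \<longrightarrow> h' x = 0" for l u :: "real^'n"
  proof -
    let ?p = "\<lambda>x. ennreal (indicator (box l u) x * max 0 (h' x))"
    let ?n = "\<lambda>x. ennreal (indicator (box l u) x * max 0 (- h' x))"
    have int_p: "integrable lborel (\<lambda>x. indicator (box a b) x * max 0 (h' x))"
      and int_n: "integrable lborel (\<lambda>x. indicator (box a b) x * max 0 (- h' x))" for a b
      by (rule Bochner_Integration.integrable_bound[OF set_int[of a b]]; auto simp: indicator_def)+
    have em: "emeasure (density lborel ?p) (box a b) = emeasure (density lborel ?n) (box a b)" for a b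
    proof -
      obtain a' b' where ab: "box a b \<inter> box l u = box a' b'" using box_Int_box by blast
      have mem: "x \<in> box a' b' \<longleftrightarrow> x \<in> box a b \<and> x \<in> box l u" for x using ab by blast
      have "emeasure (density lborel ?p) (box a b) = (\<integral>\<^sup>+x. ennreal (indicator (box a' b') x * max 0 (h' x)) \<partial>lborel)"
        by (subst emeasure_density) (auto intro!: nn_integral_cong simp: mem indicator_def)
      also have "\<dots> = ennreal (LINT x|lborel. indicator (box a' b') x * max 0 (h' x))"
        by (rule nn_integral_eq_integral[OF int_p]) simp
      also have "(LINT x|lborel. indicator (box a' b') x * max 0 (h' x)) = (LINT x|lborel. indicator (box a' b') x * max 0 (- h' x))"
      proof -
        have "(LINT x|lborel. indicator (box a' b') x * max 0 (h' x)) - (LINT x|lborel. indicator (box a' b') x * max 0 (- h' x))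
          = (LINT x|lborel. indicator (box a' b') x * max 0 (h' x) - indicator (box a' b') x * max 0 (- h' x))"
          by (rule Bochner_Integration.integral_diff[OF int_p int_n, symmetric])
        also have "\<dots> = (LINT x|lborel. indicator (box a' b') x * h' x)"
          by (rule Bochner_Integration.integral_cong) (auto simp: max_def indicator_def)
        finally show ?thesis using z'[of a' b'] by simp
      qed
      also have "ennreal (LINT x|lborel. indicator (box a' b') x * max 0 (- h' x)) = (\<integral>\<^sup>+x. ennreal (indicator (box a' b') x * max 0 (- h' x)) \<partial>lborel)"
        by (rule nn_integral_eq_integral[OF int_n, symmetric]) simp
      also have "\<dots> = emeasure (density lborel ?n) (box a b)"
        by (subst emeasure_density) (auto intro!: nn_integral_cong simp: mem indicator_def)
      finally show ?thesis .
    qed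
    have fin: "integral\<^sup>N lborel ?p \<noteq> \<infinity>"
      by (subst nn_integral_eq_integral[OF int_p]) simp_all
    have "density lborel ?p = density lborel ?n"
    proof (rule measure_eqI_generator_eq)
      let ?E = "range (\<lambda>(a, b). box a b::(real^'n) set)"
      show "Int_stable ?E" by (auto simp: Int_stable_def box_Int_box)
      show "?E \<subseteq> Pow UNIV" by simp
      show "sets (density lborel ?p) = sigma_sets UNIV ?E" "sets (density lborel ?n) = sigma_sets UNIV ?E"
        by (simp_all add: borel_eq_box)
      let ?A = "\<lambda>n::nat. box (- (real n *\<^sub>R One)) (real n *\<^sub>R One) :: (real^'n) set"
      show "range ?A \<subseteq> ?E" "(\<Union>i. ?A i) = UNIV" unfolding UN_box_eq_UNIV by auto
      show "emeasure (density lborel ?p) (?A i) \<noteq> \<infinity>" for i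
      proof -
        have "emeasure (density lborel ?p) (?A i) \<le> integral\<^sup>N lborel ?p"
          by (subst emeasure_density) (auto intro!: nn_integral_mono simp: indicator_def)
        then show ?thesis using fin by (auto simp: top_unique)
      qed
      show "emeasure (density lborel ?p) X = emeasure (density lborel ?n) X" if "X \<in> ?E" for X
        using that em by auto
    qed
    then have "AE x in lborel. ?p x = ?n x"
      by (subst (asm) finite_density_unique) (use fin in auto)
    then show ?thesis
    proof (rule eventually_mono)
      fix x assume "?p x = ?n x"
      then have "indicator (box l u) x * max 0 (h' x) = indicator (box l u) x * max 0 (- h' x)"
        by (subst (asm) ennreal_inj) simp_all
      then show "x \<in> box l u \<longrightarrow> h' x = 0" by (auto simp: max_def split: if_splits)
    qed
  qed
  have "AE x in lborel. \<forall>n::nat. x \<in> box (- (real n *\<^sub>R One)) (real n *\<^sub>R One) \<longrightarrow> h' x = 0"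
    unfolding AE_all_countable using main by blast
  then have "AE x in lborel. h' x = 0"
  proof (rule eventually_mono)
    fix x assume *: "\<forall>n::nat. x \<in> box (- (real n *\<^sub>R One)) (real n *\<^sub>R One) \<longrightarrow> h' x = 0"
    have "x \<in> (\<Union>n::nat. box (- (real n *\<^sub>R One)) (real n *\<^sub>R One))" unfolding UN_box_eq_UNIV by simp
    then show "h' x = 0" using * by blast
  qed
  then have "AE x in lebesgue. h' x = 0" by (rule AE_completion)
  with h'(2) show ?thesis by eventually_elim simp
qed

section \<open>Dilations\<close>

definition dilate :: "real \<Rightarrow> (real^2 \<Rightarrow> real) \<Rightarrow> real^2 \<Rightarrow> real" where
  "dilate s \<kappa> x = \<kappa> (x /\<^sub>R s)"

lemma dilate_affine: "dilate s \<kappa> = (\<lambda>x. \<kappa> (0 + inverse s *\<^sub>R x))"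
  by (simp add: dilate_def[abs_def])

lemma norm_scaleR_inverse: "0 < s \<Longrightarrow> norm (z /\<^sub>R s) = norm z / s"
  by (simp add: divide_inverse mult.commute)

lemma test_function_dilate: "test_function \<kappa> \<Longrightarrow> s \<noteq> 0 \<Longrightarrow> test_function (dilate s \<kappa>)"
  unfolding dilate_affine by (rule test_function_affine) simp_all

lemma partial_deriv_dilate:
  "smooth \<kappa> \<Longrightarrow> partial_deriv i (dilate s \<kappa>) = (\<lambda>x. dilate s (partial_deriv i \<kappa>) x / s)"
  unfolding dilate_affine
  by (rule ext, subst partial_deriv_affine(1)) (simp_all add: smooth_differentiable field_simps)

lemma laplacian_dilate: "smooth \<kappa> \<Longrightarrow> laplacian (dilate s \<kappa>) x = laplacian \<kappa> (x /\<^sub>R s) / s\<^sup>2"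
  unfolding dilate_affine by (subst laplacian_affine) (simp_all add: field_simps)

lemma conv_diff:
  assumes h: "locally_integrable h" and "test_function \<kappa>" "test_function \<kappa>'"
  shows "conv h (\<lambda>z. \<kappa> z - \<kappa>' z) x = conv h \<kappa> x - conv h \<kappa>' x"
  unfolding conv_def right_diff_distrib
  by (intro Bochner_Integration.integral_diff integrable_conv assms)

lemma conv_divide: "conv h (\<lambda>z. \<kappa> z / c) x = conv h \<kappa> x / c"
  by (simp add: conv_def)

section \<open>Constants of the kernels\<close>

text \<open>All constants below are expressed by two numbers: an upper bound for the two kernels and their
  derivatives up to second order, and a lower bound for \<open>mollifier\<close> and \<open>- green\<close> in the inner half
  of their supports.\<close>
definition kernel_bound :: real where
  "kernel_bound = (SOME C. 1 \<le> C \<and> (\<forall>\<kappa>\<in>{mollifier, green}. \<forall>x i j.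
     \<bar>\<kappa> x\<bar> \<le> C \<and> \<bar>partial_deriv i \<kappa> x\<bar> \<le> C \<and> \<bar>partial_deriv j (partial_deriv i \<kappa>) x\<bar> \<le> C))"

definition kernel_floor :: real where
  "kernel_floor = (SOME c. 0 < c \<and> (\<forall>x. norm x \<le> 1/2 \<longrightarrow> c \<le> mollifier x) \<and> (\<forall>x. norm x \<le> 1 \<longrightarrow> c \<le> - green x))"

lemma kernel_bound:
  shows kernel_bound_ge_1: "1 \<le> kernel_bound"
    and mollifier_bound: "\<bar>mollifier x\<bar> \<le> kernel_bound" "\<bar>partial_deriv i mollifier x\<bar> \<le> kernel_bound"
      "\<bar>partial_deriv j (partial_deriv i mollifier) x\<bar> \<le> kernel_bound"
    and green_bound: "\<bar>green x\<bar> \<le> kernel_bound" "\<bar>partial_deriv i green x\<bar> \<le> kernel_bound"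
      "\<bar>partial_deriv j (partial_deriv i green) x\<bar> \<le> kernel_bound"
proof -
  let ?P = "\<lambda>C \<kappa>. \<forall>x::real^2. \<forall>i j. \<bar>\<kappa> x\<bar> \<le> C \<and> \<bar>partial_deriv i \<kappa> x\<bar> \<le> C \<and> \<bar>partial_deriv j (partial_deriv i \<kappa>) x\<bar> \<le> C"
  obtain C1 where 1: "?P C1 mollifier" using test_function_C2_bounded[OF test_function_mollifier] by blast
  obtain C2 where 2: "?P C2 green" using test_function_C2_bounded[OF test_function_green] by blast
  have mono: "?P (max 1 (max C1 C2)) \<kappa>" if "?P C \<kappa>" "C \<in> {C1, C2}" for C and \<kappa> :: "real^2 \<Rightarrow> real"
    using that by (auto simp: le_max_iff_disj)
  have "\<exists>C. 1 \<le> C \<and> (\<forall>\<kappa>\<in>{mollifier, green}. ?P C \<kappa>)"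
    using mono[OF 1] mono[OF 2] by (intro exI[of _ "max 1 (max C1 C2)"]) simp
  then have *: "1 \<le> kernel_bound \<and> (\<forall>\<kappa>\<in>{mollifier, green}. ?P kernel_bound \<kappa>)"
    unfolding kernel_bound_def by (rule someI_ex)
  then show "1 \<le> kernel_bound" by (rule conjunct1)
  have m: "?P kernel_bound mollifier" and g: "?P kernel_bound green" using * by simp_all
  show "\<bar>mollifier x\<bar> \<le> kernel_bound" "\<bar>partial_deriv i mollifier x\<bar> \<le> kernel_bound"
      "\<bar>partial_deriv j (partial_deriv i mollifier) x\<bar> \<le> kernel_bound" using m by simp_all
  show "\<bar>green x\<bar> \<le> kernel_bound" "\<bar>partial_deriv i green x\<bar> \<le> kernel_bound"
      "\<bar>partial_deriv j (partial_deriv i green) x\<bar> \<le> kernel_bound" using g by simp_all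
qed

lemma kernel_floor:
  shows kernel_floor_pos: "0 < kernel_floor"
    and mollifier_floor: "norm x \<le> 1/2 \<Longrightarrow> kernel_floor \<le> mollifier x"
    and green_floor: "norm x \<le> 1 \<Longrightarrow> kernel_floor \<le> - green x"
proof -
  obtain c1 where 1: "0 < c1" "\<And>x. norm x \<le> 1/2 \<Longrightarrow> c1 \<le> mollifier x"
    using mollifier_lower_bound by blast
  obtain c2 where 2: "0 < c2" "\<And>x. norm x \<le> 1 \<Longrightarrow> c2 \<le> - green x" using green_upper_bound by blast
  have "0 < min c1 c2 \<and> (\<forall>x. norm x \<le> 1/2 \<longrightarrow> min c1 c2 \<le> mollifier x) \<and> (\<forall>x. norm x \<le> 1 \<longrightarrow> min c1 c2 \<le> - green x)"
    using 1 2 by (simp add: min_le_iff_disj)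
  then have "\<exists>c. 0 < c \<and> (\<forall>x. norm x \<le> 1/2 \<longrightarrow> c \<le> mollifier x) \<and> (\<forall>x. norm x \<le> 1 \<longrightarrow> c \<le> - green x)"
    by blast
  then have *: "0 < kernel_floor \<and> (\<forall>x. norm x \<le> 1/2 \<longrightarrow> kernel_floor \<le> mollifier x)
      \<and> (\<forall>x. norm x \<le> 1 \<longrightarrow> kernel_floor \<le> - green x)"
    unfolding kernel_floor_def by (rule someI_ex)
  then show "0 < kernel_floor" "norm x \<le> 1/2 \<Longrightarrow> kernel_floor \<le> mollifier x"
    "norm x \<le> 1 \<Longrightarrow> kernel_floor \<le> - green x" by simp_all
qed

lemma partial_deriv_eq_0_closed:
  fixes \<phi> :: "real^'n::finite \<Rightarrow> real"
  assumes sm: "smooth \<phi>" and z: "\<And>x. r \<le> norm x \<Longrightarrow> \<phi> x = 0" and r: "0 < r" "r \<le> norm x"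
  shows "partial_deriv i \<phi> x = 0"
proof -
  let ?x = "\<lambda>n. (1 + inverse (real (Suc n))) *\<^sub>R x"
  have "(\<lambda>n. 1 + inverse (real (Suc n))) \<longlonglongrightarrow> 1 + 0"
    by (intro tendsto_add tendsto_const LIMSEQ_inverse_real_of_nat)
  then have "?x \<longlonglongrightarrow> (1 + 0) *\<^sub>R x" by (intro tendsto_scaleR tendsto_const)
  then have "?x \<longlonglongrightarrow> x" by simp
  moreover have "isCont (partial_deriv i \<phi>) x"
    using smooth_differentiable[OF smooth_partial_deriv[OF sm]] by (rule differentiable_imp_continuous_within)
  ultimately have "(\<lambda>n. partial_deriv i \<phi> (?x n)) \<longlonglongrightarrow> partial_deriv i \<phi> x" by (metis isCont_tendsto_compose)
  moreover have "partial_deriv i \<phi> (?x n) = 0" for n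
  proof (rule partial_deriv_eq_0_outside[OF z])
    have "0 < inverse (real (Suc n)) * norm x" using r by (intro mult_pos_pos) auto
    then show "r < norm (?x n)" using r by (simp add: distrib_right abs_of_nonneg)
  qed
  ultimately show ?thesis by (simp add: LIMSEQ_const_iff)
qed

lemma mollifier_derivs_eq_0:
  "1 \<le> norm x \<Longrightarrow> partial_deriv i mollifier x = 0"
  "1 \<le> norm x \<Longrightarrow> partial_deriv j (partial_deriv i mollifier) x = 0"
proof -
  have sm: "smooth mollifier" by (rule test_function_smooth[OF test_function_mollifier])
  have 1: "partial_deriv i mollifier x = 0" if "1 \<le> norm x" for x
    by (rule partial_deriv_eq_0_closed[OF sm mollifier_eq_0 _ that]) simp_all
  show "1 \<le> norm x \<Longrightarrow> partial_deriv i mollifier x = 0" by (rule 1)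
  show "1 \<le> norm x \<Longrightarrow> partial_deriv j (partial_deriv i mollifier) x = 0"
    by (rule partial_deriv_eq_0_closed[OF smooth_partial_deriv[OF sm] 1]) simp_all
qed

lemma green_derivs_eq_0:
  "2 \<le> norm x \<Longrightarrow> partial_deriv i green x = 0"
  "2 \<le> norm x \<Longrightarrow> partial_deriv j (partial_deriv i green) x = 0"
proof -
  have sm: "smooth green" by (rule test_function_smooth[OF test_function_green])
  have 1: "partial_deriv i green x = 0" if "2 \<le> norm x" for x
    by (rule partial_deriv_eq_0_closed[OF sm green_eq_0 _ that]) simp_all
  show "2 \<le> norm x \<Longrightarrow> partial_deriv i green x = 0" by (rule 1)
  show "2 \<le> norm x \<Longrightarrow> partial_deriv j (partial_deriv i green) x = 0"
    by (rule partial_deriv_eq_0_closed[OF smooth_partial_deriv[OF sm] 1]) simp_all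
qed

section \<open>Mass and mean values\<close>

definition mass :: "(real^2 \<Rightarrow> real) \<Rightarrow> real^2 \<Rightarrow> real \<Rightarrow> real" where
  "mass f x r = (LINT y:ball x r|lebesgue. f y)"

lemma locally_integrable_ball:
  fixes f :: "real^'n::finite \<Rightarrow> real"
  assumes "locally_integrable f" shows "set_integrable lebesgue (ball x r) f"
proof -
  have "set_integrable lebesgue (cball x r) f" using assms unfolding locally_integrable_def by simp
  then show ?thesis by (rule set_integrable_subset) (auto simp: ball_subset_cball)
qed

lemma mass_nonneg: "(\<And>y. 0 \<le> f y) \<Longrightarrow> 0 \<le> mass f x r"
  unfolding mass_def set_lebesgue_integral_def by (intro Bochner_Integration.integral_nonneg) simp

lemma mass_subset:
  assumes "locally_integrable f" "\<And>y. 0 \<le> f y" "ball x r \<subseteq> ball x' r'"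
  shows "mass f x r \<le> mass f x' r'"
  unfolding mass_def
  unfolding set_lebesgue_integral_def
proof (rule integral_mono)
  show "integrable lebesgue (\<lambda>y. indicator (ball x r) y *\<^sub>R f y)"
    "integrable lebesgue (\<lambda>y. indicator (ball x' r') y *\<^sub>R f y)"
    using locally_integrable_ball[OF assms(1)] unfolding set_integrable_def by simp_all
  show "indicator (ball x r) y *\<^sub>R f y \<le> indicator (ball x' r') y *\<^sub>R f y" for y
    using assms(2)[of y] assms(3) by (auto simp: indicator_def)
qed

lemma mass_le:
  assumes f: "locally_integrable f" and M: "\<And>y. y \<in> ball x r \<Longrightarrow> f y \<le> M" and r: "0 \<le> r"
  shows "mass f x r \<le> M * (pi * r\<^sup>2)"
proof -
  have i: "set_integrable lebesgue (ball x r) (\<lambda>_. M)"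
    by (rule locally_integrable_ball[OF locally_integrable_const])
  have "mass f x r \<le> (LINT y:ball x r|lebesgue. M)"
    unfolding mass_def by (rule set_integral_mono[OF locally_integrable_ball[OF f] i M])
  also have "\<dots> = M * (pi * r\<^sup>2)"
    using r by (simp add: set_lebesgue_integral_def content_ball unit_ball_vol_2)
  finally show ?thesis .
qed

text \<open>The basic estimate for a convolution: a bounded kernel supported in a disc only sees the mass of the
  density in that disc.\<close>
lemma conv_dilate_bound:
  assumes h: "locally_integrable h" and C: "\<And>z. \<bar>\<kappa> z\<bar> \<le> C" and r: "\<And>z. r \<le> norm z \<Longrightarrow> \<kappa> z = 0"
    and s: "0 < s"
  shows "\<bar>conv h (dilate s \<kappa>) x\<bar> \<le> C * mass (\<lambda>y. \<bar>h y\<bar>) x (r * s)"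
  unfolding conv_def mass_def
proof (rule abs_integral_mult_le[OF h])
  show "\<bar>dilate s \<kappa> (x - y)\<bar> \<le> C" for y by (simp add: dilate_def C)
  fix y assume "y \<notin> ball x (r * s)"
  then have "r * s \<le> norm (x - y)" by (simp add: dist_norm)
  then have "r \<le> norm ((x - y) /\<^sub>R s)" using s by (simp add: norm_scaleR_inverse le_divide_eq del: norm_scaleR)
  then show "dilate s \<kappa> (x - y) = 0" by (simp add: dilate_def r)
qed simp_all

lemma partial_deriv_divide: "smooth f \<Longrightarrow> partial_deriv i (\<lambda>x. f x / c) = (\<lambda>x. partial_deriv i f x / c)"
  using partial_deriv_cmult[OF smooth_differentiable, of f i "inverse c"]
  by (simp add: fun_eq_iff divide_inverse mult.commute)

definition mean :: "real \<Rightarrow> (real^2 \<Rightarrow> real) \<Rightarrow> real^2 \<Rightarrow> real" where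
  "mean s h x = conv h (dilate s mollifier) x / s\<^sup>2"

context
  fixes h :: "real^2 \<Rightarrow> real" and s :: real
  assumes h: "locally_integrable h" and s: "0 < s"
begin

lemma smooth_conv_dilate: "test_function \<kappa> \<Longrightarrow> smooth (conv h (dilate s \<kappa>))"
  using s by (intro smooth_conv h test_function_dilate) simp_all

lemma partial_deriv_conv_dilate:
  assumes "test_function \<kappa>"
  shows "partial_deriv i (conv h (dilate s \<kappa>)) = (\<lambda>x. conv h (dilate s (partial_deriv i \<kappa>)) x / s)"
proof -
  have "test_function (dilate s \<kappa>)" using s assms by (intro test_function_dilate) simp_all
  then show ?thesis
    by (simp add: fun_eq_iff partial_deriv_conv[OF h] partial_deriv_dilate test_function_smooth[OF assms] conv_divide)
qed

lemma smooth_mean: "smooth (mean s h)"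
  using smooth_cmult[OF smooth_conv_dilate[OF test_function_mollifier], of "inverse (s\<^sup>2)"]
  by (simp add: mean_def[abs_def] divide_inverse mult.commute)

lemma partial_deriv_mean: "partial_deriv i (mean s h) = (\<lambda>x. conv h (dilate s (partial_deriv i mollifier)) x / s ^ 3)"
  unfolding mean_def[abs_def]
  by (simp add: partial_deriv_divide smooth_conv_dilate test_function_mollifier partial_deriv_conv_dilate
      power2_eq_square power3_eq_cube mult.assoc)

lemma partial_deriv2_mean:
  "partial_deriv j (partial_deriv i (mean s h)) = (\<lambda>x. conv h (dilate s (partial_deriv j (partial_deriv i mollifier))) x / s ^ 4)"
proof -
  note t = test_function_partial_deriv[OF test_function_mollifier]
  have "s * s ^ 3 = s ^ 4" by (simp add: power_numeral_reduce)
  then show ?thesis unfolding partial_deriv_mean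
    by (simp add: partial_deriv_divide smooth_conv_dilate t partial_deriv_conv_dilate)
qed

lemma mean_nonneg: "(\<And>y. 0 \<le> h y) \<Longrightarrow> 0 \<le> mean s h x"
  unfolding mean_def conv_def dilate_def
  by (intro divide_nonneg_nonneg Bochner_Integration.integral_nonneg mult_nonneg_nonneg mollifier_nonneg) simp_all

lemma mean_le_mass: "mean s h x \<le> kernel_bound / s\<^sup>2 * mass (\<lambda>y. \<bar>h y\<bar>) x s"
proof -
  have "\<bar>conv h (dilate s mollifier) x\<bar> \<le> kernel_bound * mass (\<lambda>y. \<bar>h y\<bar>) x (1 * s)"
    by (rule conv_dilate_bound[OF h mollifier_bound(1) mollifier_eq_0 s])
  then have "conv h (dilate s mollifier) x / s\<^sup>2 \<le> kernel_bound * mass (\<lambda>y. \<bar>h y\<bar>) x s / s\<^sup>2"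
    using s by (intro divide_right_mono) simp_all
  then show ?thesis by (simp add: mean_def)
qed

lemma partial_deriv_mean_le_mass: "\<bar>partial_deriv i (mean s h) x\<bar> \<le> kernel_bound / s ^ 3 * mass (\<lambda>y. \<bar>h y\<bar>) x s"
proof -
  have "\<bar>conv h (dilate s (partial_deriv i mollifier)) x\<bar> \<le> kernel_bound * mass (\<lambda>y. \<bar>h y\<bar>) x (1 * s)"
    by (rule conv_dilate_bound[OF h mollifier_bound(2) mollifier_derivs_eq_0(1) s])
  then have "\<bar>conv h (dilate s (partial_deriv i mollifier)) x\<bar> / s ^ 3 \<le> kernel_bound * mass (\<lambda>y. \<bar>h y\<bar>) x s / s ^ 3"
    using s by (intro divide_right_mono) simp_all
  then show ?thesis using s by (simp add: partial_deriv_mean abs_divide)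
qed

lemma partial_deriv2_mean_le_mass:
  "\<bar>partial_deriv j (partial_deriv i (mean s h)) x\<bar> \<le> kernel_bound / s ^ 4 * mass (\<lambda>y. \<bar>h y\<bar>) x s"
proof -
  have "\<bar>conv h (dilate s (partial_deriv j (partial_deriv i mollifier))) x\<bar> \<le> kernel_bound * mass (\<lambda>y. \<bar>h y\<bar>) x (1 * s)"
    by (rule conv_dilate_bound[OF h mollifier_bound(3) mollifier_derivs_eq_0(2) s])
  then have "\<bar>conv h (dilate s (partial_deriv j (partial_deriv i mollifier))) x\<bar> / s ^ 4 \<le> kernel_bound * mass (\<lambda>y. \<bar>h y\<bar>) x s / s ^ 4"
    using s by (intro divide_right_mono) simp_all
  then show ?thesis using s by (simp add: partial_deriv2_mean abs_divide)
qed

text \<open>Since the mollifier is bounded below only in the disc of radius 1/2, the mean at scale \<open>s\<close>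
  controls the mass at half the scale.\<close>
lemma mass_le_mean:
  assumes nn: "\<And>y. 0 \<le> h y"
  shows "mass h x (s / 2) \<le> s\<^sup>2 / kernel_floor * mean s h x"
proof -
  have t: "test_function (dilate s mollifier)" using s by (intro test_function_dilate test_function_mollifier) simp
  have "kernel_floor * mass h x (s / 2) = (LINT y|lebesgue. kernel_floor * (indicator (ball x (s / 2)) y *\<^sub>R h y))"
    by (simp add: mass_def set_lebesgue_integral_def)
  also have "\<dots> \<le> conv h (dilate s mollifier) x"
    unfolding conv_def
  proof (rule integral_mono)
    show "integrable lebesgue (\<lambda>y. kernel_floor * (indicator (ball x (s / 2)) y *\<^sub>R h y))"
      using locally_integrable_ball[OF h, of x "s / 2"] unfolding set_integrable_def by (rule integrable_mult_right)
    show "integrable lebesgue (\<lambda>y. h y * dilate s mollifier (x - y))" by (rule integrable_conv[OF h t])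
    fix y
    show "kernel_floor * (indicator (ball x (s / 2)) y *\<^sub>R h y) \<le> h y * dilate s mollifier (x - y)"
    proof (cases "y \<in> ball x (s / 2)")
      case True
      then have "norm ((x - y) /\<^sub>R s) \<le> 1/2" using s by (simp add: dist_norm norm_scaleR_inverse divide_le_eq del: norm_scaleR)
      then show ?thesis using True nn[of y] mollifier_floor[of "(x - y) /\<^sub>R s"]
        by (simp add: dilate_def mult.commute[of _ "h y"] mult_left_mono)
    next
      case False
      then show ?thesis using nn[of y] by (simp add: dilate_def mollifier_nonneg)
    qed
  qed
  finally have "kernel_floor * mass h x (s / 2) \<le> s\<^sup>2 * mean s h x" using s by (simp add: mean_def)
  then show ?thesis using kernel_floor_pos by (simp add: field_simps)
qed

lemma integral_dilate_mollifier: "(LINT y|lebesgue. dilate s mollifier (x - y)) = s\<^sup>2"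
proof -
  have t: "test_function (dilate s mollifier)" using s by (intro test_function_dilate test_function_mollifier) simp
  have "(LINT y|lebesgue. dilate s mollifier (x - y)) = (LINT y|lebesgue. dilate s mollifier y)"
    by (rule integral_reflect[OF t])
  also have "\<dots> = s\<^sup>2 * (LINT y|lebesgue. dilate s mollifier (0 + s *\<^sub>R y))"
    using s integral_lebesgue_affine[OF test_function_borel[OF t], of s 0] by simp
  also have "\<dots> = s\<^sup>2" using s integral_mollifier by (simp add: dilate_def)
  finally show ?thesis .
qed

lemma mean_le:
  assumes M: "AE y in lebesgue. y \<in> ball x s \<longrightarrow> h y \<le> M"
  shows "mean s h x \<le> M"
proof -
  have t: "test_function (dilate s mollifier)" using s by (intro test_function_dilate test_function_mollifier) simp
  have "conv h (dilate s mollifier) x \<le> (LINT y|lebesgue. M * dilate s mollifier (x - y))"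
    unfolding conv_def
  proof (rule integral_mono_AE)
    show "integrable lebesgue (\<lambda>y. h y * dilate s mollifier (x - y))" by (rule integrable_conv[OF h t])
    show "integrable lebesgue (\<lambda>y. M * dilate s mollifier (x - y))"
      by (rule integrable_conv[OF locally_integrable_const t])
    show "AE y in lebesgue. h y * dilate s mollifier (x - y) \<le> M * dilate s mollifier (x - y)"
      using M
    proof (rule eventually_mono)
      fix y assume y: "y \<in> ball x s \<longrightarrow> h y \<le> M"
      show "h y * dilate s mollifier (x - y) \<le> M * dilate s mollifier (x - y)"
      proof (cases "y \<in> ball x s")
        case True
        then show ?thesis using y by (intro mult_right_mono) (simp_all add: dilate_def mollifier_nonneg)
      next
        case False
        then have "1 \<le> norm ((x - y) /\<^sub>R s)" using s by (simp add: dist_norm norm_scaleR_inverse le_divide_eq del: norm_scaleR)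
        then show ?thesis by (simp add: dilate_def mollifier_eq_0)
      qed
    qed
  qed
  also have "\<dots> = M * s\<^sup>2" by (simp add: integral_dilate_mollifier)
  finally show ?thesis using s by (simp add: mean_def field_simps)
qed

end

lemma test_function_divide: "test_function \<phi> \<Longrightarrow> test_function (\<lambda>x. \<phi> x / c)"
  using test_function_cmult[of \<phi> "inverse c"] by (simp add: divide_inverse mult.commute)

lemma mean_eq_conv: "mean s h = conv h (\<lambda>z. dilate s mollifier z / s\<^sup>2)"
  by (simp add: fun_eq_iff mean_def conv_divide)

lemma test_function_mean_kernel: "0 < s \<Longrightarrow> test_function (\<lambda>z. dilate s mollifier z / s\<^sup>2)"
  by (intro test_function_divide test_function_dilate test_function_mollifier) simp

lemma laplacian_mean:
  assumes "poisson w f" "0 < s" shows "laplacian (mean s w) x = mean s f x"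
proof -
  have w: "locally_integrable w" using assms(1) by (simp add: poisson_def)
  show ?thesis unfolding mean_eq_conv
    by (simp add: laplacian_conv[OF w test_function_mean_kernel[OF assms(2)]]
        conv_laplacian[OF assms(1) test_function_mean_kernel[OF assms(2)]])
qed

text \<open>The Laplacian of the rescaled kernel \<open>green\<close> is the difference of the averaging kernels at the scales
  \<open>s\<close> and \<open>2 s\<close>, so this is the equation tested with that kernel.\<close>
lemma mean_doubling:
  assumes "poisson w f" "0 < s"
  shows "mean s w x - mean (2 * s) w x = conv f (dilate s green) x"
proof -
  have w: "locally_integrable w" using assms(1) by (simp add: poisson_def)
  have g: "test_function (dilate s green)" using assms(2) by (intro test_function_dilate test_function_green) simp
  have "laplacian (dilate s green) = (\<lambda>z. dilate s mollifier z / s\<^sup>2 - dilate (2 * s) mollifier z / (2 * s)\<^sup>2)"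
    using assms(2) by (simp add: fun_eq_iff laplacian_dilate test_function_smooth[OF test_function_green]
        laplacian_green dilate_def diff_divide_distrib power2_eq_square)
  then have "conv f (dilate s green) x = conv w (\<lambda>z. dilate s mollifier z / s\<^sup>2 - dilate (2 * s) mollifier z / (2 * s)\<^sup>2) x"
    using conv_laplacian[OF assms(1) g] by simp
  also have "\<dots> = mean s w x - mean (2 * s) w x" unfolding mean_eq_conv
    by (rule conv_diff[OF w test_function_mean_kernel test_function_mean_kernel]) (use assms(2) in simp_all)
  finally show ?thesis by simp
qed

section \<open>Telescoping over dyadic scales\<close>

lemma geometric_telescope:
  fixes a :: "nat \<Rightarrow> real"
  assumes step: "\<And>j. \<bar>a (Suc j) - a j\<bar> \<le> c * q ^ j" and q: "0 \<le> q" "q < 1"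
  shows "\<bar>a n - a 0\<bar> \<le> c / (1 - q)" and "convergent a"
proof -
  have c: "0 \<le> c" using step[of 0] by simp
  have "\<bar>a n - a 0\<bar> = \<bar>\<Sum>j<n. a (Suc j) - a j\<bar>" by (simp add: sum_lessThan_telescope)
  also have "\<dots> \<le> (\<Sum>j<n. c * q ^ j)" by (rule order_trans[OF sum_abs]) (rule sum_mono, rule step)
  also have "\<dots> = c * ((1 - q ^ n) / (1 - q))"
    using q by (simp add: sum_distrib_left[symmetric] sum_gp_strict)
  also have "\<dots> \<le> c * (1 / (1 - q))"
    using q c by (intro mult_left_mono divide_right_mono) simp_all
  finally show "\<bar>a n - a 0\<bar> \<le> c / (1 - q)" by simp
  have "summable (\<lambda>j. a (Suc j) - a j)"
  proof (rule summable_comparison_test'[where N = 0])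
    show "summable (\<lambda>j. c * q ^ j)" using q by (intro summable_mult summable_geometric) simp
  qed (use step in simp)
  then have "convergent (\<lambda>n. \<Sum>j<n. a (Suc j) - a j)" by (simp add: summable_iff_convergent)
  then have "convergent (\<lambda>n. a n - a 0)" by (simp add: sum_lessThan_telescope)
  then have "convergent (\<lambda>n. (a n - a 0) + a 0)" by (intro convergent_add convergent_const)
  then show "convergent a" by simp
qed

context
  fixes w f :: "real^2 \<Rightarrow> real" and r :: real
  assumes p: "poisson w f" and r: "0 < r"
begin

lemma locally_integrable_poisson: "locally_integrable w" "locally_integrable f"
  using p by (simp_all add: poisson_def)

lemma dyadic_scale_pos: "0 < r / 2 ^ j"
  using r by simp

lemma mean_step: "mean (r / 2 ^ Suc j) w x - mean (r / 2 ^ j) w x = conv f (dilate (r / 2 ^ Suc j) green) x"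
  using mean_doubling[OF p dyadic_scale_pos[of "Suc j"], of x] by simp

lemma partial_deriv_mean_step:
  "partial_deriv i (mean (r / 2 ^ Suc j) w) x - partial_deriv i (mean (r / 2 ^ j) w) x
    = conv f (dilate (r / 2 ^ Suc j) (partial_deriv i green)) x / (r / 2 ^ Suc j)"
proof -
  note li = locally_integrable_poisson
  have "mean (r / 2 ^ Suc j) w = (\<lambda>x. mean (r / 2 ^ j) w x + conv f (dilate (r / 2 ^ Suc j) green) x)"
  proof
    show "mean (r / 2 ^ Suc j) w x = mean (r / 2 ^ j) w x + conv f (dilate (r / 2 ^ Suc j) green) x" for x
      using mean_step[of j x] by linarith
  qed
  then have "partial_deriv i (mean (r / 2 ^ Suc j) w) x
     = partial_deriv i (mean (r / 2 ^ j) w) x + partial_deriv i (conv f (dilate (r / 2 ^ Suc j) green)) x"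
    by (simp only:) (rule partial_deriv_add[OF smooth_differentiable[OF smooth_mean[OF li(1) dyadic_scale_pos]]
        smooth_differentiable[OF smooth_conv_dilate[OF li(2) dyadic_scale_pos test_function_green]]])
  then show ?thesis
    unfolding partial_deriv_conv_dilate[OF li(2) dyadic_scale_pos[of "Suc j"] test_function_green] by linarith
qed

lemma partial_deriv2_mean_step:
  "partial_deriv k (partial_deriv i (mean (r / 2 ^ Suc j) w)) x - partial_deriv k (partial_deriv i (mean (r / 2 ^ j) w)) x
    = conv f (dilate (r / 2 ^ Suc j) (partial_deriv k (partial_deriv i green))) x / (r / 2 ^ Suc j)\<^sup>2"
proof -
  note li = locally_integrable_poisson
  note tg = test_function_partial_deriv[OF test_function_green]
  let ?g = "\<lambda>x. inverse (r / 2 ^ Suc j) * conv f (dilate (r / 2 ^ Suc j) (partial_deriv i green)) x"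
  have sm: "smooth (conv f (dilate (r / 2 ^ Suc j) (partial_deriv i green)))"
    by (rule smooth_conv_dilate[OF li(2) dyadic_scale_pos tg])
  have "partial_deriv i (mean (r / 2 ^ Suc j) w) = (\<lambda>x. partial_deriv i (mean (r / 2 ^ j) w) x + ?g x)"
  proof
    fix x
    have "?g x = conv f (dilate (r / 2 ^ Suc j) (partial_deriv i green)) x / (r / 2 ^ Suc j)"
      by (simp only: divide_inverse mult.commute)
    then show "partial_deriv i (mean (r / 2 ^ Suc j) w) x = partial_deriv i (mean (r / 2 ^ j) w) x + ?g x"
      using partial_deriv_mean_step[of i j x] by linarith
  qed
  then have "partial_deriv k (partial_deriv i (mean (r / 2 ^ Suc j) w)) x
     = partial_deriv k (partial_deriv i (mean (r / 2 ^ j) w)) x + partial_deriv k ?g x"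
    by (simp only:) (rule partial_deriv_add[OF smooth_differentiable[OF smooth_partial_deriv[OF smooth_mean[OF li(1) dyadic_scale_pos]]]
        smooth_differentiable[OF smooth_cmult[OF sm]]])
  moreover have "partial_deriv k ?g x = conv f (dilate (r / 2 ^ Suc j) (partial_deriv k (partial_deriv i green))) x / (r / 2 ^ Suc j)\<^sup>2"
    unfolding partial_deriv_cmult[OF smooth_differentiable[OF sm]]
      partial_deriv_conv_dilate[OF li(2) dyadic_scale_pos[of "Suc j"] tg]
    by (simp only: divide_inverse power2_eq_square inverse_mult_distrib mult_ac)
  ultimately show ?thesis by linarith
qed

lemma mean_step_le: "\<bar>mean (r / 2 ^ Suc j) w x - mean (r / 2 ^ j) w x\<bar> \<le> kernel_bound * mass (\<lambda>y. \<bar>f y\<bar>) x (r / 2 ^ j)"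
proof -
  have "\<bar>conv f (dilate (r / 2 ^ Suc j) green) x\<bar> \<le> kernel_bound * mass (\<lambda>y. \<bar>f y\<bar>) x (2 * (r / 2 ^ Suc j))"
    by (rule conv_dilate_bound[OF locally_integrable_poisson(2) green_bound(1) green_eq_0 dyadic_scale_pos])
  then show ?thesis unfolding mean_step by simp
qed

lemma partial_deriv_mean_step_le:
  "\<bar>partial_deriv i (mean (r / 2 ^ Suc j) w) x - partial_deriv i (mean (r / 2 ^ j) w) x\<bar>
    \<le> 2 * kernel_bound * mass (\<lambda>y. \<bar>f y\<bar>) x (r / 2 ^ j) / (r / 2 ^ j)"
proof -
  have "\<bar>conv f (dilate (r / 2 ^ Suc j) (partial_deriv i green)) x\<bar> \<le> kernel_bound * mass (\<lambda>y. \<bar>f y\<bar>) x (2 * (r / 2 ^ Suc j))"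
    by (rule conv_dilate_bound[OF locally_integrable_poisson(2) green_bound(2) green_derivs_eq_0(1) dyadic_scale_pos])
  then have "\<bar>conv f (dilate (r / 2 ^ Suc j) (partial_deriv i green)) x\<bar> / (r / 2 ^ Suc j)
      \<le> kernel_bound * mass (\<lambda>y. \<bar>f y\<bar>) x (r / 2 ^ j) / (r / 2 ^ Suc j)"
    using dyadic_scale_pos[of "Suc j"] by (intro divide_right_mono) simp_all
  then show ?thesis unfolding partial_deriv_mean_step using r by (simp add: abs_divide abs_mult mult_ac)
qed

context
  fixes x :: "real^2" and b \<beta> :: real
  assumes growth: "\<And>\<rho>. 0 < \<rho> \<Longrightarrow> \<rho> \<le> r \<Longrightarrow> mass (\<lambda>y. \<bar>f y\<bar>) x \<rho> \<le> b * \<rho> powr \<beta>"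
begin

lemma growth_constant_nonneg: "0 \<le> b"
proof -
  have "0 \<le> mass (\<lambda>y. \<bar>f y\<bar>) x r" by (rule mass_nonneg) simp
  also have "\<dots> \<le> b * r powr \<beta>" by (rule growth) (use r in simp_all)
  finally show ?thesis using r by (simp add: zero_le_mult_iff)
qed

lemma growth_dyadic: "mass (\<lambda>y. \<bar>f y\<bar>) x (r / 2 ^ j) \<le> b * (r / 2 ^ j) powr \<beta>"
  by (rule growth) (use r in \<open>simp_all add: divide_le_eq\<close>)

text \<open>The increment at scale \<open>r / 2^j\<close> is at most a constant times the mass there, hence it decreases
  geometrically with ratio at most 1/2 because \<open>\<beta> \<ge> 1\<close>.\<close>
lemma mean_telescope:
  assumes "1 \<le> \<beta>"
  shows "\<bar>mean (r / 2 ^ n) w x - mean r w x\<bar> \<le> 2 * kernel_bound * b * r powr \<beta>"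
    and "convergent (\<lambda>n. mean (r / 2 ^ n) w x)"
proof -
  have step: "\<bar>mean (r / 2 ^ Suc j) w x - mean (r / 2 ^ j) w x\<bar> \<le> (kernel_bound * b * r powr \<beta>) * (1/2) ^ j" for j
  proof -
    have "(2::real) ^ j = (2 ^ j) powr 1" by simp
    also have "\<dots> \<le> (2 ^ j) powr \<beta>" using assms by (intro powr_mono) simp_all
    finally have two: "(2::real) ^ j \<le> (2 ^ j) powr \<beta>" .
    have "(r / 2 ^ j) powr \<beta> = r powr \<beta> / (2 ^ j) powr \<beta>" using r by (simp add: powr_divide)
    also have "\<dots> \<le> r powr \<beta> / 2 ^ j" using two by (intro divide_left_mono) simp_all
    finally have "(r / 2 ^ j) powr \<beta> \<le> r powr \<beta> * (1/2) ^ j" by (simp add: power_one_over)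
    then have "b * (r / 2 ^ j) powr \<beta> \<le> b * (r powr \<beta> * (1/2) ^ j)"
      by (rule mult_left_mono) (rule growth_constant_nonneg)
    then have "mass (\<lambda>y. \<bar>f y\<bar>) x (r / 2 ^ j) \<le> b * (r powr \<beta> * (1/2) ^ j)" using growth_dyadic[of j] by linarith
    then have "kernel_bound * mass (\<lambda>y. \<bar>f y\<bar>) x (r / 2 ^ j) \<le> kernel_bound * (b * (r powr \<beta> * (1/2) ^ j))"
      using kernel_bound_ge_1 by (intro mult_left_mono) simp_all
    then show ?thesis using mean_step_le[of j x] by (simp add: mult.assoc)
  qed
  show "\<bar>mean (r / 2 ^ n) w x - mean r w x\<bar> \<le> 2 * kernel_bound * b * r powr \<beta>"
    using geometric_telescope(1)[of "\<lambda>n. mean (r / 2 ^ n) w x", OF step, of n] by simp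
  show "convergent (\<lambda>n. mean (r / 2 ^ n) w x)"
    using geometric_telescope(2)[of "\<lambda>n. mean (r / 2 ^ n) w x", OF step] by simp
qed

text \<open>Differentiation costs one power of the scale. For \<open>\<beta> \<ge> 3/2\<close> the ratio is still at most
  \<open>1 / sqrt 2\<close>, for which 3/4 is a convenient upper bound.\<close>
lemma partial_deriv_mean_telescope:
  assumes "3/2 \<le> \<beta>"
  shows "\<bar>partial_deriv i (mean (r / 2 ^ n) w) x - partial_deriv i (mean r w) x\<bar> \<le> 8 * kernel_bound * b * r powr (\<beta> - 1)"
    and "convergent (\<lambda>n. partial_deriv i (mean (r / 2 ^ n) w) x)"
proof -
  have step: "\<bar>partial_deriv i (mean (r / 2 ^ Suc j) w) x - partial_deriv i (mean (r / 2 ^ j) w) x\<bar>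
      \<le> (2 * kernel_bound * b * r powr (\<beta> - 1)) * (3/4) ^ j" for j
  proof -
    have "4/3 \<le> sqrt 2" by (rule real_le_rsqrt) (simp add: power2_eq_square)
    then have "(4/3) ^ j \<le> sqrt 2 ^ j" by (intro power_mono) simp_all
    also have "\<dots> = (2 ^ j) powr (1/2)" by (simp add: powr_half_sqrt real_sqrt_power)
    also have "\<dots> \<le> (2 ^ j) powr (\<beta> - 1)" using assms by (intro powr_mono) simp_all
    finally have two: "(4/3::real) ^ j \<le> (2 ^ j) powr (\<beta> - 1)" .
    have "(r / 2 ^ j) powr (\<beta> - 1) = r powr (\<beta> - 1) / (2 ^ j) powr (\<beta> - 1)" using r by (simp add: powr_divide)
    also have "\<dots> \<le> r powr (\<beta> - 1) / (4/3) ^ j" using two by (intro divide_left_mono) simp_all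
    also have "\<dots> = r powr (\<beta> - 1) * (3/4) ^ j" by (simp add: power_divide)
    finally have 1: "(r / 2 ^ j) powr (\<beta> - 1) \<le> r powr (\<beta> - 1) * (3/4) ^ j" .
    have "mass (\<lambda>y. \<bar>f y\<bar>) x (r / 2 ^ j) / (r / 2 ^ j) \<le> b * (r / 2 ^ j) powr \<beta> / (r / 2 ^ j)"
      using dyadic_scale_pos[of j] by (intro divide_right_mono growth_dyadic) simp
    also have "\<dots> = b * (r / 2 ^ j) powr (\<beta> - 1)"
      using r by (simp add: powr_diff)
    also have "\<dots> \<le> b * (r powr (\<beta> - 1) * (3/4) ^ j)" by (rule mult_left_mono[OF 1 growth_constant_nonneg])
    finally have "2 * kernel_bound * (mass (\<lambda>y. \<bar>f y\<bar>) x (r / 2 ^ j) / (r / 2 ^ j)) \<le> 2 * kernel_bound * (b * (r powr (\<beta> - 1) * (3/4) ^ j))"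
      using kernel_bound_ge_1 by (intro mult_left_mono) simp_all
    then show ?thesis using partial_deriv_mean_step_le[of i j x] by (simp add: mult.assoc)
  qed
  show "\<bar>partial_deriv i (mean (r / 2 ^ n) w) x - partial_deriv i (mean r w) x\<bar> \<le> 8 * kernel_bound * b * r powr (\<beta> - 1)"
    using geometric_telescope(1)[of "\<lambda>n. partial_deriv i (mean (r / 2 ^ n) w) x", OF step, of n] by simp
  show "convergent (\<lambda>n. partial_deriv i (mean (r / 2 ^ n) w) x)"
    using geometric_telescope(2)[of "\<lambda>n. partial_deriv i (mean (r / 2 ^ n) w) x", OF step] by simp
qed

end

end

lemma mass_abs_le:
  assumes "locally_integrable f" "\<And>y. \<bar>f y\<bar> \<le> M" "0 < \<rho>"
  shows "mass (\<lambda>y. \<bar>f y\<bar>) x \<rho> \<le> (M * pi) * \<rho> powr 2"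
  using mass_le[OF locally_integrable_abs[OF assms(1)], of x \<rho> M] assms(2,3) by (simp add: powr_numeral mult.assoc)

section \<open>Comparison of mean values of nonnegative functions\<close>

context
  fixes h :: "real^2 \<Rightarrow> real" and s :: real
  assumes h: "locally_integrable h" and s: "0 < s" and nn: "\<And>y. 0 \<le> h y"
begin

lemma mass_le_mean_double: "mass h x s \<le> 4 * s\<^sup>2 / kernel_floor * mean (2 * s) h x"
  using mass_le_mean[OF h _ nn, of "2 * s" x] s by (simp add: power_mult_distrib)

text \<open>Both means are comparable with masses, and the masses are those of nested balls.\<close>
lemma mean_Harnack:
  assumes "dist x y \<le> s"
  shows "mean s h x \<le> 16 * kernel_bound / kernel_floor * mean (4 * s) h y"
proof -
  have "mean s h x \<le> kernel_bound / s\<^sup>2 * mass h x s" using mean_le_mass[OF h s, of x] nn by simp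
  also have "\<dots> \<le> kernel_bound / s\<^sup>2 * mass h y (2 * s)"
  proof (intro mult_left_mono mass_subset h nn)
    show "ball x s \<subseteq> ball y (2 * s)"
    proof
      fix z assume "z \<in> ball x s"
      then show "z \<in> ball y (2 * s)" using assms dist_triangle[of y z x] by (simp add: dist_commute)
    qed
  qed (use kernel_bound_ge_1 in simp)
  also have "\<dots> \<le> kernel_bound / s\<^sup>2 * (16 * s\<^sup>2 / kernel_floor * mean (4 * s) h y)"
    using mass_le_mean[OF h _ nn, of "4 * s" y] s kernel_bound_ge_1
    by (intro mult_left_mono) (simp_all add: power_mult_distrib)
  also have "\<dots> = 16 * kernel_bound / kernel_floor * mean (4 * s) h y" using s by simp
  finally show ?thesis .
qed

text \<open>A derivative of the averaging kernel is dominated by the averaging kernel of twice the scale; for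
  nonnegative functions this bounds the gradient of a mean by a mean.\<close>
lemma partial_deriv_mean_le: "\<bar>partial_deriv i (mean s h) x\<bar> \<le> 4 * kernel_bound / kernel_floor / s * mean (2 * s) h x"
proof -
  have "\<bar>partial_deriv i (mean s h) x\<bar> \<le> kernel_bound / s ^ 3 * mass h x s"
    using partial_deriv_mean_le_mass[OF h s, of i x] nn by simp
  also have "\<dots> \<le> kernel_bound / s ^ 3 * (4 * s\<^sup>2 / kernel_floor * mean (2 * s) h x)"
    using s kernel_bound_ge_1 by (intro mult_left_mono mass_le_mean_double) simp
  also have "\<dots> = 4 * kernel_bound / kernel_floor / s * mean (2 * s) h x"
    using s by (simp add: power2_eq_square power3_eq_cube mult_ac)
  finally show ?thesis .
qed

lemma partial_deriv2_mean_le: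
  "\<bar>partial_deriv j (partial_deriv i (mean s h)) x\<bar> \<le> 4 * kernel_bound / kernel_floor / s\<^sup>2 * mean (2 * s) h x"
proof -
  have "\<bar>partial_deriv j (partial_deriv i (mean s h)) x\<bar> \<le> kernel_bound / s ^ 4 * mass h x s"
    using partial_deriv2_mean_le_mass[OF h s, of j i x] nn by simp
  also have "\<dots> \<le> kernel_bound / s ^ 4 * (4 * s\<^sup>2 / kernel_floor * mean (2 * s) h x)"
    using s kernel_bound_ge_1 by (intro mult_left_mono mass_le_mean_double) simp
  also have "\<dots> = 4 * kernel_bound / kernel_floor / s\<^sup>2 * mean (2 * s) h x"
    using s by (simp add: power2_eq_square power4_eq_xxxx mult_ac)
  finally show ?thesis .
qed

end

section \<open>Convergence of mean values\<close>

lemma mollifier_minus: "mollifier (- x) = mollifier x"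
  by (simp add: mollifier_def bump_def)

lemma locally_bounded_integrable:
  fixes g :: "real^'n::finite \<Rightarrow> real"
  assumes g: "g \<in> borel_measurable lebesgue" and b: "\<And>R. \<exists>C. \<forall>x. norm x \<le> R \<longrightarrow> \<bar>g x\<bar> \<le> C"
  shows "locally_integrable g"
  unfolding locally_integrable_def set_integrable_def
proof (intro allI impI)
  fix S :: "(real^'n) set" assume S: "compact S"
  then obtain R where R: "\<And>x. x \<in> S \<Longrightarrow> norm x \<le> R" using compact_imp_bounded bounded_iff by metis
  obtain C where C: "\<And>x. norm x \<le> R \<Longrightarrow> \<bar>g x\<bar> \<le> C" using b by blast
  have Sm: "S \<in> sets lebesgue" using S by (simp add: borel_compact)
  show "integrable lebesgue (\<lambda>x. indicator S x *\<^sub>R g x)"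
  proof (rule Bochner_Integration.integrable_bound)
    have "emeasure lborel S < \<infinity>" by (rule emeasure_bounded_finite[OF compact_imp_bounded[OF S]])
    then show "integrable lebesgue (\<lambda>x. C * indicator S x)"
      using Sm S by (intro integrable_mult_right integrable_real_indicator) (simp_all add: borel_compact)
    show "(\<lambda>x. indicator S x *\<^sub>R g x) \<in> borel_measurable lebesgue"
      using Sm g by simp
    show "AE x in lebesgue. norm (indicator S x *\<^sub>R g x) \<le> norm (C * indicator S x)"
    proof (rule AE_I2)
      fix x show "norm (indicator S x *\<^sub>R g x) \<le> norm (C * indicator S x)"
        using C[OF R, of x] by (cases "x \<in> S") (auto simp: abs_of_nonneg)
    qed
  qed
qed

lemma mean_uminus: "mean s (\<lambda>y. - h y) x = - mean s h x"
  by (simp add: mean_def conv_def)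

lemma locally_integrable_uminus: "locally_integrable h \<Longrightarrow> locally_integrable (\<lambda>y. - h y)"
  using locally_integrable_cmult[of h "-1"] by simp

lemma mean_ge:
  assumes h: "locally_integrable h" and s: "0 < s" and M: "AE y in lebesgue. y \<in> ball x s \<longrightarrow> M \<le> h y"
  shows "M \<le> mean s h x"
proof -
  have "mean s (\<lambda>y. - h y) x \<le> - M"
  proof (rule mean_le[OF locally_integrable_uminus[OF h] s])
    show "AE y in lebesgue. y \<in> ball x s \<longrightarrow> - h y \<le> - M"
      using M by (rule eventually_mono) simp
  qed
  then show ?thesis by (simp add: mean_uminus)
qed

lemma tendsto_mean:
  assumes v: "locally_integrable v" "isCont v x" and r: "0 < r"
  shows "(\<lambda>j. mean (r / 2 ^ j) v x) \<longlonglongrightarrow> v x"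
proof (rule LIMSEQ_I)
  fix e :: real assume e: "0 < e"
  obtain d where d: "0 < d" "\<And>y. dist y x < d \<Longrightarrow> dist (v y) (v x) < e / 2"
    using v(2) e unfolding continuous_at_eps_delta by (metis half_gt_zero)
  have "(\<lambda>j. r / 2 ^ j) \<longlonglongrightarrow> 0"
    using LIMSEQ_divide_realpow_zero[of 2 r] by simp
  then have "\<forall>\<^sub>F j in sequentially. r / 2 ^ j < d" using d(1) by (rule order_tendstoD)
  then obtain N where N: "\<And>j. N \<le> j \<Longrightarrow> r / 2 ^ j < d" unfolding eventually_sequentially by blast
  show "\<exists>N. \<forall>j\<ge>N. norm (mean (r / 2 ^ j) v x - v x) < e"
  proof (intro exI allI impI)
    fix j assume "N \<le> j"
    have s: "0 < r / 2 ^ j" using r by simp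
    have close: "\<bar>v y - v x\<bar> < e / 2" if "y \<in> ball x (r / 2 ^ j)" for y
      using d(2)[of y] that N[OF \<open>N \<le> j\<close>] by (simp add: dist_commute[of x y] dist_real_def)
    have close': "v x - e / 2 \<le> v y \<and> v y \<le> v x + e / 2" if "y \<in> ball x (r / 2 ^ j)" for y
      using close[OF that] by linarith
    have "mean (r / 2 ^ j) v x \<le> v x + e / 2"
      by (rule mean_le[OF v(1) s], rule AE_I2, rule impI) (simp add: close')
    moreover have "v x - e / 2 \<le> mean (r / 2 ^ j) v x"
      by (rule mean_ge[OF v(1) s], rule AE_I2, rule impI) (simp add: close')
    ultimately show "norm (mean (r / 2 ^ j) v x - v x) < e" using e by (simp add: abs_if)
  qed
qed

text \<open>Averaging is a symmetric operation because the mollifier is even.\<close>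
lemma integral_mean_mult:
  assumes h: "locally_integrable h" and s: "0 < s"
    and b: "b \<in> borel_measurable borel" "\<And>x. \<bar>b x\<bar> \<le> B" "\<And>x. x \<notin> cball 0 R \<Longrightarrow> b x = 0"
  shows "(LINT x|lebesgue. mean s h x * b x) = (LINT y|lebesgue. h y * mean s b y)"
proof -
  let ?k = "\<lambda>z. dilate s mollifier z / s\<^sup>2"
  have "?k (x - y) = ?k (y - x)" for x y
    using mollifier_minus[of "(x - y) /\<^sub>R s"] by (simp add: dilate_def scaleR_diff_right)
  then have "mean s b y = (LINT x|lebesgue. ?k (x - y) * b x)" for y
    unfolding mean_eq_conv conv_def by (simp only: mult.commute)
  then show ?thesis
    using conv_Fubini[OF h test_function_mean_kernel[OF s] b] by (simp only: mean_eq_conv)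
qed

lemma indicator_locally_integrable: "A \<in> sets borel \<Longrightarrow> locally_integrable (indicator A)"
  by (rule locally_bounded_integrable) (auto intro!: exI[of _ 1] borel_lebesgue borel_measurable_indicator simp: indicator_def)

text \<open>Averaging does not lose mass if the ball is enlarged by the averaging scale: by symmetry the averaging
  moves to the indicator of the larger ball, and this average is 1 on the smaller ball.\<close>
lemma mass_le_mass_mean:
  assumes h: "locally_integrable h" and s: "0 < s" and nn: "\<And>y. 0 \<le> h y"
  shows "mass h x \<rho> \<le> mass (mean s h) x (\<rho> + s)"
proof -
  let ?B = "ball x (\<rho> + s)"
  have i: "locally_integrable (indicator ?B :: real^2 \<Rightarrow> real)" by (rule indicator_locally_integrable) simp
  have nnB: "0 \<le> mean s (indicator ?B) y" for y by (rule mean_nonneg[OF i s]) simp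
  have ge: "indicator (ball x \<rho>) y \<le> mean s (indicator ?B) y" for y
  proof (cases "y \<in> ball x \<rho>")
    case True
    have "(1::real) \<le> mean s (indicator ?B) y"
    proof (rule mean_ge[OF i s], rule AE_I2, rule impI)
      fix z assume "z \<in> ball y s"
      then have "z \<in> ?B" using True dist_triangle[of x z y] by simp
      then show "(1::real) \<le> indicator ?B z" by simp
    qed
    then show ?thesis using True by simp
  qed (simp add: nnB)
  have out: "mean s (indicator ?B) y = 0" if y: "y \<notin> cball x (\<rho> + 2 * s)" for y
  proof (rule antisym)
    show "mean s (indicator ?B) y \<le> 0"
    proof (rule mean_le[OF i s], rule AE_I2, rule impI)
      fix z assume "z \<in> ball y s"
      then have "z \<notin> ?B" using y dist_triangle[of x y z] by (simp add: dist_commute)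
      then show "indicator ?B z \<le> (0::real)" by simp
    qed
  qed (rule nnB)
  have le: "\<bar>mean s (indicator ?B) y\<bar> \<le> 1" for y
    using nnB[of y] by (simp add: abs_of_nonneg) (rule mean_le[OF i s], simp add: indicator_def)
  have "mass h x \<rho> = (LINT y|lebesgue. indicator (ball x \<rho>) y *\<^sub>R h y)"
    by (simp add: mass_def set_lebesgue_integral_def)
  also have "\<dots> \<le> (LINT y|lebesgue. h y * mean s (indicator ?B) y)"
  proof (rule integral_mono)
    show "integrable lebesgue (\<lambda>y. indicator (ball x \<rho>) y *\<^sub>R h y)"
      using locally_integrable_ball[OF h] unfolding set_integrable_def .
    show "integrable lebesgue (\<lambda>y. h y * mean s (indicator ?B) y)"
      by (rule locally_integrable_mult_bounded[OF h borel_lebesgue[OF smooth_borel[OF smooth_mean[OF i s]]] le out])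
    show "indicator (ball x \<rho>) y *\<^sub>R h y \<le> h y * mean s (indicator ?B) y" for y
      using mult_left_mono[OF ge[of y] nn[of y]] by (simp add: mult.commute)
  qed
  also have "\<dots> = (LINT z|lebesgue. mean s h z * indicator ?B z)"
  proof (rule integral_mean_mult[OF h s, symmetric])
    show "indicator ?B \<in> borel_measurable borel" by (rule borel_measurable_indicator) simp
    show "\<bar>indicator ?B z :: real\<bar> \<le> 1" for z by (simp add: indicator_def)
    show "indicator ?B z = (0::real)" if "z \<notin> cball 0 (norm x + (\<rho> + s))" for z
    proof -
      have "norm z \<le> norm x + dist x z" by (metis dist_norm norm_minus_commute norm_triangle_sub)
      then show ?thesis using that by (simp add: indicator_def)
    qed
  qed
  also have "\<dots> = mass (mean s h) x (\<rho> + s)"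
    by (simp add: mass_def set_lebesgue_integral_def mult.commute)
  finally show ?thesis .
qed

text \<open>The means converge at every point with uniformly bounded differences by telescoping. That the limit
  is \<open>w\<close> is checked on boxes: in the integral over a box the averaging is moved to the indicator of the
  box, whose averages converge away from the boundary.\<close>
lemma AE_mean_tendsto:
  assumes p: "poisson w f" and M: "\<And>y. \<bar>f y\<bar> \<le> M" and r: "0 < r"
  shows "AE x in lebesgue. (\<lambda>j. mean (r / 2 ^ j) w x) \<longlonglongrightarrow> w x"
proof -
  have w: "locally_integrable w" and f: "locally_integrable f" using p by (simp_all add: poisson_def)
  have s: "0 < r / 2 ^ j" for j using r by simp
  define C where "C = 2 * kernel_bound * (M * pi) * r powr 2"
  have growth: "mass (\<lambda>y. \<bar>f y\<bar>) x \<rho> \<le> (M * pi) * \<rho> powr 2" if "0 < \<rho>" for x \<rho>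
    by (rule mass_abs_le[OF f M that])
  define W where "W x = lim (\<lambda>j. mean (r / 2 ^ j) w x)" for x
  have conv: "(\<lambda>j. mean (r / 2 ^ j) w x) \<longlonglongrightarrow> W x" for x
    unfolding W_def using mean_telescope(2)[OF p r growth, of x] by (simp add: convergent_LIMSEQ_iff)
  have bound: "\<bar>mean (r / 2 ^ j) w x - mean r w x\<bar> \<le> C" for j x
    unfolding C_def by (rule mean_telescope(1)[OF p r growth]) simp_all
  have cont: "\<exists>C. \<forall>x. norm x \<le> R \<longrightarrow> \<bar>mean r w x\<bar> \<le> C" for R
  proof -
    have "compact (mean r w ` cball 0 R)"
      by (intro compact_continuous_image smooth_continuous_on smooth_mean w r compact_cball)
    then have "bounded (mean r w ` cball 0 R)" by (rule compact_imp_bounded)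
    then obtain C where "\<forall>z\<in>mean r w ` cball 0 R. norm z \<le> C" unfolding bounded_iff by blast
    then have "\<forall>x. norm x \<le> R \<longrightarrow> \<bar>mean r w x\<bar> \<le> C" by simp
    then show ?thesis by blast
  qed
  have loc: "\<exists>C. \<forall>x j. norm x \<le> R \<longrightarrow> \<bar>mean (r / 2 ^ j) w x\<bar> \<le> C" for R
  proof -
    obtain C' where C': "\<And>x. norm x \<le> R \<Longrightarrow> \<bar>mean r w x\<bar> \<le> C'" using cont by blast
    have "\<bar>mean (r / 2 ^ j) w x\<bar> \<le> C' + C" if "norm x \<le> R" for x j
      using C'[OF that] bound[where j = j and x = x] by linarith
    then show ?thesis by blast
  qed
  have W: "locally_integrable W"
  proof (rule locally_bounded_integrable)
    show "W \<in> borel_measurable lebesgue"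
      by (rule borel_measurable_LIMSEQ_real[OF conv]) (rule borel_lebesgue[OF smooth_borel[OF smooth_mean[OF w s]]])
    fix R
    obtain C where C: "\<And>x j. norm x \<le> R \<Longrightarrow> \<bar>mean (r / 2 ^ j) w x\<bar> \<le> C" using loc by blast
    have "\<bar>W x\<bar> \<le> C" if "norm x \<le> R" for x
      by (rule LIMSEQ_le_const2[OF tendsto_rabs[OF conv[of x]]]) (use C[OF that] in blast)
    then show "\<exists>C. \<forall>x. norm x \<le> R \<longrightarrow> \<bar>W x\<bar> \<le> C" by blast
  qed
  have "AE x in lebesgue. w x + - W x = 0"
  proof (rule AE_eq_0_if_box_integrals_eq_0)
    show "locally_integrable (\<lambda>x. w x + - W x)" by (intro locally_integrable_add w locally_integrable_uminus W)
    fix a b :: "real^2"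
    let ?A = "box a b"
    obtain R where R: "\<And>x. x \<in> ?A \<Longrightarrow> norm x \<le> R" using bounded_box[of a b] unfolding bounded_iff by blast
    have i: "locally_integrable (indicator ?A :: real^2 \<Rightarrow> real)" by (rule indicator_locally_integrable) simp
    have meas_A: "indicator ?A \<in> borel_measurable (borel :: (real^2) measure)" by (rule borel_measurable_indicator) simp
    have bA: "\<bar>indicator ?A z :: real\<bar> \<le> 1" for z by (simp add: indicator_def)
    have sA: "indicator ?A z = (0::real)" if "z \<notin> cball 0 R" for z using R[of z] that by (auto simp: indicator_def)
    have nnA: "0 \<le> mean (r / 2 ^ j) (indicator ?A) y" for y j by (rule mean_nonneg[OF i s]) simp
    have leA: "\<bar>mean (r / 2 ^ j) (indicator ?A) y\<bar> \<le> 1" for y j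
      using nnA[of j y] by (simp add: abs_of_nonneg) (rule mean_le[OF i s], simp add: indicator_def)
    have outA: "mean (r / 2 ^ j) (indicator ?A) y = 0" if y: "y \<notin> cball 0 (R + r)" for y j
    proof (rule antisym)
      have rj: "r / 2 ^ j \<le> r" using r by (simp add: divide_le_eq)
      show "mean (r / 2 ^ j) (indicator ?A) y \<le> 0"
      proof (rule mean_le[OF i s], rule AE_I2, rule impI)
        fix z assume "z \<in> ball y (r / 2 ^ j)"
        then have "norm (y - z) < r" using rj by (simp add: dist_norm)
        then have "R < norm z" using y norm_triangle_sub[of y z] by simp
        then have "z \<notin> ?A" using R[of z] by linarith
        then show "indicator ?A z \<le> (0::real)" by simp
      qed
    qed (rule nnA)
    have eq: "(LINT x|lebesgue. mean (r / 2 ^ j) w x * indicator ?A x) = (LINT y|lebesgue. w y * mean (r / 2 ^ j) (indicator ?A) y)" for j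
      by (rule integral_mean_mult[OF w s meas_A bA sA])
    have lim1: "(\<lambda>j. LINT x|lebesgue. mean (r / 2 ^ j) w x * indicator ?A x) \<longlonglongrightarrow> (LINT x|lebesgue. W x * indicator ?A x)"
    proof -
      obtain C where C: "\<And>x j. norm x \<le> R \<Longrightarrow> \<bar>mean (r / 2 ^ j) w x\<bar> \<le> C" using loc by blast
      show ?thesis
      proof (rule integral_dominated_convergence[where w = "\<lambda>x. C * indicator ?A x"])
        show "(\<lambda>x. W x * indicator ?A x) \<in> borel_measurable lebesgue"
          by (intro borel_measurable_times locally_integrable_measurable[OF W] borel_lebesgue[OF meas_A])
        show "(\<lambda>x. mean (r / 2 ^ j) w x * indicator ?A x) \<in> borel_measurable lebesgue" for j
          by (intro borel_measurable_times borel_lebesgue meas_A smooth_borel smooth_mean w s)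
        show "integrable lebesgue (\<lambda>x. C * indicator ?A x)"
          by (rule locally_integrable_mult_bounded[OF locally_integrable_const borel_lebesgue[OF meas_A] bA sA])
        show "AE x in lebesgue. (\<lambda>j. mean (r / 2 ^ j) w x * indicator ?A x) \<longlonglongrightarrow> W x * indicator ?A x"
          by (rule AE_I2) (rule tendsto_mult[OF conv tendsto_const])
        show "AE x in lebesgue. norm (mean (r / 2 ^ j) w x * indicator ?A x) \<le> C * indicator ?A x" for j
        proof (rule AE_I2)
          fix x show "norm (mean (r / 2 ^ j) w x * indicator ?A x) \<le> C * indicator ?A x"
            using C[of x j] R[of x] by (cases "x \<in> ?A") simp_all
        qed
      qed
    qed
    have lim2: "(\<lambda>j. LINT y|lebesgue. w y * mean (r / 2 ^ j) (indicator ?A) y) \<longlonglongrightarrow> (LINT x|lebesgue. w x * indicator ?A x)"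
    proof (rule integral_dominated_convergence[where w = "\<lambda>x. \<bar>w x\<bar> * indicator (cball 0 (R + r)) x"])
      show "(\<lambda>x. w x * indicator ?A x) \<in> borel_measurable lebesgue"
        by (intro borel_measurable_times locally_integrable_measurable[OF w] borel_lebesgue[OF meas_A])
      show "(\<lambda>y. w y * mean (r / 2 ^ j) (indicator ?A) y) \<in> borel_measurable lebesgue" for j
        by (intro borel_measurable_times locally_integrable_measurable[OF w] borel_lebesgue smooth_borel smooth_mean i s)
      show "integrable lebesgue (\<lambda>x. \<bar>w x\<bar> * indicator (cball 0 (R + r)) x)"
        using locally_integrable_cball[OF locally_integrable_abs[OF w], of 0 "R + r"] by (simp add: mult.commute)
      have "AE y in lebesgue. y \<notin> cbox a b - box a b"
        using negligible_frontier_interval[of a b] by (intro AE_not_in) (simp add: negligible_iff_null_sets)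
      then show "AE y in lebesgue. (\<lambda>j. w y * mean (r / 2 ^ j) (indicator ?A) y) \<longlonglongrightarrow> w y * indicator ?A y"
      proof (rule eventually_mono)
        fix y assume "y \<notin> cbox a b - box a b"
        then consider "y \<in> box a b" | "y \<in> - cbox a b" by auto
        then have "isCont (indicator ?A :: real^2 \<Rightarrow> real) y"
        proof cases
          case 1
          have ev: "\<forall>\<^sub>F x in nhds y. (1::real) = indicator ?A x"
            using eventually_nhds_in_open[OF open_box 1] by (rule eventually_mono) simp
          show ?thesis by (rule isCont_cong[OF ev, THEN iffD1]) simp
        next
          case 2
          have ev: "\<forall>\<^sub>F x in nhds y. (0::real) = indicator ?A x"
            using eventually_nhds_in_open[OF open_Compl[OF closed_cbox] 2]
            by (rule eventually_mono) (use box_subset_cbox[of a b] in \<open>auto simp: indicator_def\<close>)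
          show ?thesis by (rule isCont_cong[OF ev, THEN iffD1]) simp
        qed
        then show "(\<lambda>j. w y * mean (r / 2 ^ j) (indicator ?A) y) \<longlonglongrightarrow> w y * indicator ?A y"
          by (intro tendsto_mult tendsto_const tendsto_mean i r)
      qed
      show "AE y in lebesgue. norm (w y * mean (r / 2 ^ j) (indicator ?A) y) \<le> \<bar>w y\<bar> * indicator (cball 0 (R + r)) y" for j
      proof (rule AE_I2)
        fix y show "norm (w y * mean (r / 2 ^ j) (indicator ?A) y) \<le> \<bar>w y\<bar> * indicator (cball 0 (R + r)) y"
          using leA[of j y] outA[of y j] by (cases "y \<in> cball 0 (R + r)") (simp_all add: abs_mult mult_left_le)
      qed
    qed
    have "(LINT x|lebesgue. W x * indicator ?A x) = (LINT x|lebesgue. w x * indicator ?A x)"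
      using lim1 lim2 unfolding eq by (rule LIMSEQ_unique)
    moreover have "(LINT x:?A|lebesgue. w x + - W x) = (LINT x|lebesgue. w x * indicator ?A x) - (LINT x|lebesgue. W x * indicator ?A x)"
    proof -
      have "(LINT x:?A|lebesgue. w x + - W x) = (LINT x|lebesgue. w x * indicator ?A x - W x * indicator ?A x)"
        unfolding set_lebesgue_integral_def by (simp add: algebra_simps)
      also have "\<dots> = (LINT x|lebesgue. w x * indicator ?A x) - (LINT x|lebesgue. W x * indicator ?A x)"
        by (intro Bochner_Integration.integral_diff locally_integrable_mult_bounded[OF w borel_lebesgue[OF meas_A] bA sA]
            locally_integrable_mult_bounded[OF W borel_lebesgue[OF meas_A] bA sA])
      finally show ?thesis .
    qed
    ultimately show "(LINT x:?A|lebesgue. w x + - W x) = 0" by simp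
  qed
  then show ?thesis by (rule eventually_mono) (use conv in simp)
qed

section \<open>Weak derivatives as limits\<close>

lemma weak_partial_smooth: "smooth a \<Longrightarrow> weak_partial i a (partial_deriv i a)"
  by (simp add: weak_partial_def smooth_locally_integrable smooth_partial_deriv integration_by_parts)

lemma integral_test_limit:
  assumes F: "\<And>n. F n \<in> borel_measurable lebesgue" and f: "f \<in> borel_measurable lebesgue"
    and lim: "AE x in lebesgue. (\<lambda>n. F n x) \<longlonglongrightarrow> f x"
    and bd: "\<And>R. \<exists>C. \<forall>n x. norm x \<le> R \<longrightarrow> \<bar>F n x\<bar> \<le> C"
    and \<phi>: "test_function \<phi>"
  shows "(\<lambda>n. LINT x|lebesgue. F n x * \<phi> x) \<longlonglongrightarrow> (LINT x|lebesgue. f x * \<phi> x)"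
proof -
  obtain R where R: "\<And>x. R \<le> norm x \<Longrightarrow> \<phi> x = 0" using \<phi> unfolding test_function_iff by blast
  obtain C where C: "\<And>n x. norm x \<le> R \<Longrightarrow> \<bar>F n x\<bar> \<le> C" using bd by blast
  have \<phi>m: "\<phi> \<in> borel_measurable lebesgue" by (intro borel_lebesgue test_function_borel \<phi>)
  show ?thesis
  proof (rule integral_dominated_convergence[where w = "\<lambda>x. \<bar>C\<bar> * \<bar>\<phi> x\<bar>"])
    show "(\<lambda>x. f x * \<phi> x) \<in> borel_measurable lebesgue" by (intro borel_measurable_times f \<phi>m)
    show "(\<lambda>x. F n x * \<phi> x) \<in> borel_measurable lebesgue" for n by (intro borel_measurable_times F \<phi>m)
    have "integrable lebesgue (\<lambda>x. \<bar>C * \<phi> x\<bar>)"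
      by (intro integrable_abs integrable_mult_test locally_integrable_const \<phi>)
    then show "integrable lebesgue (\<lambda>x. \<bar>C\<bar> * \<bar>\<phi> x\<bar>)" by (simp add: abs_mult)
    show "AE x in lebesgue. (\<lambda>n. F n x * \<phi> x) \<longlonglongrightarrow> f x * \<phi> x"
      using lim by (rule eventually_mono) (intro tendsto_mult tendsto_const)
    show "AE x in lebesgue. norm (F n x * \<phi> x) \<le> \<bar>C\<bar> * \<bar>\<phi> x\<bar>" for n
    proof (rule AE_I2)
      fix x show "norm (F n x * \<phi> x) \<le> \<bar>C\<bar> * \<bar>\<phi> x\<bar>"
        using C[of x n] R[of x] by (cases "norm x \<le> R") (auto simp: abs_mult intro!: mult_right_mono)
    qed
  qed
qed

text \<open>Used for means: their classical derivatives pass to the limit by dominated convergence.\<close>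
lemma weak_partial_limit:
  assumes FG: "\<And>n. weak_partial i (F n) (G n)"
    and f: "locally_integrable f" and g: "locally_integrable g"
    and limF: "AE x in lebesgue. (\<lambda>n. F n x) \<longlonglongrightarrow> f x"
    and limG: "AE x in lebesgue. (\<lambda>n. G n x) \<longlonglongrightarrow> g x"
    and bdF: "\<And>R. \<exists>C. \<forall>n x. norm x \<le> R \<longrightarrow> \<bar>F n x\<bar> \<le> C"
    and bdG: "\<And>R. \<exists>C. \<forall>n x. norm x \<le> R \<longrightarrow> \<bar>G n x\<bar> \<le> C"
  shows "weak_partial i f g"
  unfolding weak_partial_def
proof (intro conjI allI impI f g)
  fix \<phi> :: "real^'a \<Rightarrow> real" assume \<phi>: "test_function \<phi>"
  have m: "F n \<in> borel_measurable lebesgue" "G n \<in> borel_measurable lebesgue" for n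
    using FG[of n] by (simp_all add: weak_partial_def locally_integrable_measurable)
  have "(\<lambda>n. LINT x|lebesgue. F n x * partial_deriv i \<phi> x) \<longlonglongrightarrow> (LINT x|lebesgue. f x * partial_deriv i \<phi> x)"
    by (rule integral_test_limit[OF m(1) locally_integrable_measurable[OF f] limF bdF test_function_partial_deriv[OF \<phi>]])
  moreover have "(\<lambda>n. - (LINT x|lebesgue. G n x * \<phi> x)) \<longlonglongrightarrow> - (LINT x|lebesgue. g x * \<phi> x)"
    by (rule tendsto_minus[OF integral_test_limit[OF m(2) locally_integrable_measurable[OF g] limG bdG \<phi>]])
  moreover have "(LINT x|lebesgue. F n x * partial_deriv i \<phi> x) = - (LINT x|lebesgue. G n x * \<phi> x)" for n
    using FG[of n] \<phi> by (simp add: weak_partial_def)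
  ultimately show "(LINT x|lebesgue. f x * partial_deriv i \<phi> x) = - (LINT x|lebesgue. g x * \<phi> x)"
    using LIMSEQ_unique by simp
qed

section \<open>Monotonicity and linearity of mean values\<close>

lemma LIMSEQ_upper_bound: "a \<longlonglongrightarrow> l \<Longrightarrow> (\<And>n. a n \<le> C) \<Longrightarrow> l \<le> C" for l C :: real
  by (rule LIMSEQ_le_const2) auto

lemma mean_mono:
  assumes "locally_integrable g" "locally_integrable h" "0 < s" "\<And>y. g y \<le> h y"
  shows "mean s g x \<le> mean s h x"
proof -
  have t: "test_function (dilate s mollifier)"
    using assms(3) by (intro test_function_dilate test_function_mollifier) simp
  have "conv g (dilate s mollifier) x \<le> conv h (dilate s mollifier) x"
    unfolding conv_def
    by (rule integral_mono[OF integrable_conv[OF assms(1) t] integrable_conv[OF assms(2) t]])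
       (intro mult_right_mono assms(4), simp add: dilate_def mollifier_nonneg)
  then show ?thesis unfolding mean_def by (rule divide_right_mono) simp
qed

lemma mean_affine:
  assumes h: "locally_integrable h" and s: "0 < s"
  shows "mean s (\<lambda>y. a + b * h y) x = a + b * mean s h x"
proof -
  have t: "test_function (dilate s mollifier)" using s by (intro test_function_dilate test_function_mollifier) simp
  have "conv (\<lambda>y. a + b * h y) (dilate s mollifier) x =
      (LINT y|lebesgue. a * dilate s mollifier (x - y) + b * (h y * dilate s mollifier (x - y)))"
    unfolding conv_def by (simp only: distrib_right mult.assoc)
  also have "\<dots> = (LINT y|lebesgue. a * dilate s mollifier (x - y)) + (LINT y|lebesgue. b * (h y * dilate s mollifier (x - y)))"
    by (intro Bochner_Integration.integral_add integrable_mult_right integrable_conv[OF h t]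
        integrable_conv[OF locally_integrable_const t])
  also have "\<dots> = a * s\<^sup>2 + b * conv h (dilate s mollifier) x"
    unfolding conv_def using integral_dilate_mollifier[OF h s, of x] by simp
  finally show ?thesis unfolding mean_def using s by (simp add: add_divide_distrib)
qed

section \<open>A gradient estimate\<close>

text \<open>The constant of the gradient estimate, from the gradient at scale \<open>r\<close> (first two summands) and
  from the finer scales (last summand).\<close>
definition gradient_const :: real where
  "gradient_const = 4 * kernel_bound / kernel_floor + 32 * kernel_bound\<^sup>2 * pi / kernel_floor + 8 * kernel_bound * pi"

lemma gradient_const_nonneg: "0 \<le> gradient_const"
  unfolding gradient_const_def using kernel_bound_ge_1 kernel_floor_pos by simp

context
  fixes v :: "real^2 \<Rightarrow> real" and D :: real
  assumes v: "smooth v" and v0: "\<And>y. 0 \<le> v y"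
    and F0: "\<And>y. 0 \<le> laplacian v y" and FD: "\<And>y. laplacian v y \<le> D"
begin

lemma laplacian_bound_nonneg: "0 \<le> D" using F0[of 0] FD[of 0] by linarith

lemma mass_laplacian_le:
  assumes "0 < \<rho>" shows "mass (\<lambda>y. \<bar>laplacian v y\<bar>) x \<rho> \<le> (D * pi) * \<rho> powr 2"
  by (rule mass_abs_le[OF smooth_locally_integrable[OF smooth_laplacian[OF v]] _ assms])
     (use F0 FD in \<open>simp add: abs_of_nonneg\<close>)

text \<open>Telescoping down to scale zero, where the means converge to the value by continuity.\<close>
lemma mean_le_value:
  assumes r: "0 < r" shows "mean r v x \<le> v x + 2 * kernel_bound * pi * D * r\<^sup>2"
proof -
  have "(\<lambda>n. mean (r / 2 ^ n) v x) \<longlonglongrightarrow> v x"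
    by (rule tendsto_mean[OF smooth_locally_integrable[OF v] isCont_smooth[OF v] r])
  then have "(\<lambda>n. \<bar>mean (r / 2 ^ n) v x - mean r v x\<bar>) \<longlonglongrightarrow> \<bar>v x - mean r v x\<bar>"
    by (intro tendsto_intros)
  moreover have "\<bar>mean (r / 2 ^ n) v x - mean r v x\<bar> \<le> 2 * kernel_bound * (D * pi) * r powr 2" for n
    by (rule mean_telescope(1)[OF poisson_smooth[OF v] r mass_laplacian_le]) simp_all
  ultimately have "\<bar>v x - mean r v x\<bar> \<le> 2 * kernel_bound * (D * pi) * r powr 2"
    by (rule LIMSEQ_upper_bound)
  then show ?thesis using r by (simp add: powr_numeral abs_le_iff mult_ac)
qed

text \<open>At scale \<open>r\<close> the gradient of the mean is controlled by a mean of \<open>v\<close>, because \<open>v\<close> is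
  nonnegative, and that mean by the value at \<open>x\<close>, because the Laplacian is bounded; the finer scales
  contribute a geometric series of order \<open>D r\<close>.\<close>
lemma gradient_estimate:
  assumes r: "0 < r" shows "\<bar>partial_deriv i v x\<bar> \<le> gradient_const * (v x / r + D * r)"
proof -
  let ?K = kernel_bound and ?c = kernel_floor
  have K: "1 \<le> ?K" and c: "0 < ?c" by (rule kernel_bound_ge_1, rule kernel_floor_pos)
  note li = smooth_locally_integrable[OF v]
  have d: "partial_deriv i (mean (r / 2 ^ n) v) x = mean (r / 2 ^ n) (partial_deriv i v) x" for n
    unfolding mean_eq_conv
    using r by (simp add: partial_deriv_conv[OF li] conv_partial_deriv_smooth[OF v] test_function_mean_kernel)
  have "(\<lambda>n. mean (r / 2 ^ n) (partial_deriv i v) x) \<longlonglongrightarrow> partial_deriv i v x"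
    by (rule tendsto_mean[OF smooth_locally_integrable isCont_smooth r]) (intro smooth_partial_deriv v)+
  then have "(\<lambda>n. \<bar>partial_deriv i (mean (r / 2 ^ n) v) x - partial_deriv i (mean r v) x\<bar>)
      \<longlonglongrightarrow> \<bar>partial_deriv i v x - partial_deriv i (mean r v) x\<bar>"
    unfolding d by (intro tendsto_intros)
  moreover have "\<bar>partial_deriv i (mean (r / 2 ^ n) v) x - partial_deriv i (mean r v) x\<bar> \<le> 8 * ?K * (D * pi) * r powr (2 - 1)" for n
    by (rule partial_deriv_mean_telescope(1)[OF poisson_smooth[OF v] r mass_laplacian_le]) simp_all
  ultimately have "\<bar>partial_deriv i v x - partial_deriv i (mean r v) x\<bar> \<le> 8 * ?K * (D * pi) * r powr (2 - 1)"
    by (rule LIMSEQ_upper_bound)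
  then have 1: "\<bar>partial_deriv i v x - partial_deriv i (mean r v) x\<bar> \<le> 8 * ?K * pi * (D * r)"
    using r by (simp add: mult_ac)
  have "\<bar>partial_deriv i (mean r v) x\<bar> \<le> 4 * ?K / ?c / r * mean (2 * r) v x"
    by (rule partial_deriv_mean_le[OF li r v0])
  also have "\<dots> \<le> 4 * ?K / ?c / r * (v x + 2 * ?K * pi * D * (2 * r)\<^sup>2)"
    using K c r by (intro mult_left_mono mean_le_value) simp_all
  also have "\<dots> = 4 * ?K / ?c * (v x / r) + 32 * ?K\<^sup>2 * pi / ?c * (D * r)"
    using r c by (simp add: field_simps power2_eq_square)
  finally have "\<bar>partial_deriv i v x\<bar> \<le> 4 * ?K / ?c * (v x / r) + (32 * ?K\<^sup>2 * pi / ?c + 8 * ?K * pi) * (D * r)"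
    using 1 by (simp add: algebra_simps)
  also have "\<dots> \<le> gradient_const * (v x / r) + gradient_const * (D * r)"
    unfolding gradient_const_def using K c r v0[of x] laplacian_bound_nonneg
    by (intro add_mono mult_right_mono) simp_all
  finally show ?thesis by (simp add: distrib_left)
qed

text \<open>The radius balances the two terms of the preceding estimate. The summand \<open>L\<close> bounds the radius away from
  zero.\<close>
lemma gradient_square_estimate:
  assumes L: "0 < L" and D: "0 < D"
  shows "(\<Sum>i\<in>UNIV. (partial_deriv i v x)\<^sup>2) \<le> 8 * gradient_const\<^sup>2 * D * (v x + L)"
proof -
  define r where "r = sqrt ((v x + L) / D)"
  have pos: "0 < (v x + L) / D" using v0[of x] L D by simp
  have r: "0 < r" unfolding r_def using pos by simp
  have r2: "D * r\<^sup>2 = v x + L" unfolding r_def using pos D by simp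
  have "v x / r \<le> (v x + L) / r" using L r by (intro divide_right_mono) simp_all
  also have "\<dots> = D * r" unfolding r2[symmetric] using r by (simp add: power2_eq_square)
  finally have le: "v x / r + D * r \<le> 2 * (D * r)" by simp
  have "(partial_deriv i v x)\<^sup>2 \<le> 4 * gradient_const\<^sup>2 * D * (v x + L)" for i
  proof -
    have "\<bar>partial_deriv i v x\<bar> \<le> gradient_const * (2 * (D * r))"
      by (rule order_trans[OF gradient_estimate[OF r] mult_left_mono[OF le gradient_const_nonneg]])
    then have "\<bar>partial_deriv i v x\<bar>\<^sup>2 \<le> (gradient_const * (2 * (D * r)))\<^sup>2" by (intro power_mono) simp_all
    also have "\<dots> = 4 * gradient_const\<^sup>2 * D * (D * r\<^sup>2)" by (simp add: power2_eq_square mult_ac)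
    finally show ?thesis unfolding r2 by simp
  qed
  then have "(\<Sum>i\<in>UNIV. (partial_deriv i v x)\<^sup>2) \<le> (\<Sum>i\<in>(UNIV::2 set). 4 * gradient_const\<^sup>2 * D * (v x + L))"
    by (intro sum_mono) simp
  then show ?thesis by simp
qed

end

section \<open>The concave test\<close>

text \<open>A concave function lies below its tangent at \<open>b\<close>.\<close>
lemma powr_tangent:
  fixes z b p :: real
  assumes "0 < z" "0 < b" "0 < p" "p < 1"
  shows "z powr (1 - p) \<le> b powr (1 - p) + (1 - p) * b powr (- p) * (z - b)"
proof -
  have "z powr (1 - p) * b powr p \<le> (1 - p) * z + p * b"
    using assms by (intro Youngs_inequality_0) simp_all
  then have "z powr (1 - p) * b powr p * b powr (- p) \<le> ((1 - p) * z + p * b) * b powr (- p)"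
    by (intro mult_right_mono) simp_all
  moreover have "z powr (1 - p) * b powr p * b powr (- p) = z powr (1 - p)"
    using assms by (simp add: mult.assoc flip: powr_add)
  moreover have "b * b powr (- p) = b powr (1 - p)" using assms by (simp add: powr_diff powr_minus divide_inverse)
  then have "((1 - p) * z + p * b) * b powr (- p) = b powr (1 - p) + (1 - p) * b powr (- p) * (z - b)"
    by (simp add: algebra_simps)
  ultimately show ?thesis by simp
qed

context
  fixes v :: "real^2 \<Rightarrow> real" and D L p :: real
  assumes v: "smooth v" and v0: "\<And>y. 0 \<le> v y"
    and F0: "\<And>y. 0 \<le> laplacian v y" and FD: "\<And>y. laplacian v y \<le> D"
    and D: "0 < D" and L: "0 < L" and p: "0 < p" "p \<le> 1/2"
begin

text \<open>The function \<open>\<Gamma>\<close> of the introduction, normalised such that \<open>\<Gamma>'(0) = 1\<close>.\<close>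
definition concave_test :: "real \<Rightarrow> real" where
  "concave_test t = L / (1 - p) * (1 + t / L) powr (1 - p)"

lemma concave_base_pos: "0 < 1 + v x / L" using v0[of x] L by (simp add: add_pos_nonneg)

lemma DERIV_affine_powr:
  assumes "0 < 1 + t / L"
  shows "((\<lambda>t. c * (1 + t / L) powr a) has_real_derivative c * (a / L) * (1 + t / L) powr (a - 1)) (at t)"
proof -
  have "((\<lambda>t. (1 + t / L) powr a) has_real_derivative a * (1 + t / L) powr (a - 1) * (1 / L)) (at t)"
    using DERIV_fun_powr[of "\<lambda>t. 1 + t / L" "1 / L" t a] assms L
    by (auto intro!: derivative_eq_intros)
  from DERIV_cmult[OF this, of c] show ?thesis by (simp add: mult_ac)
qed

lemma smooth_concave_test: "smooth (\<lambda>x. concave_test (v x))"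
proof -
  define c where "c n = L / (1 - p) * (\<Prod>k<n. (1 - p - real k) / L)" for n
  have "smooth (\<lambda>x. c 0 * (1 + v x / L) powr (1 - p - real 0))"
  proof (rule smooth_compose[OF v, where d = "\<lambda>n t. c n * (1 + t / L) powr (1 - p - real n)"])
    fix n x
    show "((\<lambda>t. c n * (1 + t / L) powr (1 - p - real n)) has_real_derivative
        c (Suc n) * (1 + v x / L) powr (1 - p - real (Suc n))) (at (v x))"
    proof -
      have e: "c (Suc n) = c n * ((1 - p - real n) / L)" "1 - p - real (Suc n) = 1 - p - real n - 1"
        by (simp_all add: c_def)
      show ?thesis unfolding e by (rule DERIV_affine_powr[OF concave_base_pos])
    qed
  qed
  then show ?thesis by (simp add: c_def concave_test_def)
qed

text \<open>The first derivative of the concave function is \<open>(1 + v/L)\<close> to the power \<open>- p\<close>, which is nonnegative and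
  at least 1/2 where \<open>v \<le> L\<close>. Its second derivative carries the small factor \<open>p\<close> and a weight
  that exactly compensates the growth \<open>v + L\<close> of the squared gradient.\<close>
lemma laplacian_concave_test:
  "(if v x \<le> L then laplacian v x / 2 else 0) - 8 * gradient_const\<^sup>2 * p * D \<le> laplacian (\<lambda>x. concave_test (v x)) x"
proof -
  let ?z = "1 + v x / L"
  have z: "0 < ?z" by (rule concave_base_pos)
  have eq: "laplacian (\<lambda>x. concave_test (v x)) x =
     ?z powr (- p) * laplacian v x + (- p / L) * ?z powr (- p - 1) * (\<Sum>i\<in>UNIV. (partial_deriv i v x)\<^sup>2)"
  proof (rule laplacian_compose[OF v, where h' = "\<lambda>t. (1 + t / L) powr (- p)" and h'' = "\<lambda>t. (- p / L) * (1 + t / L) powr (- p - 1)"])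
    show "(concave_test has_real_derivative (1 + v y / L) powr (- p)) (at (v y))" for y
      using DERIV_affine_powr[OF concave_base_pos[of y], of "L / (1 - p)" "1 - p"] L p
      by (simp add: concave_test_def[abs_def])
    show "((\<lambda>t. (1 + t / L) powr (- p)) has_real_derivative (- p / L) * (1 + v y / L) powr (- p - 1)) (at (v y))" for y
      using DERIV_affine_powr[OF concave_base_pos[of y], of 1 "- p"] by simp
  qed
  have z1: "1 \<le> ?z" using v0[of x] L by simp
  have "(p / L) * ?z powr (- p - 1) * (\<Sum>i\<in>UNIV. (partial_deriv i v x)\<^sup>2)
      \<le> (p / L) * ?z powr (- p - 1) * (8 * gradient_const\<^sup>2 * D * (v x + L))"
    using p L by (intro mult_left_mono gradient_square_estimate[OF v v0 F0 FD L D]) simp_all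
  also have "v x + L = L * ?z" using L by (simp add: field_simps)
  also have "(p / L) * ?z powr (- p - 1) * (8 * gradient_const\<^sup>2 * D * (L * ?z))
      = 8 * gradient_const\<^sup>2 * p * D * (?z powr (- p - 1) * ?z)" using L by (simp add: mult_ac)
  also have "?z powr (- p - 1) * ?z = ?z powr (- p)" using z by (simp add: powr_diff)
  also have "8 * gradient_const\<^sup>2 * p * D * ?z powr (- p) \<le> 8 * gradient_const\<^sup>2 * p * D * 1"
  proof (rule mult_left_mono)
    have "?z powr (- p) \<le> 1 powr (- p)" using p z1 by (intro powr_mono2') simp_all
    then show "?z powr (- p) \<le> 1" by simp
  qed (use p D in simp)
  finally have second: "(p / L) * ?z powr (- p - 1) * (\<Sum>i\<in>UNIV. (partial_deriv i v x)\<^sup>2) \<le> 8 * gradient_const\<^sup>2 * p * D"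
    by simp
  have first: "(if v x \<le> L then laplacian v x / 2 else 0) \<le> ?z powr (- p) * laplacian v x"
  proof (cases "v x \<le> L")
    case True
    then have "?z \<le> 2" using L by simp
    then have "2 powr (- p) \<le> ?z powr (- p)" using p z by (intro powr_mono2') simp_all
    moreover have "2 powr (- (1/2)) \<le> (2::real) powr (- p)" using p by (intro powr_mono) simp_all
    moreover have "1/2 \<le> (2::real) powr (- (1/2))"
      using powr_mono[of "-1" "- (1/2)" "2::real"] by (simp add: powr_minus_divide)
    ultimately have "1/2 * laplacian v x \<le> ?z powr (- p) * laplacian v x"
      using F0[of x] by (intro mult_right_mono) linarith+
    then show ?thesis using True by simp
  next
    case False
    then show ?thesis using F0[of x] by simp
  qed
  show ?thesis unfolding eq using first second by simp
qed

text \<open>The inequality for the Laplacian of \<open>\<Gamma>(v)\<close> is tested with the kernel \<open>green\<close> at scale \<open>R\<close>. The integral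
  of \<open>\<Delta>\<Gamma>(v)\<close> against the kernel is at most the mean of \<open>\<Gamma>(v)\<close> at scale \<open>2 R\<close>, which by concavity is at
  most \<open>\<Gamma>\<close> of the mean of \<open>v\<close>. As \<open>v x \<le> L\<close>, that mean is at most \<open>L\<close> plus a multiple of \<open>D R\<^sup>2\<close>.\<close>
lemma low_set_mass:
  assumes R: "0 < R" and x: "v x \<le> L"
  shows "kernel_floor / 2 * (LINT y:ball x R \<inter> {y. v y \<le> L}|lebesgue. laplacian v y)
    \<le> 2 * L * (2 + 8 * kernel_bound * pi * D * R\<^sup>2 / L) powr (1 - p)
      + 32 * pi * kernel_bound * gradient_const\<^sup>2 * p * D * R\<^sup>2"
proof -
  let ?H = "\<lambda>x. concave_test (v x)" and ?K = kernel_bound and ?c = kernel_floor and ?G = gradient_const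
  let ?F = "laplacian v"
  define \<phi> where "\<phi> y = - dilate R green (x - y)" for y
  let ?S = "ball x R \<inter> {y. v y \<le> L}"
  have K: "1 \<le> ?K" and c: "0 < ?c" by (rule kernel_bound_ge_1, rule kernel_floor_pos)
  have H: "smooth ?H" by (rule smooth_concave_test)
  have vb: "v \<in> borel_measurable borel" by (rule smooth_borel[OF v])
  have Sb: "?S \<in> sets borel" "?S \<in> sets lebesgue"
  proof -
    have "{y. v y \<le> L} \<in> sets borel" using borel_measurable_le[of v borel "\<lambda>_. L"] vb by simp
    then show "?S \<in> sets borel" by simp
    then show "?S \<in> sets lebesgue" by simp
  qed
  have \<phi>t: "test_function (\<lambda>y. dilate R green (x - y))"
    using R by (intro test_function_reflect test_function_dilate test_function_green) simp
  have \<phi>0: "0 \<le> \<phi> y" for y unfolding \<phi>_def dilate_def using green_nonpos[of "(x - y) /\<^sub>R R"] by simp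
  have \<phi>K: "\<phi> y \<le> ?K" for y unfolding \<phi>_def dilate_def using green_bound(1)[of "(x - y) /\<^sub>R R"] by linarith
  have \<phi>c: "?c \<le> \<phi> y" if "y \<in> ball x R" for y
    unfolding \<phi>_def dilate_def
  proof (rule green_floor)
    show "norm ((x - y) /\<^sub>R R) \<le> 1" using that R
      by (simp add: dist_norm norm_scaleR_inverse divide_le_eq del: norm_scaleR)
  qed
  have \<phi>s: "\<phi> y = 0" if "y \<notin> ball x (2 * R)" for y
  proof -
    have "2 \<le> norm ((x - y) /\<^sub>R R)" using that R
      by (simp add: dist_norm norm_scaleR_inverse le_divide_eq del: norm_scaleR)
    then show ?thesis by (simp add: \<phi>_def dilate_def green_eq_0)
  qed
  have int_\<phi>: "integrable lebesgue (\<lambda>y. a y * \<phi> y)" if "locally_integrable a" for a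
    using integrable_mult_test[OF that \<phi>t] by (simp add: \<phi>_def)
  define g where "g y = (if v y \<le> L then ?F y / 2 else 0)" for y
  have g_li: "locally_integrable g"
  proof (rule locally_bounded_integrable)
    have "(\<lambda>y. indicator {y. v y \<le> L} y * (?F y / 2)) \<in> borel_measurable borel"
      using borel_measurable_le[of v borel "\<lambda>_. L"] vb smooth_borel[OF smooth_laplacian[OF v]] by simp
    moreover have "(\<lambda>y. indicator {y. v y \<le> L} y * (?F y / 2)) = g"
      by (auto simp: g_def fun_eq_iff indicator_def)
    ultimately show "g \<in> borel_measurable lebesgue" by (simp add: borel_lebesgue)
    have "\<bar>g y\<bar> \<le> D" for y using F0[of y] FD[of y] by (simp add: g_def)
    then show "\<exists>C. \<forall>y. norm y \<le> R \<longrightarrow> \<bar>g y\<bar> \<le> C" for R by blast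
  qed
  \<comment> \<open>The differential inequality for \<open>\<Gamma>(v)\<close>, multiplied by \<open>\<phi>\<close> and integrated.\<close>
  have \<phi>int: "(LINT y|lebesgue. \<phi> y) \<le> 4 * pi * ?K * R\<^sup>2"
  proof -
    have "(LINT y|lebesgue. \<phi> y) \<le> (LINT y|lebesgue. indicator (ball x (2 * R)) y *\<^sub>R ?K)"
    proof (rule integral_mono)
      show "integrable lebesgue \<phi>" using int_\<phi>[OF locally_integrable_const[of 1]] by simp
      show "integrable lebesgue (\<lambda>y. indicator (ball x (2 * R)) y *\<^sub>R ?K)"
        using locally_integrable_ball[OF locally_integrable_const] unfolding set_integrable_def .
      show "\<phi> y \<le> indicator (ball x (2 * R)) y *\<^sub>R ?K" for y
        using \<phi>K[of y] \<phi>s[of y] by (cases "y \<in> ball x (2 * R)") simp_all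
    qed
    also have "\<dots> = 4 * pi * ?K * R\<^sup>2" using R by (simp add: content_ball unit_ball_vol_2 power_mult_distrib)
    finally show ?thesis .
  qed
  have gS: "?c / 2 * (LINT y:?S|lebesgue. ?F y) \<le> (LINT y|lebesgue. g y * \<phi> y)"
  proof -
    have "?c / 2 * (LINT y:?S|lebesgue. ?F y) = (LINT y|lebesgue. ?c / 2 * (indicator ?S y *\<^sub>R ?F y))"
      by (simp add: set_lebesgue_integral_def)
    also have "\<dots> \<le> (LINT y|lebesgue. g y * \<phi> y)"
    proof (rule integral_mono[OF _ int_\<phi>[OF g_li]])
      have "set_integrable lebesgue ?S ?F"
        by (rule set_integrable_subset[OF locally_integrable_ball[OF smooth_locally_integrable[OF smooth_laplacian[OF v]], of x R] Sb(2)]) simp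
      then show "integrable lebesgue (\<lambda>y. ?c / 2 * (indicator ?S y *\<^sub>R ?F y))"
        unfolding set_integrable_def by (rule integrable_mult_right)
      fix y
      show "?c / 2 * (indicator ?S y *\<^sub>R ?F y) \<le> g y * \<phi> y"
      proof (cases "y \<in> ?S")
        case True
        then have "?F y / 2 * ?c \<le> ?F y / 2 * \<phi> y" using F0[of y] \<phi>c[of y] by (intro mult_left_mono) simp_all
        then show ?thesis using True by (simp add: g_def mult_ac)
      next
        case False
        have "0 \<le> g y * \<phi> y" using F0[of y] \<phi>0[of y] by (simp add: g_def)
        then show ?thesis using False by simp
      qed
    qed
    finally show ?thesis .
  qed
  have "(LINT y|lebesgue. g y * \<phi> y) - 8 * ?G\<^sup>2 * p * D * (LINT y|lebesgue. \<phi> y)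
      = (LINT y|lebesgue. g y * \<phi> y - 8 * ?G\<^sup>2 * p * D * \<phi> y)"
    by (subst Bochner_Integration.integral_diff[OF int_\<phi>[OF g_li] int_\<phi>[OF locally_integrable_const]]) simp
  also have "\<dots> \<le> (LINT y|lebesgue. laplacian ?H y * \<phi> y)"
  proof (rule integral_mono)
    show "integrable lebesgue (\<lambda>y. g y * \<phi> y - 8 * ?G\<^sup>2 * p * D * \<phi> y)"
      by (intro Bochner_Integration.integrable_diff int_\<phi> g_li locally_integrable_const)
    show "integrable lebesgue (\<lambda>y. laplacian ?H y * \<phi> y)"
      by (intro int_\<phi> smooth_locally_integrable smooth_laplacian H)
    fix y
    have "(g y - 8 * ?G\<^sup>2 * p * D) * \<phi> y \<le> laplacian ?H y * \<phi> y"
      using laplacian_concave_test[of y] by (intro mult_right_mono \<phi>0) (simp add: g_def)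
    then show "g y * \<phi> y - 8 * ?G\<^sup>2 * p * D * \<phi> y \<le> laplacian ?H y * \<phi> y" by (simp only: left_diff_distrib)
  qed
  also have "\<dots> = mean (2 * R) ?H x - mean R ?H x"
    using mean_doubling[OF poisson_smooth[OF H] R, of x] by (simp add: conv_def \<phi>_def)
  also have "\<dots> \<le> mean (2 * R) ?H x"
  proof -
    have "0 \<le> mean R ?H x"
      using L p by (intro mean_nonneg[OF smooth_locally_integrable[OF H] R]) (simp add: concave_test_def)
    then show ?thesis by simp
  qed
  finally have lower: "?c / 2 * (LINT y:?S|lebesgue. ?F y) \<le> mean (2 * R) ?H x + 8 * ?G\<^sup>2 * p * D * (LINT y|lebesgue. \<phi> y)"
    using gS by linarith
  have "8 * ?G\<^sup>2 * p * D * (LINT y|lebesgue. \<phi> y) \<le> 8 * ?G\<^sup>2 * p * D * (4 * pi * ?K * R\<^sup>2)"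
    using p D by (intro mult_left_mono \<phi>int) simp_all
  then have lower': "?c / 2 * (LINT y:?S|lebesgue. ?F y) \<le> mean (2 * R) ?H x + 32 * pi * ?K * ?G\<^sup>2 * p * D * R\<^sup>2"
    using lower by (simp add: mult_ac)
  \<comment> \<open>Jensen's inequality for \<open>\<Gamma>\<close>: the tangent is taken at the point \<open>L (b - 1)\<close> that bounds the mean of \<open>v\<close>.\<close>
  define b where "b = 2 + 8 * ?K * pi * D * R\<^sup>2 / L"
  have b: "0 < b" unfolding b_def using K D L by (simp add: add_pos_nonneg)
  have tangent: "concave_test t \<le> (L / (1 - p) * b powr (1 - p) + L * b powr (- p) * (1 - b)) + b powr (- p) * t" if "0 \<le> t" for t
  proof -
    have z: "0 < 1 + t / L" using that L by (simp add: add_pos_nonneg)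
    have "concave_test t \<le> L / (1 - p) * (b powr (1 - p) + (1 - p) * b powr (- p) * (1 + t / L - b))"
      unfolding concave_test_def using p L by (intro mult_left_mono powr_tangent z b) simp_all
    also have "\<dots> = L / (1 - p) * b powr (1 - p) + L * b powr (- p) * (1 + t / L - b)"
      using p by (simp add: distrib_left)
    also have "L * b powr (- p) * (1 + t / L - b) = L * b powr (- p) * (1 - b) + b powr (- p) * t"
      using L by (simp add: field_simps)
    finally show ?thesis by simp
  qed
  have "mean (2 * R) ?H x \<le> mean (2 * R) (\<lambda>y. (L / (1 - p) * b powr (1 - p) + L * b powr (- p) * (1 - b)) + b powr (- p) * v y) x"
    using R by (intro mean_mono smooth_locally_integrable H locally_integrable_add locally_integrable_const
        locally_integrable_cmult v tangent v0) simp
  also have "\<dots> = (L / (1 - p) * b powr (1 - p) + L * b powr (- p) * (1 - b)) + b powr (- p) * mean (2 * R) v x"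
    using R by (intro mean_affine smooth_locally_integrable v) simp
  also have "\<dots> \<le> (L / (1 - p) * b powr (1 - p) + L * b powr (- p) * (1 - b)) + b powr (- p) * (L * (b - 1))"
  proof (intro add_left_mono mult_left_mono)
    have "mean (2 * R) v x \<le> L + 2 * ?K * pi * D * (2 * R)\<^sup>2"
      using mean_le_value[OF v v0 F0 FD, of "2 * R" x] R x by simp
    also have "\<dots> = L * (b - 1)" unfolding b_def using L by (simp add: field_simps power2_eq_square)
    finally show "mean (2 * R) v x \<le> L * (b - 1)" .
  qed simp
  also have "\<dots> = L / (1 - p) * b powr (1 - p)" by (simp add: algebra_simps)
  also have "\<dots> \<le> 2 * L * b powr (1 - p)"
  proof (intro mult_right_mono)
    have "L / (1 - p) \<le> L / (1/2)" using p L by (intro divide_left_mono) simp_all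
    then show "L / (1 - p) \<le> 2 * L" by simp
  qed simp
  finally show ?thesis using lower' unfolding b_def by linarith
qed

end

section \<open>Decay of the mass\<close>

lemma set_integral_le_area:
  fixes f :: "real^2 \<Rightarrow> real"
  assumes "locally_integrable f" "\<And>y. 0 \<le> f y" "S \<in> sets lebesgue" "S \<subseteq> ball x R" "\<And>y. y \<in> S \<Longrightarrow> f y \<le> m" "0 \<le> R" "0 \<le> m"
  shows "(LINT y:S|lebesgue. f y) \<le> m * (pi * R\<^sup>2)"
proof -
  have "(LINT y:S|lebesgue. f y) \<le> (LINT y:ball x R|lebesgue. m)"
    unfolding set_lebesgue_integral_def
  proof (rule integral_mono)
    show "integrable lebesgue (\<lambda>y. indicator S y *\<^sub>R f y)"
      using set_integrable_subset[OF locally_integrable_ball[OF assms(1)] assms(3,4)] unfolding set_integrable_def .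
    show "integrable lebesgue (\<lambda>y. indicator (ball x R) y *\<^sub>R m)"
      using locally_integrable_ball[OF locally_integrable_const] unfolding set_integrable_def .
    show "indicator S y *\<^sub>R f y \<le> indicator (ball x R) y *\<^sub>R m" for y
      using assms(4,5,7) by (cases "y \<in> S") (auto simp: indicator_def)
  qed
  also have "\<dots> = m * (pi * R\<^sup>2)" using assms(6) by (simp add: set_lebesgue_integral_def content_ball unit_ball_vol_2)
  finally show ?thesis .
qed

context
  fixes w f :: "real^2 \<Rightarrow> real" and M :: real
  assumes p: "poisson w f" and w0: "\<And>y. 0 \<le> w y" and f0: "\<And>y. 0 \<le> f y"
    and fM: "\<And>y. f y \<le> M * exp (- (2 * w y))"
begin

lemma density_bound_nonneg: "0 \<le> M"
proof -
  have "0 \<le> M * exp (- (2 * w 0))" using f0[of 0] fM[of 0] by linarith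
  then show ?thesis by (simp add: zero_le_mult_iff)
qed

lemma density_le_bound: "f y \<le> M"
proof -
  have "M * exp (- (2 * w y)) \<le> M * 1" using density_bound_nonneg w0[of y] by (intro mult_left_mono) simp_all
  then show ?thesis using fM[of y] by simp
qed

lemma abs_density: "(\<lambda>y. \<bar>f y\<bar>) = f"
  using f0 by (simp add: fun_eq_iff)

lemma w_locally_integrable: "locally_integrable w" and f_locally_integrable: "locally_integrable f"
  using p by (simp_all add: poisson_def)

text \<open>The pointwise inequality between \<open>f\<close> and \<open>w\<close> speaks of values of \<open>w\<close>, whereas the estimates speak of
  means; the two are linked here.\<close>
lemma AE_dyadic_mean_tendsto: "0 < r \<Longrightarrow> AE x in lebesgue. (\<lambda>j. mean (r / 2 ^ j) w x) \<longlonglongrightarrow> w x"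
  by (rule AE_mean_tendsto[OF p]) (use f0 density_le_bound in \<open>simp add: abs_of_nonneg\<close>)

text \<open>Passage from the scale \<open>r0\<close> to the scale \<open>R\<close>. The constant \<open>Q\<close> precedes all other quantities: \<open>\<theta>\<close>,
  \<open>R / r0\<close>, \<open>\<epsilon>\<close> and \<open>B\<close> are later chosen in dependence on it. The exponential term is the
  contribution of the points where the averaged \<open>w\<close> is large.\<close>
lemma scale_step:
  "\<exists>Q>0. \<forall>B \<epsilon> r0 \<theta> R x. 0 < B \<and> 0 < \<epsilon> \<and> \<epsilon> \<le> 1/2 \<and> 0 < r0 \<and> r0 \<le> R \<and> 0 < \<theta> \<and> \<theta> \<le> 1/2 \<and>
     (\<forall>x \<rho>. 0 < \<rho> \<and> \<rho> \<le> r0 \<longrightarrow> mass f x \<rho> \<le> B * \<rho> powr (2 - \<epsilon>)) \<longrightarrow>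
     mass f x (R / 4) \<le> Q * R\<^sup>2 * (B * r0 powr (- \<epsilon>) * (\<theta> + (r0 / R) powr (2 * \<theta>)) + M * exp (- (2 * (B * r0 powr (- \<epsilon>) * r0\<^sup>2))))"
proof -
  let ?K = kernel_bound and ?c = kernel_floor and ?G = gradient_const
  have K: "1 \<le> ?K" and c: "0 < ?c" by (rule kernel_bound_ge_1, rule kernel_floor_pos)
  define Q1 where "Q1 = 16 * ?K / ?c"
  define Q2 where "Q2 = Q1 * (2 * ?K + 1)"
  define E where "E = 2 + 64 * ?K\<^sup>2 * pi / Q2"
  define Q where "Q = 2 / ?c * (2 * Q2 * E + 256 * pi * ?K\<^sup>2 * ?G\<^sup>2) + pi"
  have Q1: "0 < Q1" unfolding Q1_def using K c by simp
  have Q2: "0 < Q2" unfolding Q2_def using K Q1 by simp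
  have E: "1 \<le> E" "0 < E" unfolding E_def using K Q2 by (simp_all add: add_increasing2 add_pos_nonneg)
  have Q: "0 < Q" unfolding Q_def using c Q2 E by (intro add_nonneg_pos mult_nonneg_nonneg add_nonneg_nonneg) simp_all
  show ?thesis
  proof (intro exI[of _ Q] conjI Q allI impI, elim conjE)
    fix B \<epsilon> r0 \<theta> R :: real and x :: "real^2"
    assume B: "0 < B" and \<epsilon>: "0 < \<epsilon>" "\<epsilon> \<le> 1/2" and r0: "0 < r0" and R: "r0 \<le> R" and \<theta>: "0 < \<theta>" "\<theta> \<le> 1/2"
      and growth0: "\<forall>x \<rho>. 0 < \<rho> \<and> \<rho> \<le> r0 \<longrightarrow> mass f x \<rho> \<le> B * \<rho> powr (2 - \<epsilon>)"
    have growth: "mass f x \<rho> \<le> B * \<rho> powr (2 - \<epsilon>)" if "0 < \<rho>" "\<rho> \<le> r0" for x \<rho>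
      using growth0 that by blast
    have R0: "0 < R" using r0 R by linarith
    define D0 where "D0 = B * r0 powr (- \<epsilon>)"
    have D0: "0 < D0" unfolding D0_def using B r0 by simp
    \<comment> \<open>With this averaging scale the balls that occur have radius at most \<open>r0 / 2\<close>, where the
      mass is controlled.\<close>
    define s where "s = r0 / 8"
    have s: "0 < s" unfolding s_def using r0 by simp
    define v where "v = mean s w"
    define F where "F = mean s f"
    define L where "L = Q2 * D0 * r0\<^sup>2"
    define D where "D = 8 * ?K * D0"
    have L: "0 < L" unfolding L_def using Q2 D0 r0 by simp
    have D: "0 < D" unfolding D_def using K D0 by simp
    have scale: "B * (r0 / a) powr (2 - \<epsilon>) \<le> D0 * r0\<^sup>2 / a" if a: "1 \<le> a" for a
    proof -
      have "B * (r0 / a) powr (2 - \<epsilon>) = B * r0 powr (2 - \<epsilon>) / a powr (2 - \<epsilon>)" using r0 a by (simp add: powr_divide)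
      also have "r0 powr (2 - \<epsilon>) = r0 powr (- \<epsilon>) * r0\<^sup>2"
      proof -
        have "2 - \<epsilon> = - \<epsilon> + 2" by simp
        then show ?thesis using r0 by (simp only: powr_add powr_numeral)
      qed
      also have "B * (r0 powr (- \<epsilon>) * r0\<^sup>2) / a powr (2 - \<epsilon>) = D0 * r0\<^sup>2 / a powr (2 - \<epsilon>)" by (simp add: D0_def)
      also have "\<dots> \<le> D0 * r0\<^sup>2 / a"
      proof (rule divide_left_mono)
        have "a powr 1 \<le> a powr (2 - \<epsilon>)" using \<epsilon> a by (intro powr_mono) simp_all
        then show "a \<le> a powr (2 - \<epsilon>)" using a by simp
      qed (use D0 a in simp_all)
      finally show ?thesis .
    qed
    have vs: "smooth v" unfolding v_def by (rule smooth_mean[OF w_locally_integrable s])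
    have lap: "laplacian v = F" unfolding v_def F_def by (rule ext) (rule laplacian_mean[OF p s])
    have v0: "0 \<le> v y" for y unfolding v_def by (rule mean_nonneg[OF w_locally_integrable s w0])
    have F0: "0 \<le> F y" for y unfolding F_def by (rule mean_nonneg[OF f_locally_integrable s f0])
    have FD: "F y \<le> D" for y
    proof -
      have "F y \<le> ?K / s\<^sup>2 * mass f y s" using mean_le_mass[OF f_locally_integrable s, of y] by (simp add: F_def abs_density)
      also have "\<dots> \<le> ?K / s\<^sup>2 * (D0 * r0\<^sup>2 / 8)"
      proof (rule mult_left_mono)
        have "mass f y s \<le> B * (r0 / 8) powr (2 - \<epsilon>)" using growth[of s y] s r0 by (simp add: s_def)
        also have "\<dots> \<le> D0 * r0\<^sup>2 / 8" by (rule scale) simp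
        finally show "mass f y s \<le> D0 * r0\<^sup>2 / 8" .
      qed (use K in simp)
      also have "\<dots> = D" unfolding s_def D_def using r0 by (simp add: power2_eq_square)
      finally show ?thesis .
    qed
    have F_li: "locally_integrable F" unfolding F_def by (rule smooth_locally_integrable[OF smooth_mean[OF f_locally_integrable s]])
    \<comment> \<open>If \<open>v > L\<close> at a point, then \<open>w > D0 r0\<^sup>2\<close> almost everywhere in the ball over which \<open>f\<close> is averaged
      there: \<open>v\<close> is compared with a mean around the other point and the latter with the value of \<open>w\<close>.\<close>
    have AE_w: "AE y in lebesgue. mean (4 * s) w y \<le> w y + 2 * ?K * (D0 * r0\<^sup>2)"
    proof -
      have s4: "0 < 4 * s" using s by simp
      have tele: "\<bar>mean (4 * s / 2 ^ n) w y - mean (4 * s) w y\<bar> \<le> 2 * ?K * (D0 * r0\<^sup>2)" for n y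
      proof -
        have "\<bar>mean (4 * s / 2 ^ n) w y - mean (4 * s) w y\<bar> \<le> 2 * ?K * B * (4 * s) powr (2 - \<epsilon>)"
          by (rule mean_telescope(1)[OF p s4]) (use growth s \<epsilon> in \<open>simp_all add: abs_density s_def\<close>)
        also have "\<dots> = 2 * ?K * (B * (r0 / 2) powr (2 - \<epsilon>))" by (simp add: s_def)
        also have "\<dots> \<le> 2 * ?K * (D0 * r0\<^sup>2 / 2)" using K by (intro mult_left_mono scale) simp_all
        also have "\<dots> \<le> 2 * ?K * (D0 * r0\<^sup>2)" using K D0 by (intro mult_left_mono) simp_all
        finally show ?thesis .
      qed
      show ?thesis
        using AE_dyadic_mean_tendsto[OF s4]
      proof (rule eventually_mono)
        fix y assume "(\<lambda>j. mean (4 * s / 2 ^ j) w y) \<longlonglongrightarrow> w y"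
        then have "(\<lambda>j. \<bar>mean (4 * s / 2 ^ j) w y - mean (4 * s) w y\<bar>) \<longlonglongrightarrow> \<bar>w y - mean (4 * s) w y\<bar>"
          by (intro tendsto_intros)
        then have "\<bar>w y - mean (4 * s) w y\<bar> \<le> 2 * ?K * (D0 * r0\<^sup>2)" by (rule LIMSEQ_upper_bound) (rule tele)
        then show "mean (4 * s) w y \<le> w y + 2 * ?K * (D0 * r0\<^sup>2)" by linarith
      qed
    qed
    define m where "m = M * exp (- (2 * (D0 * r0\<^sup>2)))"
    have m0: "0 \<le> m" unfolding m_def using density_bound_nonneg by simp
    have deep: "F y \<le> m" if "L < v y" for y
      unfolding F_def
    proof (rule mean_le[OF f_locally_integrable s])
      show "AE z in lebesgue. z \<in> ball y s \<longrightarrow> f z \<le> m"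
        using AE_w
      proof (rule eventually_mono, intro impI)
        fix z assume z: "mean (4 * s) w z \<le> w z + 2 * ?K * (D0 * r0\<^sup>2)" "z \<in> ball y s"
        have "v y \<le> Q1 * mean (4 * s) w z"
          unfolding v_def Q1_def by (rule mean_Harnack[OF w_locally_integrable s w0]) (use z(2) in simp)
        also have "\<dots> \<le> Q1 * (w z + 2 * ?K * (D0 * r0\<^sup>2))" using Q1 z(1) by (intro mult_left_mono) simp_all
        finally have "Q1 * ((2 * ?K + 1) * (D0 * r0\<^sup>2)) < Q1 * (w z + 2 * ?K * (D0 * r0\<^sup>2))"
          using that unfolding L_def Q2_def by (simp add: mult.assoc)
        then have "D0 * r0\<^sup>2 < w z" using Q1 by (simp add: distrib_right)
        then have "M * exp (- (2 * w z)) \<le> m" unfolding m_def using density_bound_nonneg by (intro mult_left_mono) simp_all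
        then show "f z \<le> m" using fM[of z] by linarith
      qed
    qed
    \<comment> \<open>The low part is bounded by \<open>low_set_mass\<close>, which needs a centre in the low set.\<close>
    have centred: "mass F x0 R \<le> Q * R\<^sup>2 * (D0 * (\<theta> + (r0 / R) powr (2 * \<theta>)) + m)" if x0: "v x0 \<le> L" for x0
    proof -
      let ?S = "ball x0 R \<inter> {y. v y \<le> L}" and ?T = "ball x0 R \<inter> {y. L < v y}"
      have vb: "v \<in> borel_measurable borel" by (rule smooth_borel[OF vs])
      have S: "?S \<in> sets lebesgue" and T: "?T \<in> sets lebesgue"
      proof -
        have "{y. v y \<le> L} \<in> sets borel" "{y. L < v y} \<in> sets borel"
          using borel_measurable_le[of v borel "\<lambda>_. L"] borel_measurable_less[of "\<lambda>_. L" borel v] vb by simp_all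
        then have "?S \<in> sets borel" "?T \<in> sets borel" by simp_all
        then show "?S \<in> sets lebesgue" "?T \<in> sets lebesgue" by simp_all
      qed
      have split: "mass F x0 R = (LINT y:?S|lebesgue. F y) + (LINT y:?T|lebesgue. F y)"
      proof -
        have "ball x0 R = ?S \<union> ?T" by auto
        then have "mass F x0 R = (LINT y:?S \<union> ?T|lebesgue. F y)" by (simp add: mass_def)
        also have "\<dots> = (LINT y:?S|lebesgue. F y) + (LINT y:?T|lebesgue. F y)"
        proof (rule set_integral_Un)
          show "set_integrable lebesgue ?S F" by (rule set_integrable_subset[OF locally_integrable_ball[OF F_li, of x0 R] S]) simp
          show "set_integrable lebesgue ?T F" by (rule set_integrable_subset[OF locally_integrable_ball[OF F_li, of x0 R] T]) simp
        qed auto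
        finally show ?thesis .
      qed
      define t where "t = R / r0"
      have t: "1 \<le> t" unfolding t_def using R r0 by simp
      have b: "2 + 8 * ?K * pi * D * R\<^sup>2 / L \<le> E * t\<^sup>2"
      proof -
        have "8 * ?K * pi * D * R\<^sup>2 / L = 64 * ?K\<^sup>2 * pi / Q2 * t\<^sup>2"
          unfolding D_def L_def t_def using D0 by (simp add: power2_eq_square)
        moreover have "2 \<le> 2 * t\<^sup>2" using t by (simp add: one_le_power)
        ultimately show ?thesis unfolding E_def by (simp add: distrib_right)
      qed
      have "2 * L * (2 + 8 * ?K * pi * D * R\<^sup>2 / L) powr (1 - \<theta>) \<le> 2 * L * (E * (t\<^sup>2 * t powr (- (2 * \<theta>))))"
      proof (rule mult_left_mono)
        have "(2 + 8 * ?K * pi * D * R\<^sup>2 / L) powr (1 - \<theta>) \<le> (E * t\<^sup>2) powr (1 - \<theta>)"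
          using \<theta> b K D L by (intro powr_mono2) simp_all
        also have "\<dots> = E powr (1 - \<theta>) * (t\<^sup>2) powr (1 - \<theta>)" using E t by (simp add: powr_mult)
        also have "\<dots> \<le> E * (t\<^sup>2) powr (1 - \<theta>)"
        proof (rule mult_right_mono)
          have "E powr (1 - \<theta>) \<le> E powr 1" using E \<theta> by (intro powr_mono) simp_all
          then show "E powr (1 - \<theta>) \<le> E" using E by simp
        qed simp
        also have "(t\<^sup>2) powr (1 - \<theta>) = t\<^sup>2 * t powr (- (2 * \<theta>))"
        proof -
          have "(t\<^sup>2) powr (1 - \<theta>) = t powr (2 * (1 - \<theta>))" using t by (simp add: powr_powr flip: powr_numeral)
          also have "2 * (1 - \<theta>) = 2 + - (2 * \<theta>)" by simp
          also have "t powr (2 + - (2 * \<theta>)) = t\<^sup>2 * t powr (- (2 * \<theta>))" using t by (simp only: powr_add) (simp add: powr_numeral)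
          finally show ?thesis .
        qed
        finally show "(2 + 8 * ?K * pi * D * R\<^sup>2 / L) powr (1 - \<theta>) \<le> E * (t\<^sup>2 * t powr (- (2 * \<theta>)))" .
      qed (use L in simp)
      also have "\<dots> = 2 * Q2 * E * (D0 * R\<^sup>2 * (r0 / R) powr (2 * \<theta>))"
      proof -
        have "t powr (- (2 * \<theta>)) = (r0 / R) powr (2 * \<theta>)"
          unfolding t_def using r0 R0 by (simp add: powr_divide powr_minus field_simps)
        moreover have "L * t\<^sup>2 = Q2 * D0 * R\<^sup>2" unfolding L_def t_def using r0 by (simp add: power2_eq_square)
        ultimately show ?thesis by (simp add: mult_ac)
      qed
      finally have up: "2 * L * (2 + 8 * ?K * pi * D * R\<^sup>2 / L) powr (1 - \<theta>) \<le> 2 * Q2 * E * (D0 * R\<^sup>2 * (r0 / R) powr (2 * \<theta>))" .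
      have "?c / 2 * (LINT y:?S|lebesgue. F y)
         \<le> 2 * L * (2 + 8 * ?K * pi * D * R\<^sup>2 / L) powr (1 - \<theta>) + 32 * pi * ?K * ?G\<^sup>2 * \<theta> * D * R\<^sup>2"
        using low_set_mass[OF vs v0 _ _ D L \<theta> R0 x0] F0 FD unfolding lap by blast
      also have "\<dots> \<le> 2 * Q2 * E * (D0 * R\<^sup>2 * (r0 / R) powr (2 * \<theta>)) + 256 * pi * ?K\<^sup>2 * ?G\<^sup>2 * (D0 * R\<^sup>2 * \<theta>)"
        using up unfolding D_def by (simp add: power2_eq_square mult_ac)
      also have "\<dots> \<le> (2 * Q2 * E + 256 * pi * ?K\<^sup>2 * ?G\<^sup>2) * (D0 * R\<^sup>2 * (r0 / R) powr (2 * \<theta>))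
          + (2 * Q2 * E + 256 * pi * ?K\<^sup>2 * ?G\<^sup>2) * (D0 * R\<^sup>2 * \<theta>)"
        using Q2 E D0 \<theta> by (intro add_mono mult_right_mono) simp_all
      finally have "(LINT y:?S|lebesgue. F y) \<le> 2 / ?c * ((2 * Q2 * E + 256 * pi * ?K\<^sup>2 * ?G\<^sup>2) * (D0 * R\<^sup>2 * (\<theta> + (r0 / R) powr (2 * \<theta>))))"
        using c by (simp add: field_simps)
      also have "\<dots> = (Q - pi) * (R\<^sup>2 * (D0 * (\<theta> + (r0 / R) powr (2 * \<theta>))))"
        unfolding Q_def by (simp add: mult_ac)
      also have "\<dots> \<le> Q * (R\<^sup>2 * (D0 * (\<theta> + (r0 / R) powr (2 * \<theta>))))"
        using D0 \<theta> by (intro mult_right_mono mult_nonneg_nonneg add_nonneg_nonneg) simp_all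
      finally have S_le: "(LINT y:?S|lebesgue. F y) \<le> Q * R\<^sup>2 * (D0 * (\<theta> + (r0 / R) powr (2 * \<theta>)))" by (simp only: mult.assoc)
      have "(LINT y:?T|lebesgue. F y) \<le> m * (pi * R\<^sup>2)"
        by (rule set_integral_le_area[OF F_li F0 T]) (use deep R0 m0 in auto)
      also have "\<dots> \<le> Q * R\<^sup>2 * m"
      proof -
        have "pi \<le> Q" unfolding Q_def using c Q2 E by simp
        then have "pi * (R\<^sup>2 * m) \<le> Q * (R\<^sup>2 * m)" using m0 by (intro mult_right_mono) simp_all
        then show ?thesis by (simp only: mult_ac)
      qed
      finally show ?thesis unfolding split using S_le by (simp add: distrib_left)
    qed
    \<comment> \<open>Either the ball of radius \<open>R / 2\<close> contains a low point, which serves as centre, or all its points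
      are deep.\<close>
    have "mass f x (R / 4) \<le> mass F x (R / 4 + s)" unfolding F_def by (rule mass_le_mass_mean[OF f_locally_integrable s f0])
    also have "\<dots> \<le> mass F x (R / 2)"
      by (intro mass_subset F_li F0 subset_ball) (use R r0 in \<open>simp add: s_def\<close>)
    also have "\<dots> \<le> Q * R\<^sup>2 * (D0 * (\<theta> + (r0 / R) powr (2 * \<theta>)) + m)"
    proof (cases "\<exists>x0\<in>ball x (R / 2). v x0 \<le> L")
      case True
      then obtain x0 where x0: "x0 \<in> ball x (R / 2)" "v x0 \<le> L" by blast
      have "ball x (R / 2) \<subseteq> ball x0 R"
      proof
        fix z assume "z \<in> ball x (R / 2)"
        then show "z \<in> ball x0 R" using x0(1) dist_triangle[of x0 z x] by (simp add: dist_commute)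
      qed
      then have "mass F x (R / 2) \<le> mass F x0 R" by (intro mass_subset F_li F0)
      then show ?thesis using centred[OF x0(2)] by linarith
    next
      case False
      then have "F y \<le> m" if "y \<in> ball x (R / 2)" for y
        using that by (intro deep) (meson not_le)
      then have "mass F x (R / 2) \<le> m * (pi * (R / 2)\<^sup>2)"
        using R0 by (intro mass_le[OF F_li]) simp_all
      also have "\<dots> \<le> Q * R\<^sup>2 * m"
      proof -
        have "pi \<le> Q" unfolding Q_def using c Q2 E by simp
        then have "pi * (R\<^sup>2 * m) \<le> Q * (R\<^sup>2 * m)" using m0 by (intro mult_right_mono) simp_all
        moreover have "m * (pi * (R / 2)\<^sup>2) \<le> pi * (R\<^sup>2 * m)"
          using m0 by (simp add: power_divide mult_ac)
        ultimately show ?thesis by (simp only: mult.assoc)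
      qed
      also have "\<dots> \<le> Q * R\<^sup>2 * (D0 * (\<theta> + (r0 / R) powr (2 * \<theta>)) + m)"
        using Q D0 \<theta> by (intro mult_left_mono) simp_all
      finally show ?thesis .
    qed
    finally show "mass f x (R / 4) \<le> Q * R\<^sup>2 * (B * r0 powr (- \<epsilon>) * (\<theta> + (r0 / R) powr (2 * \<theta>)) + M * exp (- (2 * (B * r0 powr (- \<epsilon>) * r0\<^sup>2))))"
      unfolding m_def D0_def .
  qed
qed

text \<open>One step of \<open>scale_step\<close> from \<open>r0\<close> to \<open>4 \<rho> = A r0\<close> is to reproduce the bound at the radius
  \<open>\<rho> = (A/4) r0\<close>. First \<open>q\<close> and then \<open>A\<close> are chosen such that both terms next to \<open>D0\<close> are at most
  \<open>1 / (96 Q)\<close>. Together with the exponential term the step then yields at most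
  \<open>16 Q \<cdot> 3 / (96 Q) = 1/2\<close> of the density at \<open>r0\<close>. Next \<open>\<epsilon>\<close> is so small that
  \<open>(A/4)\<close> to the power \<open>\<epsilon>\<close> is at most 2, so that a halving suffices. Finally \<open>B\<close> is large enough for
  the radii up to \<open>A\<close>, where only \<open>f \<le> M\<close> is used, and for the exponential term.\<close>
lemma mass_decay:
  "\<exists>\<epsilon> B. 0 < \<epsilon> \<and> \<epsilon> \<le> 1/2 \<and> 0 < B \<and> (\<forall>x \<rho>. 0 < \<rho> \<longrightarrow> mass f x \<rho> \<le> B * \<rho> powr (2 - \<epsilon>))"
proof -
  obtain Q where Q: "0 < Q" and step0: "\<forall>B \<epsilon> r0 \<theta> R x. 0 < B \<and> 0 < \<epsilon> \<and> \<epsilon> \<le> 1/2 \<and> 0 < r0 \<and> r0 \<le> R \<and> 0 < \<theta> \<and> \<theta> \<le> 1/2 \<and>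
     (\<forall>x \<rho>. 0 < \<rho> \<and> \<rho> \<le> r0 \<longrightarrow> mass f x \<rho> \<le> B * \<rho> powr (2 - \<epsilon>)) \<longrightarrow>
     mass f x (R / 4) \<le> Q * R\<^sup>2 * (B * r0 powr (- \<epsilon>) * (\<theta> + (r0 / R) powr (2 * \<theta>)) + M * exp (- (2 * (B * r0 powr (- \<epsilon>) * r0\<^sup>2))))"
    using scale_step by (elim exE conjE) (rule that, assumption+)
  define q where "q = min (1/2) (1 / (96 * Q))"
  define A where "A = max 8 ((96 * Q) powr (1 / (2 * q)))"
  define \<epsilon> where "\<epsilon> = min (1/2) (ln 2 / ln (A / 4))"
  define B where "B = max 1 (max (48 * Q * M) (pi * M * A))"
  have q: "0 < q" "q \<le> 1/2" "q \<le> 1 / (96 * Q)" unfolding q_def using Q by simp_all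
  have A: "8 \<le> A" unfolding A_def by simp
  have lnA: "0 < ln (A / 4)" using A by simp
  have "0 < \<epsilon>" unfolding \<epsilon>_def using lnA by simp
  moreover have "\<epsilon> \<le> 1/2" unfolding \<epsilon>_def by (rule min.cobounded1)
  ultimately have \<epsilon>: "0 < \<epsilon>" "\<epsilon> \<le> 1/2" by simp_all
  have B: "1 \<le> B" "48 * Q * M \<le> B" "pi * M * A \<le> B" unfolding B_def by simp_all
  have Aq: "(1 / A) powr (2 * q) \<le> 1 / (96 * Q)"
  proof -
    have "96 * Q = ((96 * Q) powr (1 / (2 * q))) powr (2 * q)" using q Q by (simp add: powr_powr)
    also have "\<dots> \<le> A powr (2 * q)" using q by (intro powr_mono2) (simp_all add: A_def)
    finally have "1 / A powr (2 * q) \<le> 1 / (96 * Q)" using Q A by (intro divide_left_mono mult_pos_pos) simp_all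
    then show ?thesis using A by (simp add: powr_divide)
  qed
  have A\<epsilon>: "(A / 4) powr \<epsilon> \<le> 2"
  proof -
    have "\<epsilon> \<le> ln 2 / ln (A / 4)" unfolding \<epsilon>_def by simp
    then have "\<epsilon> * ln (A / 4) \<le> ln 2" using lnA by (simp add: pos_le_divide_eq)
    then have "exp (\<epsilon> * ln (A / 4)) \<le> exp (ln 2)" by (simp only: exp_le_cancel_iff)
    then show ?thesis using A by (simp add: powr_def)
  qed
  have base: "mass f x \<rho> \<le> B * \<rho> powr (2 - \<epsilon>)" if \<rho>: "0 < \<rho>" "\<rho> \<le> A" for x \<rho>
  proof -
    have "\<rho> powr \<epsilon> \<le> A powr \<epsilon>" using \<rho> \<epsilon> by (intro powr_mono2) simp_all
    also have "\<dots> \<le> A powr 1" using A \<epsilon> by (intro powr_mono) simp_all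
    finally have e: "\<rho> powr \<epsilon> \<le> A" using A by simp
    have "mass f x \<rho> \<le> M * (pi * \<rho>\<^sup>2)" using \<rho> by (intro mass_le f_locally_integrable density_le_bound) simp
    also have "\<rho>\<^sup>2 = \<rho> powr \<epsilon> * \<rho> powr (2 - \<epsilon>)" using \<rho> by (simp flip: powr_add)
    also have "M * (pi * (\<rho> powr \<epsilon> * \<rho> powr (2 - \<epsilon>))) = (pi * M * \<rho> powr \<epsilon>) * \<rho> powr (2 - \<epsilon>)" by simp
    also have "\<dots> \<le> (pi * M * A) * \<rho> powr (2 - \<epsilon>)"
      using density_bound_nonneg e by (intro mult_right_mono mult_left_mono) simp_all
    also have "\<dots> \<le> B * \<rho> powr (2 - \<epsilon>)" using B by (intro mult_right_mono) simp_all
    finally show ?thesis .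
  qed
  have all_scales: "\<forall>x \<rho>. 0 < \<rho> \<and> \<rho> \<le> A * 2 ^ n \<longrightarrow> mass f x \<rho> \<le> B * \<rho> powr (2 - \<epsilon>)" for n
  proof (induction n)
    case 0
    show ?case using base by simp
  next
    case (Suc n)
    show ?case
    proof (intro allI impI, elim conjE)
      fix x \<rho> assume \<rho>: "0 < \<rho>" "\<rho> \<le> A * 2 ^ Suc n"
      show "mass f x \<rho> \<le> B * \<rho> powr (2 - \<epsilon>)"
      proof (cases "\<rho> \<le> A")
        case True
        then show ?thesis using base \<rho> by simp
      next
        case False
        define r0 where "r0 = 4 * \<rho> / A"
        have r01: "1 \<le> r0" unfolding r0_def using False A by (simp add: le_divide_eq)
        have "4 / A \<le> 1 / 2" using A by (simp add: divide_le_eq)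
        then have "(4 / A) * \<rho> \<le> (1 / 2) * \<rho>" using \<rho> by (intro mult_right_mono) simp_all
        then have r0_half: "r0 \<le> \<rho> / 2" unfolding r0_def by simp
        have r0_le: "r0 \<le> A * 2 ^ n" using r0_half \<rho>(2) by simp
        define D0 where "D0 = B * r0 powr (- \<epsilon>)"
        have D0: "0 < D0" unfolding D0_def using B r01 by simp
        have ratio: "r0 / (4 * \<rho>) = 1 / A" unfolding r0_def using \<rho> by simp
        have "mass f x (4 * \<rho> / 4) \<le> Q * (4 * \<rho>)\<^sup>2 * (B * r0 powr (- \<epsilon>) * (q + (r0 / (4 * \<rho>)) powr (2 * q))
             + M * exp (- (2 * (B * r0 powr (- \<epsilon>) * r0\<^sup>2))))"
        proof (rule step0[THEN spec[of _ B], THEN spec[of _ \<epsilon>], THEN spec[of _ r0], THEN spec[of _ q],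
              THEN spec[of _ "4 * \<rho>"], THEN spec[of _ x], THEN mp], intro conjI)
          show "\<forall>x \<rho>. 0 < \<rho> \<and> \<rho> \<le> r0 \<longrightarrow> mass f x \<rho> \<le> B * \<rho> powr (2 - \<epsilon>)"
          proof (intro allI impI, elim conjE)
            fix x' \<rho>' assume "0 < \<rho>'" "\<rho>' \<le> r0"
            then show "mass f x' \<rho>' \<le> B * \<rho>' powr (2 - \<epsilon>)" using Suc.IH[rule_format, of \<rho>' x'] r0_le by simp
          qed
          show "0 < B" "0 < r0" "r0 \<le> 4 * \<rho>" using B(1) r01 r0_half \<rho>(1) by linarith+
        qed (rule \<epsilon> q)+
        then have 1: "mass f x \<rho> \<le> Q * (4 * \<rho>)\<^sup>2 * (D0 * (q + (1 / A) powr (2 * q)) + M * exp (- (2 * (D0 * r0\<^sup>2))))"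
          unfolding ratio D0_def by simp
        \<comment> \<open>By \<open>exp (- y) \<le> 1 / y\<close> and \<open>D0 r0 \<ge> B\<close>, as \<open>r0 \<ge> 1\<close>.\<close>
        have tail: "M * exp (- (2 * (D0 * r0\<^sup>2))) \<le> D0 * (1 / (96 * Q))"
        proof -
          have y: "0 < D0 * r0\<^sup>2" using D0 r01 by simp
          have "2 * (D0 * r0\<^sup>2) \<le> exp (2 * (D0 * r0\<^sup>2))" using exp_ge_add_one_self[of "2 * (D0 * r0\<^sup>2)"] by linarith
          then have "inverse (exp (2 * (D0 * r0\<^sup>2))) \<le> inverse (2 * (D0 * r0\<^sup>2))"
            by (rule le_imp_inverse_le) (use y in linarith)
          then have "exp (- (2 * (D0 * r0\<^sup>2))) \<le> 1 / (2 * (D0 * r0\<^sup>2))"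
            unfolding exp_minus inverse_eq_divide .
          then have "M * exp (- (2 * (D0 * r0\<^sup>2))) \<le> M * (1 / (2 * (D0 * r0\<^sup>2)))"
            by (rule mult_left_mono[OF _ density_bound_nonneg])
          also have "\<dots> \<le> D0 * (1 / (96 * Q))"
          proof -
            have "B \<le> D0 * r0"
            proof -
              have "r0 powr 0 \<le> r0 powr (1 - \<epsilon>)" using r01 \<epsilon> by (intro powr_mono) simp_all
              then have "B * 1 \<le> B * r0 powr (1 - \<epsilon>)" using B r01 by (intro mult_left_mono) simp_all
              also have "r0 powr (1 - \<epsilon>) = r0 powr (- \<epsilon>) * r0" using r01 by (simp add: powr_diff powr_minus divide_inverse)
              finally show ?thesis by (simp add: D0_def mult.assoc)
            qed
            then have "B * B \<le> (D0 * r0) * (D0 * r0)" using B by (intro mult_mono) simp_all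
            moreover have "B * 1 \<le> B * B" using B by (intro mult_left_mono) simp_all
            ultimately have "48 * Q * M \<le> (D0 * r0) * (D0 * r0)" using B(2) by linarith
            then have "M * (96 * Q) \<le> D0 * (2 * (D0 * r0\<^sup>2))" by (simp add: power2_eq_square mult_ac)
            then show ?thesis using Q y by (simp add: divide_le_eq le_divide_eq mult_ac)
          qed
          finally show ?thesis .
        qed
        have "D0 * (q + (1 / A) powr (2 * q)) \<le> D0 * (1 / (96 * Q) + 1 / (96 * Q))"
          using D0 q Aq by (intro mult_left_mono add_mono) simp_all
        then have "D0 * (q + (1 / A) powr (2 * q)) + M * exp (- (2 * (D0 * r0\<^sup>2))) \<le> 3 * (D0 * (1 / (96 * Q)))"
          using tail by (simp add: distrib_left)
        then have "Q * (4 * \<rho>)\<^sup>2 * (D0 * (q + (1 / A) powr (2 * q)) + M * exp (- (2 * (D0 * r0\<^sup>2))))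
            \<le> Q * (4 * \<rho>)\<^sup>2 * (3 * (D0 * (1 / (96 * Q))))"
          using Q by (intro mult_left_mono) simp_all
        also have "\<dots> = \<rho>\<^sup>2 * (B * r0 powr (- \<epsilon>)) / 2" unfolding D0_def using Q by (simp add: power2_eq_square)
        also have "r0 powr (- \<epsilon>) = \<rho> powr (- \<epsilon>) * (A / 4) powr \<epsilon>"
        proof -
          have "r0 = \<rho> / (A / 4)" by (simp add: r0_def)
          then have "r0 powr (- \<epsilon>) = \<rho> powr (- \<epsilon>) / (A / 4) powr (- \<epsilon>)" using \<rho>(1) A by (simp only: powr_divide)
          then show ?thesis by (simp only: powr_minus divide_inverse inverse_inverse_eq)
        qed
        also have "\<rho>\<^sup>2 * (B * (\<rho> powr (- \<epsilon>) * (A / 4) powr \<epsilon>)) / 2 = B * (\<rho>\<^sup>2 * \<rho> powr (- \<epsilon>)) * ((A / 4) powr \<epsilon> / 2)"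
          by (simp only: times_divide_eq_right mult_ac)
        also have "\<rho>\<^sup>2 * \<rho> powr (- \<epsilon>) = \<rho> powr (2 - \<epsilon>)"
        proof -
          have "\<rho> powr (2 + - \<epsilon>) = \<rho>\<^sup>2 * \<rho> powr (- \<epsilon>)" using \<rho>(1) by (simp only: powr_add) (simp add: powr_numeral)
          then show ?thesis by simp
        qed
        also have "B * \<rho> powr (2 - \<epsilon>) * ((A / 4) powr \<epsilon> / 2) \<le> B * \<rho> powr (2 - \<epsilon>) * 1"
          using B A\<epsilon> by (intro mult_left_mono) simp_all
        finally show ?thesis using 1 by simp
      qed
    qed
  qed
  have "mass f x \<rho> \<le> B * \<rho> powr (2 - \<epsilon>)" if "0 < \<rho>" for x \<rho>
  proof -
    obtain n where "\<rho> < 2 ^ n" using real_arch_pow[of 2 \<rho>] by auto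
    also have "(2::real) ^ n \<le> A * 2 ^ n" using A by simp
    finally show ?thesis using all_scales[of n] that by simp
  qed
  then show ?thesis using \<epsilon> B by (intro exI[of _ \<epsilon>] exI[of _ B]) simp
qed

end

section \<open>Estimates on all dyadic balls\<close>

lemma dyadic_shift: "(2::real) ^ k / 2 ^ (n + k) = 1 / 2 ^ n"
  by (simp add: power_add)

lemma dyadic_shift_powr_le: "0 \<le> a \<Longrightarrow> a \<le> 2 \<Longrightarrow> (2 ^ (k + m)) powr a \<le> 4 ^ m * (2 ^ k :: real) powr a"
proof -
  assume a: "0 \<le> a" "a \<le> 2"
  have "((2::real) ^ m) powr a \<le> (2 ^ m) powr 2" using a by (intro powr_mono) simp_all
  also have "\<dots> = 4 ^ m" by (simp add: powr_numeral flip: power_mult_distrib power_mult) (simp add: power_mult power2_eq_square flip: power_mult_distrib)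
  finally show ?thesis by (simp add: power_add powr_mult mult.commute)
qed

lemma ex_dyadic_ge: "\<exists>k. R \<le> (2::real) ^ k"
  using real_arch_pow[of 2 R] by (auto intro: less_imp_le)

text \<open>The conclusion of \<open>mass_decay\<close> as an assumption. All scales are powers of 2, so that every estimate refers
  to the same sequence of smooth functions \<open>mean (1 / 2^n) w\<close>, and the estimates hold for the limits.\<close>
locale poisson_growth =
  fixes w f :: "real^2 \<Rightarrow> real" and M B \<epsilon> :: real
  assumes p: "poisson w f" and w0: "\<And>y. 0 \<le> w y" and f0: "\<And>y. 0 \<le> f y" and fM: "\<And>y. f y \<le> M"
    and \<epsilon>: "0 < \<epsilon>" "\<epsilon> \<le> 1/2" and B: "0 < B"
    and growth: "\<And>x \<rho>. 0 < \<rho> \<Longrightarrow> mass f x \<rho> \<le> B * \<rho> powr (2 - \<epsilon>)"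
begin

lemma locally_integrable_pair: "locally_integrable w" "locally_integrable f" using p by (simp_all add: poisson_def)

lemma growth_abs: "0 < \<rho> \<Longrightarrow> mass (\<lambda>y. \<bar>f y\<bar>) x \<rho> \<le> B * \<rho> powr (2 - \<epsilon>)"
  using growth f0 by simp

lemma mean_near_limit:
  "\<bar>mean (1 / 2 ^ n) w x - mean (2 ^ k) w x\<bar> \<le> 2 * kernel_bound * B * (2 ^ k) powr (2 - \<epsilon>)"
proof -
  have "\<bar>mean (2 ^ k / 2 ^ (n + k)) w x - mean (2 ^ k) w x\<bar> \<le> 2 * kernel_bound * B * (2 ^ k) powr (2 - \<epsilon>)"
    by (rule mean_telescope(1)[OF p _ growth_abs]) (use \<epsilon> in simp_all)
  then show ?thesis unfolding dyadic_shift .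
qed

text \<open>The continuous representative of \<open>w\<close>.\<close>
definition precise :: "real^2 \<Rightarrow> real" where "precise x = lim (\<lambda>n. mean (1 / 2 ^ n) w x)"

lemma tendsto_precise: "(\<lambda>n. mean (1 / 2 ^ n) w x) \<longlonglongrightarrow> precise x"
proof -
  have "convergent (\<lambda>n. mean (1 / 2 ^ n) w x)"
    by (rule mean_telescope(2)[OF p _ growth_abs]) (use \<epsilon> in simp_all)
  then show ?thesis unfolding precise_def by (simp add: convergent_LIMSEQ_iff)
qed

lemma AE_precise: "AE x in lebesgue. w x = precise x"
proof -
  have "AE x in lebesgue. (\<lambda>n. mean (1 / 2 ^ n) w x) \<longlonglongrightarrow> w x"
    by (rule AE_mean_tendsto[OF p, where M = M]) (use f0 fM in \<open>simp_all add: abs_of_nonneg\<close>)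
  then show ?thesis by (rule eventually_mono) (rule LIMSEQ_unique[OF _ tendsto_precise])
qed

lemma precise_nonneg: "0 \<le> precise x"
  by (rule LIMSEQ_le_const[OF tendsto_precise]) (use mean_nonneg[OF locally_integrable_pair(1) _ w0] in auto)

lemma mean_minus_precise: "\<bar>precise x - mean (2 ^ k) w x\<bar> \<le> 2 * kernel_bound * B * (2 ^ k) powr (2 - \<epsilon>)"
proof (rule LIMSEQ_upper_bound)
  show "(\<lambda>n. \<bar>mean (1 / 2 ^ n) w x - mean (2 ^ k) w x\<bar>) \<longlonglongrightarrow> \<bar>precise x - mean (2 ^ k) w x\<bar>"
    by (intro tendsto_intros tendsto_precise)
qed (rule mean_near_limit)

text \<open>The means around \<open>x\<close> at scale \<open>2^k \<ge> \<bar>x\<bar>\<close> are compared with those around the origin, and these with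
  the value at the origin by telescoping.\<close>
lemma mean_growth: "\<exists>C>0. \<forall>k x. norm x \<le> 2 ^ k \<longrightarrow> mean (2 ^ k) w x \<le> C * (2 ^ k) powr (2 - \<epsilon>)"
proof -
  define Q1 where "Q1 = 16 * kernel_bound / kernel_floor"
  have Q1: "0 < Q1" unfolding Q1_def using kernel_bound_ge_1 kernel_floor_pos by simp
  define C where "C = Q1 * (precise 0 + 2 * kernel_bound * B * 16)"
  have C: "0 < C" unfolding C_def using Q1 precise_nonneg[of 0] B kernel_bound_ge_1
    by (intro mult_pos_pos add_nonneg_pos) simp_all
  have "mean (2 ^ k) w x \<le> C * (2 ^ k) powr (2 - \<epsilon>)" if x: "norm x \<le> 2 ^ k" for k x
  proof -
    let ?P = "(2 ^ k :: real) powr (2 - \<epsilon>)"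
    have P: "1 \<le> ?P" using \<epsilon> by (intro ge_one_powr_ge_zero) simp_all
    have "mean (2 ^ k) w x \<le> Q1 * mean (4 * 2 ^ k) w 0"
      unfolding Q1_def by (rule mean_Harnack[OF locally_integrable_pair(1) _ w0]) (use x in simp_all)
    also have "\<dots> \<le> Q1 * (precise 0 + 2 * kernel_bound * B * (16 * ?P))"
    proof (rule mult_left_mono)
      have "mean (4 * 2 ^ k) w 0 = mean (2 ^ (k + 2)) w 0" by simp
      also have "\<dots> \<le> precise 0 + 2 * kernel_bound * B * (2 ^ (k + 2)) powr (2 - \<epsilon>)"
        using mean_minus_precise[of 0 "k + 2"] by linarith
      also have "\<dots> \<le> precise 0 + 2 * kernel_bound * B * (4 ^ 2 * ?P)"
        using dyadic_shift_powr_le[of "2 - \<epsilon>" k 2] \<epsilon> B kernel_bound_ge_1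
        by (intro add_left_mono mult_left_mono) (simp_all del: power_add)
      finally show "mean (4 * 2 ^ k) w 0 \<le> precise 0 + 2 * kernel_bound * B * (16 * ?P)" by simp
    qed (use Q1 in simp)
    also have "\<dots> \<le> Q1 * (precise 0 * ?P + 2 * kernel_bound * B * (16 * ?P))"
      using Q1 P precise_nonneg[of 0] by (intro mult_left_mono add_right_mono) (simp_all add: mult_le_cancel_left1)
    also have "\<dots> = C * ?P" unfolding C_def by (simp add: algebra_simps)
    finally show ?thesis .
  qed
  then show ?thesis using C by blast
qed

lemma dyadic_mean_growth: "\<exists>C>0. \<forall>k x n. norm x \<le> 2 ^ k \<longrightarrow> mean (1 / 2 ^ n) w x \<le> C * (2 ^ k) powr (2 - \<epsilon>)"
proof -
  obtain C where C: "0 < C" "\<And>k x. norm x \<le> 2 ^ k \<Longrightarrow> mean (2 ^ k) w x \<le> C * (2 ^ k) powr (2 - \<epsilon>)"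
    using mean_growth by blast
  have "mean (1 / 2 ^ n) w x \<le> (C + 2 * kernel_bound * B) * (2 ^ k) powr (2 - \<epsilon>)" if "norm x \<le> 2 ^ k" for k x n
    using C(2)[OF that] mean_near_limit[of n x k] by (simp add: distrib_right)
  moreover have "0 < C + 2 * kernel_bound * B" using C(1) B kernel_bound_ge_1 by (simp add: add_pos_pos)
  ultimately show ?thesis by blast
qed

text \<open>At scale \<open>2^k\<close> the gradient of the mean is bounded by a mean divided by the scale; the finer scales
  are summed by telescoping.\<close>
lemma gradient_growth:
  "\<exists>C>0. \<forall>k x n i. norm x \<le> 2 ^ k \<longrightarrow> \<bar>partial_deriv i (mean (1 / 2 ^ n) w) x\<bar> \<le> C * (2 ^ k) powr (1 - \<epsilon>)"
proof -
  let ?K = kernel_bound and ?c = kernel_floor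
  have K: "1 \<le> ?K" and c: "0 < ?c" by (rule kernel_bound_ge_1, rule kernel_floor_pos)
  obtain C where C: "0 < C" "\<And>k x. norm x \<le> 2 ^ k \<Longrightarrow> mean (2 ^ k) w x \<le> C * (2 ^ k) powr (2 - \<epsilon>)"
    using mean_growth by blast
  define C' where "C' = 16 * ?K / ?c * C + 8 * ?K * B"
  have C': "0 < C'" unfolding C'_def using K c C B by (simp add: add_pos_pos)
  have "\<bar>partial_deriv i (mean (1 / 2 ^ n) w) x\<bar> \<le> C' * (2 ^ k) powr (1 - \<epsilon>)" if x: "norm x \<le> 2 ^ k" for k x n i
  proof -
    have "\<bar>partial_deriv i (mean (2 ^ k / 2 ^ (n + k)) w) x - partial_deriv i (mean (2 ^ k) w) x\<bar>
        \<le> 8 * ?K * B * (2 ^ k) powr (2 - \<epsilon> - 1)"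
      by (rule partial_deriv_mean_telescope(1)[OF p _ growth_abs]) (use \<epsilon> in simp_all)
    then have 1: "\<bar>partial_deriv i (mean (1 / 2 ^ n) w) x - partial_deriv i (mean (2 ^ k) w) x\<bar> \<le> 8 * ?K * B * (2 ^ k) powr (1 - \<epsilon>)"
      unfolding dyadic_shift by simp
    have "\<bar>partial_deriv i (mean (2 ^ k) w) x\<bar> \<le> 4 * ?K / ?c / 2 ^ k * mean (2 * 2 ^ k) w x"
      by (rule partial_deriv_mean_le[OF locally_integrable_pair(1) _ w0]) simp
    also have "\<dots> \<le> 4 * ?K / ?c / 2 ^ k * (C * (4 * (2 ^ k) powr (2 - \<epsilon>)))"
    proof (rule mult_left_mono)
      have "mean (2 * 2 ^ k) w x = mean (2 ^ (k + 1)) w x" by simp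
      also have "\<dots> \<le> C * (2 ^ (k + 1)) powr (2 - \<epsilon>)" by (rule C(2), rule order_trans[OF x]) simp
      also have "\<dots> \<le> C * (4 ^ 1 * (2 ^ k) powr (2 - \<epsilon>))"
        using dyadic_shift_powr_le[of "2 - \<epsilon>" k 1] \<epsilon> C(1) by (intro mult_left_mono) simp_all
      finally show "mean (2 * 2 ^ k) w x \<le> C * (4 * (2 ^ k) powr (2 - \<epsilon>))" by simp
    qed (use K c in simp)
    also have "\<dots> = 16 * ?K / ?c * C * ((2 ^ k) powr (2 - \<epsilon>) / 2 ^ k)" by simp
    also have "(2 ^ k :: real) powr (2 - \<epsilon>) / 2 ^ k = (2 ^ k) powr (1 - \<epsilon>)"
    proof -
      have "(2 ^ k :: real) powr (1 - \<epsilon>) = (2 ^ k) powr (2 - \<epsilon> - 1)" by simp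
      also have "\<dots> = (2 ^ k) powr (2 - \<epsilon>) / 2 ^ k" by (subst powr_diff) simp
      finally show ?thesis by simp
    qed
    finally show ?thesis using 1 unfolding C'_def by (simp add: distrib_right)
  qed
  then show ?thesis using C' by blast
qed

lemma convergent_gradient: "convergent (\<lambda>n. partial_deriv i (mean (1 / 2 ^ n) w) x)"
  by (rule partial_deriv_mean_telescope(2)[OF p _ growth_abs]) (use \<epsilon> in simp_all)

definition precise_grad :: "2 \<Rightarrow> real^2 \<Rightarrow> real" where "precise_grad i x = lim (\<lambda>n. partial_deriv i (mean (1 / 2 ^ n) w) x)"

lemma tendsto_precise_grad: "(\<lambda>n. partial_deriv i (mean (1 / 2 ^ n) w) x) \<longlonglongrightarrow> precise_grad i x"
  unfolding precise_grad_def using convergent_gradient by (simp add: convergent_LIMSEQ_iff)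

lemma smooth_dyadic_mean: "smooth (mean (1 / 2 ^ n) w)"
  by (rule smooth_mean[OF locally_integrable_pair(1)]) simp

lemma precise_grad_measurable: "precise_grad i \<in> borel_measurable borel"
  by (rule borel_measurable_LIMSEQ_real[OF tendsto_precise_grad]) (intro smooth_borel smooth_partial_deriv smooth_dyadic_mean)

lemma precise_grad_growth: "\<exists>C>0. \<forall>k x i. norm x \<le> 2 ^ k \<longrightarrow> \<bar>precise_grad i x\<bar> \<le> C * (2 ^ k) powr (1 - \<epsilon>)"
proof -
  obtain C where C: "0 < C" "\<And>k x n i. norm x \<le> 2 ^ k \<Longrightarrow> \<bar>partial_deriv i (mean (1 / 2 ^ n) w) x\<bar> \<le> C * (2 ^ k) powr (1 - \<epsilon>)"
    using gradient_growth by blast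
  have "\<bar>precise_grad i x\<bar> \<le> C * (2 ^ k) powr (1 - \<epsilon>)" if "norm x \<le> 2 ^ k" for k x i
    by (rule LIMSEQ_upper_bound[OF tendsto_rabs[OF tendsto_precise_grad]]) (rule C(2)[OF that])
  then show ?thesis using C(1) by blast
qed

lemma locally_bounded_gradients: "\<exists>C. \<forall>n x. norm x \<le> R \<longrightarrow> \<bar>partial_deriv i (mean (1 / 2 ^ n) w) x\<bar> \<le> C"
proof -
  obtain C where C: "\<And>k x n i. norm x \<le> 2 ^ k \<Longrightarrow> \<bar>partial_deriv i (mean (1 / 2 ^ n) w) x\<bar> \<le> C * (2 ^ k) powr (1 - \<epsilon>)"
    using gradient_growth by blast
  obtain k where "R \<le> 2 ^ k" using ex_dyadic_ge by blast
  then have "\<forall>n x. norm x \<le> R \<longrightarrow> \<bar>partial_deriv i (mean (1 / 2 ^ n) w) x\<bar> \<le> C * (2 ^ k) powr (1 - \<epsilon>)"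
    using C by (meson order_trans)
  then show ?thesis by blast
qed

lemma precise_grad_locally_integrable: "locally_integrable (precise_grad i)"
proof (rule locally_bounded_integrable)
  show "precise_grad i \<in> borel_measurable lebesgue" by (rule borel_lebesgue[OF precise_grad_measurable])
  fix R
  obtain C where C: "\<And>n x. norm x \<le> R \<Longrightarrow> \<bar>partial_deriv i (mean (1 / 2 ^ n) w) x\<bar> \<le> C"
    using locally_bounded_gradients by blast
  have "\<bar>precise_grad i x\<bar> \<le> C" if "norm x \<le> R" for x
    by (rule LIMSEQ_upper_bound[OF tendsto_rabs[OF tendsto_precise_grad]]) (rule C[OF that])
  then show "\<exists>C. \<forall>x. norm x \<le> R \<longrightarrow> \<bar>precise_grad i x\<bar> \<le> C" by blast
qed

lemma weak_partial_precise_grad: "weak_partial i w (precise_grad i)"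
proof (rule weak_partial_limit[OF weak_partial_smooth[OF smooth_dyadic_mean] locally_integrable_pair(1) precise_grad_locally_integrable])
  show "AE x in lebesgue. (\<lambda>n. mean (1 / 2 ^ n) w x) \<longlonglongrightarrow> w x"
    using AE_precise by (rule eventually_mono) (use tendsto_precise in simp)
  show "AE x in lebesgue. (\<lambda>n. partial_deriv i (mean (1 / 2 ^ n) w) x) \<longlonglongrightarrow> precise_grad i x"
    by (rule AE_I2) (rule tendsto_precise_grad)
  show "\<exists>C. \<forall>n x. norm x \<le> R \<longrightarrow> \<bar>partial_deriv i (mean (1 / 2 ^ n) w) x\<bar> \<le> C" for R
    by (rule locally_bounded_gradients)
  show "\<exists>C. \<forall>n x. norm x \<le> R \<longrightarrow> \<bar>mean (1 / 2 ^ n) w x\<bar> \<le> C" for R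
  proof -
    obtain C where C: "\<And>k x n. norm x \<le> 2 ^ k \<Longrightarrow> mean (1 / 2 ^ n) w x \<le> C * (2 ^ k) powr (2 - \<epsilon>)"
      using dyadic_mean_growth by blast
    obtain k where k: "R \<le> 2 ^ k" using ex_dyadic_ge by blast
    have "\<bar>mean (1 / 2 ^ n) w x\<bar> \<le> C * (2 ^ k) powr (2 - \<epsilon>)" if "norm x \<le> R" for n x
    proof -
      have "0 \<le> mean (1 / 2 ^ n) w x" by (rule mean_nonneg[OF locally_integrable_pair(1) _ w0]) simp
      then show ?thesis using C[of x k n] that k by simp
    qed
    then show ?thesis by blast
  qed
qed

text \<open>The weaker growth of order \<open>2^k\<close> instead of \<open>2^k\<close> to the power \<open>1 - \<epsilon>\<close> suffices for the second derivatives.\<close>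
lemma precise_lipschitz:
  "\<exists>C>0. \<forall>k x y. norm x \<le> 2 ^ k \<longrightarrow> norm y \<le> 2 ^ k \<longrightarrow> \<bar>precise x - precise y\<bar> \<le> C * 2 ^ k * norm (x - y)"
proof -
  obtain C where C: "0 < C" "\<And>k x n i. norm x \<le> 2 ^ k \<Longrightarrow> \<bar>partial_deriv i (mean (1 / 2 ^ n) w) x\<bar> \<le> C * (2 ^ k) powr (1 - \<epsilon>)"
    using gradient_growth by blast
  have "\<bar>precise x - precise y\<bar> \<le> (2 * C) * 2 ^ k * norm (x - y)" if xy: "norm x \<le> 2 ^ k" "norm y \<le> 2 ^ k" for k x y
  proof (rule LIMSEQ_upper_bound)
    show "(\<lambda>n. \<bar>mean (1 / 2 ^ n) w x - mean (1 / 2 ^ n) w y\<bar>) \<longlonglongrightarrow> \<bar>precise x - precise y\<bar>"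
      by (intro tendsto_intros tendsto_precise)
    fix n
    have "(2 ^ k :: real) powr (1 - \<epsilon>) \<le> (2 ^ k) powr 1" using \<epsilon> by (intro powr_mono) simp_all
    then have le: "C * (2 ^ k) powr (1 - \<epsilon>) \<le> C * 2 ^ k" using C(1) by (intro mult_left_mono) simp_all
    have "\<bar>mean (1 / 2 ^ n) w x - mean (1 / 2 ^ n) w y\<bar> \<le> CARD(2) * (C * 2 ^ k) * norm (x - y)"
    proof (rule lipschitz_of_partials[of "cball 0 (2 ^ k)"])
      show "mean (1 / 2 ^ n) w differentiable (at z)" for z by (rule smooth_differentiable[OF smooth_dyadic_mean])
      show "\<bar>partial_deriv i (mean (1 / 2 ^ n) w) z\<bar> \<le> C * 2 ^ k" if "z \<in> cball 0 (2 ^ k)" for i z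
        using C(2)[of z k i n] le that by simp
    qed (use xy in simp_all)
    then show "\<bar>mean (1 / 2 ^ n) w x - mean (1 / 2 ^ n) w y\<bar> \<le> (2 * C) * 2 ^ k * norm (x - y)" by (simp add: mult_ac)
  qed
  then show ?thesis using C(1) by (intro exI[of _ "2 * C"]) simp
qed

end

section \<open>Second derivatives\<close>

text \<open>The reason why a constant may be subtracted from the density in the formula for the second
  derivatives.\<close>
lemma integral_second_green_eq_0:
  assumes s: "0 < s"
  shows "(LINT y|lebesgue. dilate s (partial_deriv l (partial_deriv i green)) (x - y)) = 0"
proof -
  have g: "test_function (partial_deriv i green)" by (intro test_function_partial_deriv test_function_green)
  have t: "test_function (dilate s (partial_deriv i green))" using s by (intro test_function_dilate g) simp
  have t2: "test_function (dilate s (partial_deriv l (partial_deriv i green)))"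
    using s by (intro test_function_dilate test_function_partial_deriv g) simp
  have "(LINT y|lebesgue. dilate s (partial_deriv l (partial_deriv i green)) y / s) = 0"
    using integral_partial_deriv[OF t, of l]
    unfolding partial_deriv_dilate[OF test_function_smooth[OF g]] .
  then have "(LINT y|lebesgue. dilate s (partial_deriv l (partial_deriv i green)) y) = 0" using s by simp
  then show ?thesis using integral_reflect[OF t2, of x] by simp
qed

text \<open>The continuity assumption is that of a product of a Hoelder continuous function and of a function
  with Lipschitz constant of order \<open>2^k\<close> on the ball of radius \<open>2^k\<close>.\<close>
locale poisson_holder = poisson_growth +
  fixes \<alpha> H :: real
  assumes \<alpha>: "0 < \<alpha>" "\<alpha> < 1" and H: "0 \<le> H"
    and holder: "\<And>k x y. norm x \<le> 2 ^ k \<Longrightarrow> norm y \<le> 2 ^ k \<Longrightarrow>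
      \<bar>f y - f x\<bar> \<le> H * (norm (x - y) powr \<alpha> + 2 ^ k * norm (x - y))"
begin

text \<open>The second derivatives of the kernel have integral zero, hence only the oscillation of \<open>f\<close> counts.\<close>
lemma hessian_step:
  assumes m: "\<And>y. y \<in> ball x (2 ^ k / 2 ^ j) \<Longrightarrow> \<bar>f y - f x\<bar> \<le> m"
  shows "\<bar>partial_deriv l (partial_deriv i (mean (2 ^ k / 2 ^ Suc j) w)) x - partial_deriv l (partial_deriv i (mean (2 ^ k / 2 ^ j) w)) x\<bar>
    \<le> 4 * pi * kernel_bound * m"
proof -
  let ?s = "(2::real) ^ k / 2 ^ Suc j"
  let ?\<kappa> = "partial_deriv l (partial_deriv i green)"
  have s: "0 < ?s" by simp
  have k0: "(0::real) < 2 ^ k" by simp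
  have t: "test_function (dilate ?s ?\<kappa>)"
    by (intro test_function_dilate test_function_partial_deriv test_function_green) simp
  have d_li: "locally_integrable (\<lambda>y. f y + - f x)"
    by (intro locally_integrable_add locally_integrable_pair(2) locally_integrable_const)
  have "conv f (dilate ?s ?\<kappa>) x = (LINT y|lebesgue. (f y + - f x) * dilate ?s ?\<kappa> (x - y) + f x * dilate ?s ?\<kappa> (x - y))"
    unfolding conv_def by (intro Bochner_Integration.integral_cong) (simp_all add: algebra_simps)
  also have "\<dots> = (LINT y|lebesgue. (f y + - f x) * dilate ?s ?\<kappa> (x - y)) + (LINT y|lebesgue. f x * dilate ?s ?\<kappa> (x - y))"
    by (intro Bochner_Integration.integral_add integrable_conv d_li locally_integrable_const t)
  also have "(LINT y|lebesgue. f x * dilate ?s ?\<kappa> (x - y)) = 0"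
    using integral_second_green_eq_0[OF s] by simp
  finally have eq: "conv f (dilate ?s ?\<kappa>) x = conv (\<lambda>y. f y + - f x) (dilate ?s ?\<kappa>) x"
    by (simp add: conv_def)
  have "\<bar>conv f (dilate ?s ?\<kappa>) x\<bar> \<le> kernel_bound * mass (\<lambda>y. \<bar>f y + - f x\<bar>) x (2 * ?s)"
    unfolding eq by (rule conv_dilate_bound[OF d_li green_bound(3) green_derivs_eq_0(2) s])
  also have "\<dots> \<le> kernel_bound * (m * (pi * (2 * ?s)\<^sup>2))"
    using kernel_bound_ge_1 m by (intro mult_left_mono mass_le locally_integrable_abs d_li) simp_all
  also have "\<dots> = 4 * pi * kernel_bound * m * ?s\<^sup>2" by (simp only: power_mult_distrib) (simp add: mult_ac)
  finally have "\<bar>conv f (dilate ?s ?\<kappa>) x\<bar> / ?s\<^sup>2 \<le> 4 * pi * kernel_bound * m"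
    using s by (subst pos_divide_le_eq) simp_all
  then show ?thesis
    unfolding partial_deriv2_mean_step[OF p k0] by (simp only: abs_divide abs_power2)
qed

lemma oscillation_le_M: "\<bar>f y - f x\<bar> \<le> M"
  using f0[of x] f0[of y] fM[of x] fM[of y] by linarith

text \<open>Below the scale \<open>2^k / 2^(2k) = 1 / 2^k\<close> the factor \<open>2^k\<close> of the Lipschitz part is compensated, and the
  oscillation decreases geometrically like the scale to the power \<open>\<alpha>\<close>.\<close>
lemma hessian_tail:
  fixes x :: "real^2" and l i :: 2 and k n :: nat
  assumes x: "norm x \<le> 2 ^ k"
  defines "h \<equiv> \<lambda>j. partial_deriv l (partial_deriv i (mean (2 ^ k / 2 ^ j) w)) x"
  shows "\<bar>h (n + 2 * k) - h (2 * k)\<bar> \<le> 12 * pi * kernel_bound * H / (1 - 2 powr (- \<alpha>))"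
    and "convergent (\<lambda>n. h (n + 2 * k))"
proof -
  define q where "q = (2::real) powr (- \<alpha>)"
  have q0: "0 \<le> q" unfolding q_def by simp
  have q1: "q < 1" unfolding q_def using \<alpha> powr_less_mono[of "- \<alpha>" 0 2] by simp
  have qn: "(1 / 2 ^ n :: real) powr \<alpha> = q ^ n" for n
  proof -
    have "(1 / 2 ^ n :: real) powr \<alpha> = 1 / (2 ^ n) powr \<alpha>" by (simp add: powr_divide)
    also have "((2::real) ^ n) powr \<alpha> = (2 powr \<alpha>) ^ n" by (simp add: powr_powr mult.commute flip: powr_realpow)
    finally show ?thesis unfolding q_def by (simp add: powr_minus power_inverse divide_inverse)
  qed
  have half: "1 / 2 ^ n \<le> q ^ n" for n
  proof -
    have "(1 / 2 ^ n :: real) powr 1 \<le> (1 / 2 ^ n) powr \<alpha>" using \<alpha> by (intro powr_mono') simp_all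
    then show ?thesis unfolding qn by simp
  qed
  have step: "\<bar>h (Suc n + 2 * k) - h (n + 2 * k)\<bar> \<le> (12 * pi * kernel_bound * H) * q ^ n" for n
  proof -
    have "\<bar>h (Suc (n + 2 * k)) - h (n + 2 * k)\<bar> \<le> 4 * pi * kernel_bound * (H * (3 * q ^ n))"
      unfolding h_def
    proof (rule hessian_step)
      fix y assume y: "y \<in> ball x (2 ^ k / 2 ^ (n + 2 * k))"
      have e: "(2::real) ^ k / 2 ^ (n + 2 * k) = 1 / 2 ^ n / 2 ^ k" by (simp add: power_add mult_2)
      have d: "norm (x - y) \<le> 1 / 2 ^ n / 2 ^ k" using y unfolding e by (simp add: dist_norm)
      have d1: "norm (x - y) \<le> 1 / 2 ^ n"
        using order_trans[OF d, of "1 / 2 ^ n"] by (simp add: divide_le_eq)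
      have "norm y \<le> norm x + norm (x - y)" by (metis norm_minus_commute norm_triangle_sub)
      also have "\<dots> \<le> 2 ^ k + 1" using x d1 order_trans[of "1 / 2 ^ n" 1] by (intro add_mono order_trans[OF d1]) simp_all
      also have "\<dots> \<le> 2 ^ Suc k" by simp
      finally have yk: "norm y \<le> 2 ^ Suc k" .
      have xk: "norm x \<le> 2 ^ Suc k" using x by (rule order_trans) simp
      have "\<bar>f y - f x\<bar> \<le> H * (norm (x - y) powr \<alpha> + 2 ^ Suc k * norm (x - y))" by (rule holder[OF xk yk])
      also have "\<dots> \<le> H * (q ^ n + 2 * q ^ n)"
      proof (rule mult_left_mono[OF add_mono H])
        show "norm (x - y) powr \<alpha> \<le> q ^ n"
          unfolding qn[symmetric] using \<alpha> d1 by (intro powr_mono2) simp_all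
        have "2 ^ Suc k * norm (x - y) \<le> 2 ^ Suc k * (1 / 2 ^ n / 2 ^ k)" by (intro mult_left_mono d) simp
        also have "\<dots> = 2 * (1 / 2 ^ n)" by simp
        also have "\<dots> \<le> 2 * q ^ n" by (intro mult_left_mono half) simp
        finally show "2 ^ Suc k * norm (x - y) \<le> 2 * q ^ n" .
      qed
      finally show "\<bar>f y - f x\<bar> \<le> H * (3 * q ^ n)" by simp
    qed
    then show ?thesis by (simp add: mult_ac)
  qed
  show "\<bar>h (n + 2 * k) - h (2 * k)\<bar> \<le> 12 * pi * kernel_bound * H / (1 - 2 powr (- \<alpha>))"
    using geometric_telescope(1)[of "\<lambda>n. h (n + 2 * k)", OF step q0 q1, of n] unfolding q_def by simp
  show "convergent (\<lambda>n. h (n + 2 * k))"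
    using geometric_telescope(2)[of "\<lambda>n. h (n + 2 * k)", OF step q0 q1] .
qed

lemma hessian_head:
  "\<bar>partial_deriv l (partial_deriv i (mean (2 ^ k / 2 ^ j) w)) x - partial_deriv l (partial_deriv i (mean (2 ^ k / 2 ^ 0) w)) x\<bar>
    \<le> real j * (4 * pi * kernel_bound * M)"
proof (induction j)
  case (Suc j)
  have "\<bar>partial_deriv l (partial_deriv i (mean (2 ^ k / 2 ^ Suc j) w)) x - partial_deriv l (partial_deriv i (mean (2 ^ k / 2 ^ j) w)) x\<bar>
    \<le> 4 * pi * kernel_bound * M" by (rule hessian_step) (rule oscillation_le_M)
  then show ?case using Suc.IH by (simp only: of_nat_Suc distrib_right)
qed simp

text \<open>The \<open>2 k\<close> scales between \<open>2^k\<close> and \<open>1 / 2^k\<close> contribute a bounded amount each; the largest scale is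
  bounded by the growth of the means and the finest scales are summed.\<close>
lemma hessian_growth:
  "\<exists>C>0. \<forall>k x n l i. norm x \<le> 2 ^ k \<longrightarrow> \<bar>partial_deriv l (partial_deriv i (mean (1 / 2 ^ n) w)) x\<bar> \<le> C * (1 + real k)"
proof -
  let ?K = kernel_bound and ?c = kernel_floor
  have K: "1 \<le> ?K" and c: "0 < ?c" by (rule kernel_bound_ge_1, rule kernel_floor_pos)
  have M: "0 \<le> M" using f0[of 0] fM[of 0] by linarith
  obtain C where C: "0 < C" "\<And>k x. norm x \<le> 2 ^ k \<Longrightarrow> mean (2 ^ k) w x \<le> C * (2 ^ k) powr (2 - \<epsilon>)"
    using mean_growth by blast
  define T where "T = 12 * pi * ?K * H / (1 - 2 powr (- \<alpha>))"
  have T: "0 \<le> T" unfolding T_def using K H \<alpha> powr_less_mono[of "- \<alpha>" 0 2]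
    by (intro divide_nonneg_nonneg mult_nonneg_nonneg) simp_all
  define S where "S = 16 * ?K / ?c * C"
  have S: "0 < S" unfolding S_def using K c C(1) by simp
  define C' where "C' = S + 8 * pi * ?K * M + T"
  have C': "0 < C'" unfolding C'_def using S T K M by (intro add_pos_nonneg mult_nonneg_nonneg) simp_all
  have "\<bar>partial_deriv l (partial_deriv i (mean (1 / 2 ^ n) w)) x\<bar> \<le> C' * (1 + real k)" if x: "norm x \<le> 2 ^ k" for k x n l i
  proof -
    define h where "h j = partial_deriv l (partial_deriv i (mean (2 ^ k / 2 ^ j) w)) x" for j
    have h0: "\<bar>h 0\<bar> \<le> S"
    proof -
      have "\<bar>h 0\<bar> \<le> 4 * ?K / ?c / (2 ^ k)\<^sup>2 * mean (2 * 2 ^ k) w x"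
        unfolding h_def using partial_deriv2_mean_le[OF locally_integrable_pair(1) _ w0, of "2 ^ k" l i x] by simp
      also have "\<dots> \<le> 4 * ?K / ?c / (2 ^ k)\<^sup>2 * (C * (4 * (2 ^ k)\<^sup>2))"
      proof (rule mult_left_mono)
        have "mean (2 * 2 ^ k) w x = mean (2 ^ (k + 1)) w x" by simp
        also have "\<dots> \<le> C * (2 ^ (k + 1)) powr (2 - \<epsilon>)" by (rule C(2), rule order_trans[OF x]) simp
        also have "\<dots> \<le> C * (2 ^ (k + 1)) powr 2"
        proof (intro mult_left_mono powr_mono)
          show "(1::real) \<le> 2 ^ (k + 1)" by (rule one_le_power) simp
        qed (use \<epsilon> C(1) in simp_all)
        also have "\<dots> = C * (4 * (2 ^ k)\<^sup>2)" by (simp add: powr_numeral power_mult_distrib)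
        finally show "mean (2 * 2 ^ k) w x \<le> C * (4 * (2 ^ k)\<^sup>2)" .
      qed (use K c in simp)
      also have "\<dots> = S" unfolding S_def by simp
      finally show ?thesis .
    qed
    have nn: "0 \<le> 4 * pi * ?K * M" using K M by simp
    have "\<bar>h j\<bar> \<le> S + real (2 * k) * (4 * pi * ?K * M) + T" for j
    proof (cases "j \<le> 2 * k")
      case True
      have "\<bar>h j - h 0\<bar> \<le> real j * (4 * pi * ?K * M)" unfolding h_def by (rule hessian_head)
      also have "\<dots> \<le> real (2 * k) * (4 * pi * ?K * M)" using True nn by (intro mult_right_mono) simp_all
      finally show ?thesis using h0 T by linarith
    next
      case False
      then obtain m where m: "j = m + 2 * k" by (metis add.commute le_iff_add nat_le_linear)
      have "\<bar>h (m + 2 * k) - h (2 * k)\<bar> \<le> T" unfolding h_def T_def by (rule hessian_tail(1)[OF x])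
      moreover have "\<bar>h (2 * k) - h 0\<bar> \<le> real (2 * k) * (4 * pi * ?K * M)" unfolding h_def by (rule hessian_head)
      ultimately show ?thesis using h0 unfolding m by linarith
    qed
    from this[of "n + k"] have "\<bar>partial_deriv l (partial_deriv i (mean (1 / 2 ^ n) w)) x\<bar> \<le> S + real (2 * k) * (4 * pi * ?K * M) + T"
      unfolding h_def dyadic_shift .
    also have "\<dots> \<le> C' * (1 + real k)"
    proof -
      have "0 \<le> S * real k" "0 \<le> T * real k" "0 \<le> 8 * pi * ?K * M" using S T K M by simp_all
      then show ?thesis unfolding C'_def by (simp add: algebra_simps)
    qed
    finally show ?thesis .
  qed
  then show ?thesis using C' by blast
qed

lemma convergent_hessian: "convergent (\<lambda>n. partial_deriv l (partial_deriv i (mean (1 / 2 ^ n) w)) x)"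
proof -
  obtain k where k: "norm x \<le> 2 ^ k" using ex_dyadic_ge by blast
  have "convergent (\<lambda>n. partial_deriv l (partial_deriv i (mean (2 ^ k / 2 ^ (n + 2 * k)) w)) x)"
    by (rule hessian_tail(2)[OF k])
  moreover have "(2::real) ^ k / 2 ^ (n + 2 * k) = 1 / 2 ^ (n + k)" for n
    using dyadic_shift[of k "n + k"] by (simp add: add.assoc mult_2)
  ultimately have "convergent (\<lambda>n. partial_deriv l (partial_deriv i (mean (1 / 2 ^ (n + k)) w)) x)" by simp
  then show ?thesis
    using convergent_ignore_initial_segment[of "\<lambda>n. partial_deriv l (partial_deriv i (mean (1 / 2 ^ n) w)) x" k]
    by simp
qed

definition precise_hess :: "2 \<Rightarrow> 2 \<Rightarrow> real^2 \<Rightarrow> real" where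
  "precise_hess l i x = lim (\<lambda>n. partial_deriv l (partial_deriv i (mean (1 / 2 ^ n) w)) x)"

lemma tendsto_precise_hess: "(\<lambda>n. partial_deriv l (partial_deriv i (mean (1 / 2 ^ n) w)) x) \<longlonglongrightarrow> precise_hess l i x"
  unfolding precise_hess_def using convergent_hessian by (simp add: convergent_LIMSEQ_iff)

lemma precise_hess_measurable: "precise_hess l i \<in> borel_measurable borel"
  by (rule borel_measurable_LIMSEQ_real[OF tendsto_precise_hess])
     (intro smooth_borel smooth_partial_deriv smooth_dyadic_mean)

lemma precise_hess_growth: "\<exists>C>0. \<forall>k x l i. norm x \<le> 2 ^ k \<longrightarrow> \<bar>precise_hess l i x\<bar> \<le> C * (1 + real k)"
proof -
  obtain C where C: "0 < C" "\<And>k x n l i. norm x \<le> 2 ^ k \<Longrightarrow> \<bar>partial_deriv l (partial_deriv i (mean (1 / 2 ^ n) w)) x\<bar> \<le> C * (1 + real k)"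
    using hessian_growth by blast
  have "\<bar>precise_hess l i x\<bar> \<le> C * (1 + real k)" if "norm x \<le> 2 ^ k" for k x l i
    by (rule LIMSEQ_upper_bound[OF tendsto_rabs[OF tendsto_precise_hess]]) (rule C(2)[OF that])
  then show ?thesis using C(1) by blast
qed

lemma weak_partial_precise_hess: "weak_partial l (precise_grad i) (precise_hess l i)"
proof -
  obtain C where C: "\<And>k x n l i. norm x \<le> 2 ^ k \<Longrightarrow> \<bar>partial_deriv l (partial_deriv i (mean (1 / 2 ^ n) w)) x\<bar> \<le> C * (1 + real k)"
    using hessian_growth by blast
  have loc: "\<exists>C. \<forall>n x. norm x \<le> R \<longrightarrow> \<bar>partial_deriv l (partial_deriv i (mean (1 / 2 ^ n) w)) x\<bar> \<le> C" for R
  proof -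
    obtain k where k: "R \<le> 2 ^ k" using ex_dyadic_ge by blast
    have "\<bar>partial_deriv l (partial_deriv i (mean (1 / 2 ^ n) w)) x\<bar> \<le> C * (1 + real k)" if "norm x \<le> R" for n x
      by (rule C) (use that k in linarith)
    then show ?thesis by blast
  qed
  have hess_li: "locally_integrable (precise_hess l i)"
  proof (rule locally_bounded_integrable)
    show "precise_hess l i \<in> borel_measurable lebesgue" by (rule borel_lebesgue[OF precise_hess_measurable])
    fix R
    obtain C where C: "\<And>n x. norm x \<le> R \<Longrightarrow> \<bar>partial_deriv l (partial_deriv i (mean (1 / 2 ^ n) w)) x\<bar> \<le> C"
      using loc by blast
    have "\<bar>precise_hess l i x\<bar> \<le> C" if "norm x \<le> R" for x
      by (rule LIMSEQ_upper_bound[OF tendsto_rabs[OF tendsto_precise_hess]]) (rule C[OF that])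
    then show "\<exists>C. \<forall>x. norm x \<le> R \<longrightarrow> \<bar>precise_hess l i x\<bar> \<le> C" by blast
  qed
  show ?thesis
  proof (rule weak_partial_limit[OF weak_partial_smooth[OF smooth_partial_deriv[OF smooth_dyadic_mean]] precise_grad_locally_integrable hess_li])
    show "AE x in lebesgue. (\<lambda>n. partial_deriv i (mean (1 / 2 ^ n) w) x) \<longlonglongrightarrow> precise_grad i x"
      by (rule AE_I2) (rule tendsto_precise_grad)
    show "AE x in lebesgue. (\<lambda>n. partial_deriv l (partial_deriv i (mean (1 / 2 ^ n) w)) x) \<longlonglongrightarrow> precise_hess l i x"
      by (rule AE_I2) (rule tendsto_precise_hess)
  qed (rule locally_bounded_gradients loc)+
qed

end

section \<open>Growth of the solution\<close>

text \<open>The measurability assumption matters: the essential supremum of a nonmeasurable function is the top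
  element.\<close>
lemma Linf_ball_bigoI:
  fixes f :: "'a::euclidean_space \<Rightarrow> 'b::real_normed_vector"
  assumes m: "(\<lambda>x. norm (f x)) \<in> borel_measurable lebesgue"
    and b: "\<And>R. R0 \<le> R \<Longrightarrow> AE x in lebesgue. norm x < R \<longrightarrow> norm (f x) \<le> C * g R"
  shows "Linf_ball_bigo f g"
  unfolding Linf_ball_bigo_def
proof (intro exI[of _ C])
  show "\<forall>\<^sub>F R in at_top. Linf_norm (ball 0 R) f \<le> ereal (C * g R)"
    using eventually_ge_at_top[of R0]
  proof (rule eventually_mono)
    fix R assume R: "R0 \<le> R"
    show "Linf_norm (ball 0 R) f \<le> ereal (C * g R)"
      unfolding Linf_norm_def
    proof (rule esssup_I)
      show "(\<lambda>x. ereal (norm (f x))) \<in> borel_measurable (restrict_space lebesgue (ball 0 R))"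
        by (intro measurable_restrict_space1 borel_measurable_ereal m)
      show "AE x in restrict_space lebesgue (ball 0 R). ereal (norm (f x)) \<le> ereal (C * g R)"
        using b[OF R] by (subst AE_restrict_space_iff) simp_all
    qed
  qed
qed

lemma ex_comparable_dyadic: assumes "1 \<le> R" obtains k where "R \<le> 2 ^ k" "2 ^ k \<le> 2 * (R::real)"
proof -
  define k where "k = (LEAST k. R \<le> 2 ^ k)"
  have "\<exists>k. R \<le> 2 ^ k" using real_arch_pow[of 2 R] by (auto intro: less_imp_le)
  then have k: "R \<le> 2 ^ k" unfolding k_def by (rule LeastI_ex)
  have "2 ^ k \<le> 2 * R"
  proof (cases k)
    case 0
    then show ?thesis using assms by simp
  next
    case (Suc j)
    then have "\<not> R \<le> 2 ^ j" using not_less_Least[of j "\<lambda>k. R \<le> 2 ^ k"] unfolding k_def by simp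
    then show ?thesis using Suc by simp
  qed
  then show thesis using that k by blast
qed

lemma weak_partial_const_minus:
  assumes "weak_partial i f g" shows "weak_partial i (\<lambda>x. c - f x) (\<lambda>x. - g x)"
proof -
  have f: "locally_integrable f" and g: "locally_integrable g"
    and e: "\<And>\<phi>. test_function \<phi> \<Longrightarrow> (LINT x|lebesgue. f x * partial_deriv i \<phi> x) = - (LINT x|lebesgue. g x * \<phi> x)"
    using assms by (simp_all add: weak_partial_def)
  have "locally_integrable (\<lambda>x. c + - f x)" by (intro locally_integrable_add locally_integrable_const locally_integrable_uminus f)
  then have "locally_integrable (\<lambda>x. c - f x)" by simp
  moreover have "(LINT x|lebesgue. (c - f x) * partial_deriv i \<phi> x) = - (LINT x|lebesgue. - g x * \<phi> x)" if \<phi>: "test_function \<phi>" for \<phi>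
  proof -
    note t = test_function_partial_deriv[OF \<phi>, of i]
    have "(LINT x|lebesgue. (c - f x) * partial_deriv i \<phi> x) =
       (LINT x|lebesgue. c * partial_deriv i \<phi> x) - (LINT x|lebesgue. f x * partial_deriv i \<phi> x)"
      unfolding left_diff_distrib
      by (intro Bochner_Integration.integral_diff integrable_mult_test locally_integrable_const f t)
    also have "(LINT x|lebesgue. c * partial_deriv i \<phi> x) = 0" using integral_partial_deriv[OF \<phi>, of i] by simp
    finally show ?thesis by (simp add: e[OF \<phi>])
  qed
  ultimately show ?thesis unfolding weak_partial_def using locally_integrable_uminus[OF g] by blast
qed

text \<open>Needed to replace \<open>f\<close> by its continuous representative.\<close>
lemma poisson_cong_AE:
  assumes p: "poisson w f" and ae: "AE x in lebesgue. f x = g x" and g: "g \<in> borel_measurable lebesgue"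
  shows "poisson w g"
proof -
  have w: "locally_integrable w" and f: "locally_integrable f" using p by (simp_all add: poisson_def)
  have "(LINT x|lebesgue. f x * \<phi> x) = (LINT x|lebesgue. g x * \<phi> x)" if \<phi>: "test_function \<phi>" for \<phi>
  proof (rule integral_cong_AE)
    have m: "\<phi> \<in> borel_measurable lebesgue" by (intro borel_lebesgue test_function_borel \<phi>)
    show "(\<lambda>x. f x * \<phi> x) \<in> borel_measurable lebesgue"
      by (intro borel_measurable_times locally_integrable_measurable[OF f] m)
    show "(\<lambda>x. g x * \<phi> x) \<in> borel_measurable lebesgue" by (intro borel_measurable_times g m)
    show "AE x in lebesgue. f x * \<phi> x = g x * \<phi> x" using ae by (rule eventually_mono) simp
  qed
  then show ?thesis using p locally_integrable_cong_AE[OF f ae g] by (simp add: poisson_def)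
qed

lemma mass_cong_AE:
  fixes f g :: "real^2 \<Rightarrow> real"
  assumes "AE y in lebesgue. f y = g y" "f \<in> borel_measurable lebesgue" "g \<in> borel_measurable lebesgue"
  shows "mass f x r = mass g x r"
  unfolding mass_def set_lebesgue_integral_def
proof (rule integral_cong_AE)
  show "(\<lambda>y. indicator (ball x r) y *\<^sub>R f y) \<in> borel_measurable lebesgue"
    "(\<lambda>y. indicator (ball x r) y *\<^sub>R g y) \<in> borel_measurable lebesgue"
    by (intro borel_measurable_scaleR borel_measurable_indicator assms, simp)+
  show "AE y in lebesgue. indicator (ball x r) y *\<^sub>R f y = indicator (ball x r) y *\<^sub>R g y"
    using assms(1) by (rule eventually_mono) simp
qed

lemma exp_minus_lipschitz:
  fixes a b :: real
  assumes "0 \<le> a" "0 \<le> b" shows "\<bar>exp (- a) - exp (- b)\<bar> \<le> \<bar>a - b\<bar>"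
proof -
  have main: "exp (- a) - exp (- b) \<le> b - a" if "0 \<le> a" "a \<le> b" for a b :: real
  proof -
    have "exp (- a) - exp (- b) = exp (- a) * (1 - exp (- (b - a)))"
      by (simp add: right_diff_distrib flip: exp_add)
    also have "\<dots> \<le> 1 * (1 - exp (- (b - a)))" using that by (intro mult_right_mono) simp_all
    also have "\<dots> \<le> b - a" unfolding mult_1 using exp_ge_add_one_self[of "- (b - a)"] by linarith
    finally show ?thesis .
  qed
  show ?thesis
  proof (cases "a \<le> b")
    case True
    then have "exp (- b) \<le> exp (- a)" by simp
    then show ?thesis using main[OF assms(1) True] True by linarith
  next
    case False
    then have "exp (- a) \<le> exp (- b)" by simp
    then show ?thesis using main[OF assms(2), of a] False by linarith
  qed
qed

lemma norm_vec_borel: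
  fixes F :: "'i::finite \<Rightarrow> 'a \<Rightarrow> real"
  assumes "\<And>i. F i \<in> borel_measurable N"
  shows "(\<lambda>x. norm (\<chi> i. F i x)) \<in> borel_measurable N"
proof -
  have "(\<lambda>x. norm (\<chi> i. F i x)) = (\<lambda>x. sqrt (\<Sum>i\<in>UNIV. (F i x)\<^sup>2))"
    by (simp add: norm_vec_def L2_set_def)
  then show ?thesis using assms by simp
qed

lemma norm_matrix_borel:
  fixes F :: "'i::finite \<Rightarrow> 'j::finite \<Rightarrow> 'a \<Rightarrow> real"
  assumes "\<And>i j. F i j \<in> borel_measurable N"
  shows "(\<lambda>x. norm (\<chi> i. \<chi> j. F i j x)) \<in> borel_measurable N"
proof -
  have "(\<lambda>x. norm (\<chi> i. \<chi> j. F i j x)) = (\<lambda>x. sqrt (\<Sum>i\<in>UNIV. \<Sum>j\<in>UNIV. (F i j x)\<^sup>2))"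
    by (simp add: norm_vec_def L2_set_def sum_nonneg)
  then show ?thesis using assms by simp
qed

lemma norm_vec_le:
  fixes v :: "real^2"
  assumes "\<And>i. \<bar>v $ i\<bar> \<le> C" shows "norm v \<le> 2 * C"
proof -
  have "norm v \<le> (\<Sum>i\<in>UNIV. \<bar>v $ i\<bar>)" by (rule norm_le_l1_cart)
  also have "\<dots> \<le> (\<Sum>i\<in>(UNIV::2 set). C)" by (rule sum_mono) (rule assms)
  finally show ?thesis by simp
qed

lemma norm_matrix_le:
  fixes A :: "real^2^2"
  assumes "\<And>i j. \<bar>A $ i $ j\<bar> \<le> C" shows "norm A \<le> 4 * C"
proof -
  have "norm A \<le> (\<Sum>i\<in>UNIV. norm (A $ i))" unfolding norm_vec_def[of A] by (rule L2_set_le_sum) simp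
  also have "\<dots> \<le> (\<Sum>i\<in>(UNIV::2 set). 2 * C)" by (intro sum_mono norm_vec_le assms)
  finally show ?thesis by simp
qed

lemma powr_dyadic_le:
  assumes "1 \<le> R" "2 ^ k \<le> 2 * R" "0 \<le> a" "a \<le> 2"
  shows "(2 ^ k :: real) powr a \<le> 4 * R powr a"
proof -
  have "(2 ^ k :: real) powr a \<le> (2 * R) powr a" using assms by (intro powr_mono2) simp_all
  also have "\<dots> = 2 powr a * R powr a" using assms by (simp add: powr_mult)
  also have "\<dots> \<le> 4 * R powr a"
  proof (rule mult_right_mono)
    have "(2::real) powr a \<le> 2 powr 2" using assms by (intro powr_mono) simp_all
    then show "(2::real) powr a \<le> 4" by (simp add: powr_numeral)
  qed simp
  finally show ?thesis .
qed

lemma holder_seminorm_finite: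
  assumes "holder_seminorm \<alpha> f < \<infinity>"
  obtains C where "0 \<le> C" "\<And>x y. \<bar>f x - f y\<bar> \<le> C * dist x y powr \<alpha>"
proof -
  obtain n :: nat where n: "holder_seminorm \<alpha> f < ereal (real n)"
    using assms less_PInf_Ex_of_nat[of "holder_seminorm \<alpha> f"] by auto
  have "\<bar>f x - f y\<bar> \<le> real n * dist x y powr \<alpha>" for x y
  proof (cases "x = y")
    case False
    have "ereal (\<bar>f x - f y\<bar> / dist x y powr \<alpha>) \<le> holder_seminorm \<alpha> f"
      unfolding holder_seminorm_def by (rule SUP_upper2[of "(x, y)"]) (use False in simp_all)
    then have "ereal (\<bar>f x - f y\<bar> / dist x y powr \<alpha>) \<le> ereal (real n)" using n by (rule order_trans[OF _ less_imp_le])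
    then show ?thesis using False by (simp add: divide_le_eq)
  qed simp
  then show thesis by (rule that[rotated]) simp
qed

theorem theorem1p3:
  fixes K u :: "real^2 \<Rightarrow> real" and lam Lam :: real
  assumes K_meas: "K \<in> borel_measurable lebesgue"
    and lam_pos: "0 < lam"
    and K_bounds: "\<And>x. lam \<le> K x \<and> K x \<le> Lam"
    and sol: "entire_solution K u"
    and bdd: "bdd_above (range u)"
  shows "(\<exists>\<epsilon>>0. \<exists>Du. weak_gradient u Du
            \<and> (\<lambda>R. LINT x:ball 0 R|lebesgue. exp (2 * u x)) \<in> O(\<lambda>R. R powr (2 - \<epsilon>))
            \<and> Linf_ball_bigo u (\<lambda>R. R powr (2 - \<epsilon>))
            \<and> Linf_ball_bigo Du (\<lambda>R. R powr (1 - \<epsilon>\<^sup>2 / 2)))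
       \<and> (\<forall>\<alpha>. 0 < \<alpha> \<and> \<alpha> < 1 \<and> holder_seminorm \<alpha> K < \<infinity> \<longrightarrow>
            (\<exists>D2u. weak_hessian u D2u \<and> Linf_ball_bigo D2u (\<lambda>R. R powr \<alpha> * ln R)))"
proof -
  obtain U where U: "\<And>x. u x \<le> U" using bdd unfolding bdd_above_def by auto
  \<comment> \<open>Distance to an upper bound, so that \<open>\<Delta>w = f\<close>.\<close>
  define w where "w x = U - u x" for x
  define f where "f x = K x * exp (2 * u x)" for x
  define M where "M = Lam * exp (2 * U)"
  have Lam: "0 < Lam" using K_bounds[of 0] lam_pos by linarith
  have K0: "0 \<le> K x" for x using K_bounds[of x] lam_pos by linarith
  have u_li: "locally_integrable u" and f_li: "locally_integrable f"
    using sol unfolding entire_solution_def f_def by simp_all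
  have um: "u \<in> borel_measurable lebesgue" by (rule locally_integrable_measurable[OF u_li])
  have w0: "0 \<le> w y" for y unfolding w_def using U[of y] by simp
  have f0: "0 \<le> f y" for y unfolding f_def using K0 by simp
  have fw: "f y \<le> M * exp (- (2 * w y))" for y
  proof -
    have "M * exp (- (2 * w y)) = Lam * exp (2 * u y)" unfolding M_def w_def by (simp add: mult.assoc flip: exp_add)
    then show ?thesis unfolding f_def using K_bounds[of y] by simp
  qed
  have p: "poisson w f"
  proof -
    have w_locally_integrable: "locally_integrable w"
    proof -
      have "locally_integrable (\<lambda>x. U + - u x)" by (intro locally_integrable_add locally_integrable_const locally_integrable_uminus u_li)
      then show ?thesis by (simp add: w_def[abs_def])
    qed
    have "(LINT x|lebesgue. w x * laplacian \<phi> x) = (LINT x|lebesgue. f x * \<phi> x)" if \<phi>: "test_function \<phi>" for \<phi>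
    proof -
      note t = test_function_laplacian[OF \<phi>]
      have "(LINT x|lebesgue. u x * laplacian \<phi> x) + (LINT x|lebesgue. f x * \<phi> x) = (LINT x|lebesgue. u x * laplacian \<phi> x + f x * \<phi> x)"
        by (intro Bochner_Integration.integral_add[symmetric] integrable_mult_test u_li f_li \<phi> t)
      also have "\<dots> = 0" using sol \<phi> unfolding entire_solution_def f_def by simp
      finally have 1: "(LINT x|lebesgue. u x * laplacian \<phi> x) = - (LINT x|lebesgue. f x * \<phi> x)" by simp
      have "(LINT x|lebesgue. w x * laplacian \<phi> x) = (LINT x|lebesgue. U * laplacian \<phi> x) - (LINT x|lebesgue. u x * laplacian \<phi> x)"
        unfolding w_def left_diff_distrib
        by (intro Bochner_Integration.integral_diff integrable_mult_test locally_integrable_const u_li t)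
      also have "(LINT x|lebesgue. U * laplacian \<phi> x) = 0"
        using green_identity[OF smooth_const[of U] \<phi>] by (simp add: laplacian_def partial_deriv_const)
      finally show ?thesis using 1 by simp
    qed
    then show ?thesis unfolding poisson_def using w_locally_integrable f_li by blast
  qed
  have fM: "f y \<le> M" for y by (rule density_le_bound[OF p w0 f0 fw])
  obtain \<epsilon> B where \<epsilon>: "0 < \<epsilon>" "\<epsilon> \<le> 1/2" and B: "0 < B" and growth: "\<And>x \<rho>. 0 < \<rho> \<Longrightarrow> mass f x \<rho> \<le> B * \<rho> powr (2 - \<epsilon>)"
    using mass_decay[OF p w0 f0 fw] by auto
  interpret poisson_growth w f M B \<epsilon>
    by unfold_locales (use p w0 f0 fM \<epsilon> B growth in simp_all)
  define Du :: "real^2 \<Rightarrow> real^2" where "Du x = (\<chi> i. - precise_grad i x)" for x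
  have wg: "weak_gradient u Du"
    unfolding weak_gradient_def
  proof
    fix i
    have "weak_partial i (\<lambda>x. U - w x) (\<lambda>x. - precise_grad i x)"
      by (rule weak_partial_const_minus[OF weak_partial_precise_grad])
    then show "weak_partial i u (\<lambda>x. Du x $ i)" by (simp add: w_def Du_def)
  qed
  have exp_growth: "(\<lambda>R. LINT x:ball 0 R|lebesgue. exp (2 * u x)) \<in> O(\<lambda>R. R powr (2 - \<epsilon>))"
  proof (rule bigoI[where c = "B / lam"])
    have e_li: "locally_integrable (\<lambda>x. exp (2 * u x))"
    proof (rule locally_bounded_integrable)
      show "(\<lambda>x. exp (2 * u x)) \<in> borel_measurable lebesgue" using um by simp
      show "\<exists>C. \<forall>x. norm x \<le> R \<longrightarrow> \<bar>exp (2 * u x)\<bar> \<le> C" for R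
        using U by (intro exI[of _ "exp (2 * U)"]) simp
    qed
    show "\<forall>\<^sub>F R in at_top. norm (LINT x:ball 0 R|lebesgue. exp (2 * u x)) \<le> B / lam * norm (R powr (2 - \<epsilon>))"
      using eventually_gt_at_top[of 0]
    proof (rule eventually_mono)
      fix R :: real assume R: "0 < R"
      let ?I = "LINT x:ball 0 R|lebesgue. exp (2 * u x)"
      have nn: "0 \<le> ?I" using mass_nonneg[of "\<lambda>x. exp (2 * u x)" 0 R] by (simp add: mass_def)
      have "lam * ?I = (LINT x:ball 0 R|lebesgue. lam * exp (2 * u x))" by simp
      also have "\<dots> \<le> mass f 0 R" unfolding mass_def
      proof (rule set_integral_mono)
        show "set_integrable lebesgue (ball 0 R) (\<lambda>x. lam * exp (2 * u x))"
          by (intro locally_integrable_ball locally_integrable_cmult e_li)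
        show "set_integrable lebesgue (ball 0 R) f" by (rule locally_integrable_ball[OF f_li])
        show "lam * exp (2 * u x) \<le> f x" for x unfolding f_def using K_bounds[of x] by simp
      qed
      also have "\<dots> \<le> B * R powr (2 - \<epsilon>)" by (rule growth[OF R])
      finally have "?I \<le> B / lam * R powr (2 - \<epsilon>)" using lam_pos by (simp add: field_simps)
      then show "norm ?I \<le> B / lam * norm (R powr (2 - \<epsilon>))" using nn by simp
    qed
  qed
  have u_bound: "Linf_ball_bigo u (\<lambda>R. R powr (2 - \<epsilon>))"
  proof -
    obtain C where C: "0 < C" "\<And>k x n. norm x \<le> 2 ^ k \<Longrightarrow> mean (1 / 2 ^ n) w x \<le> C * (2 ^ k) powr (2 - \<epsilon>)"
      using dyadic_mean_growth by blast
    have prec: "precise x \<le> C * (2 ^ k) powr (2 - \<epsilon>)" if "norm x \<le> 2 ^ k" for k x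
      by (rule LIMSEQ_upper_bound[OF tendsto_precise]) (rule C(2)[OF that])
    show ?thesis
    proof (rule Linf_ball_bigoI[where ?R0.0 = 1 and C = "\<bar>U\<bar> + 4 * C"])
      show "(\<lambda>x. norm (u x)) \<in> borel_measurable lebesgue" using um by simp
      fix R :: real assume R: "1 \<le> R"
      obtain k where k: "R \<le> 2 ^ k" "2 ^ k \<le> 2 * R" using ex_comparable_dyadic[OF R] by blast
      have R1: "1 \<le> R powr (2 - \<epsilon>)" using R \<epsilon> by (intro ge_one_powr_ge_zero) simp_all
      show "AE x in lebesgue. norm x < R \<longrightarrow> norm (u x) \<le> (\<bar>U\<bar> + 4 * C) * R powr (2 - \<epsilon>)"
        using AE_precise
      proof (rule eventually_mono, intro impI)
        fix x assume x: "w x = precise x" "norm x < R"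
        have "w x \<le> C * (2 ^ k) powr (2 - \<epsilon>)" unfolding x(1) by (rule prec) (use x(2) k(1) in linarith)
        also have "\<dots> \<le> C * (4 * R powr (2 - \<epsilon>))"
          using C(1) R k(2) \<epsilon> by (intro mult_left_mono powr_dyadic_le) simp_all
        finally have "w x \<le> 4 * C * R powr (2 - \<epsilon>)" by simp
        moreover have "\<bar>u x\<bar> \<le> \<bar>U\<bar> + w x" unfolding w_def using U[of x] by linarith
        moreover have "\<bar>U\<bar> * 1 \<le> \<bar>U\<bar> * R powr (2 - \<epsilon>)" by (intro mult_left_mono R1) simp
        ultimately show "norm (u x) \<le> (\<bar>U\<bar> + 4 * C) * R powr (2 - \<epsilon>)" by (simp add: distrib_right)
      qed
    qed
  qed
  have Du_bound: "Linf_ball_bigo Du (\<lambda>R. R powr (1 - \<epsilon>\<^sup>2 / 2))"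
  proof -
    obtain C where C: "0 < C" "\<And>k x i. norm x \<le> 2 ^ k \<Longrightarrow> \<bar>precise_grad i x\<bar> \<le> C * (2 ^ k) powr (1 - \<epsilon>)"
      using precise_grad_growth by blast
    show ?thesis
    proof (rule Linf_ball_bigoI[where ?R0.0 = 1 and C = "8 * C"])
      show "(\<lambda>x. norm (Du x)) \<in> borel_measurable lebesgue"
        unfolding Du_def by (rule norm_vec_borel) (use borel_lebesgue[OF precise_grad_measurable] in simp)
      fix R :: real assume R: "1 \<le> R"
      obtain k where k: "R \<le> 2 ^ k" "2 ^ k \<le> 2 * R" using ex_comparable_dyadic[OF R] by blast
      have "norm (Du x) \<le> 8 * C * R powr (1 - \<epsilon>\<^sup>2 / 2)" if x: "norm x < R" for x
      proof -
        have "norm (Du x) \<le> 2 * (C * (2 ^ k) powr (1 - \<epsilon>))"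
        proof (rule norm_vec_le)
          have "norm x \<le> 2 ^ k" using x k(1) by linarith
          then show "\<bar>Du x $ i\<bar> \<le> C * (2 ^ k) powr (1 - \<epsilon>)" for i using C(2)[of x k i] by (simp add: Du_def)
        qed
        also have "\<dots> \<le> 2 * (C * (4 * R powr (1 - \<epsilon>)))"
          using C(1) R k(2) \<epsilon> by (intro mult_left_mono powr_dyadic_le) simp_all
        also have "\<dots> \<le> 2 * (C * (4 * R powr (1 - \<epsilon>\<^sup>2 / 2)))"
        proof (intro mult_left_mono powr_mono)
          \<comment> \<open>The gradient bound with exponent \<open>1 - \<epsilon>\<close> is stronger than claimed.\<close>
          have "\<epsilon> * \<epsilon> \<le> 1 * \<epsilon>" using \<epsilon> by (intro mult_right_mono) simp_all
          then show "1 - \<epsilon> \<le> 1 - \<epsilon>\<^sup>2 / 2" using \<epsilon> by (simp add: power2_eq_square)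
        qed (use C(1) R in simp_all)
        finally show ?thesis by simp
      qed
      then show "AE x in lebesgue. norm x < R \<longrightarrow> norm (Du x) \<le> 8 * C * R powr (1 - \<epsilon>\<^sup>2 / 2)" by simp
    qed
  qed
  have second: "\<exists>D2u. weak_hessian u D2u \<and> Linf_ball_bigo D2u (\<lambda>R. R powr \<alpha> * ln R)"
    if \<alpha>: "0 < \<alpha>" "\<alpha> < 1" and hK: "holder_seminorm \<alpha> K < \<infinity>" for \<alpha>
  proof -
    obtain CK where CK: "0 \<le> CK" "\<And>x y. \<bar>K x - K y\<bar> \<le> CK * dist x y powr \<alpha>"
      using holder_seminorm_finite[OF hK] by blast
    obtain CL where CL: "0 < CL" "\<And>k x y. norm x \<le> 2 ^ k \<Longrightarrow> norm y \<le> 2 ^ k \<Longrightarrow> \<bar>precise x - precise y\<bar> \<le> CL * 2 ^ k * norm (x - y)"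
      using precise_lipschitz by blast
    \<comment> \<open>The representative of \<open>f\<close> formed with the continuous representative of \<open>w\<close>; its
      continuity holds at all points and not only almost everywhere.\<close>
    define g where "g x = K x * exp (2 * U) * exp (- (2 * precise x))" for x
    define H where "H = exp (2 * U) * (CK + 2 * Lam * CL)"
    have prec_m: "precise \<in> borel_measurable lebesgue"
      by (rule borel_measurable_LIMSEQ_real[OF tendsto_precise]) (intro borel_lebesgue smooth_borel smooth_dyadic_mean)
    have gm: "g \<in> borel_measurable lebesgue" unfolding g_def[abs_def] using K_meas prec_m by simp
    have fg: "AE x in lebesgue. f x = g x"
      using AE_precise
    proof (rule eventually_mono)
      fix x assume x: "w x = precise x"
      show "f x = g x" unfolding f_def g_def x[symmetric] w_def by (simp add: mult.assoc flip: exp_add)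
    qed
    have e1: "exp (- (2 * precise x)) \<le> 1" for x using precise_nonneg[of x] by simp
    have g0: "0 \<le> g x" for x unfolding g_def using K0 by simp
    have gM: "g x \<le> M" for x
    proof -
      have "K x * exp (2 * U) * exp (- (2 * precise x)) \<le> K x * exp (2 * U) * 1"
        using K0[of x] by (intro mult_left_mono e1) simp
      also have "\<dots> \<le> M" unfolding M_def using K_bounds[of x] by simp
      finally show ?thesis unfolding g_def .
    qed
    have g_growth: "mass g x \<rho> \<le> B * \<rho> powr (2 - \<epsilon>)" if "0 < \<rho>" for x \<rho>
      using growth[OF that, of x] mass_cong_AE[OF fg locally_integrable_measurable[OF f_li] gm, of x \<rho>] by simp
    have holder: "\<bar>g y - g x\<bar> \<le> H * (norm (x - y) powr \<alpha> + 2 ^ k * norm (x - y))"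
      if x: "norm x \<le> 2 ^ k" and y: "norm y \<le> 2 ^ k" for k x y
    proof -
      let ?e = "\<lambda>x. exp (- (2 * precise x))" and ?d = "norm (x - y)"
      have "g y - g x = exp (2 * U) * ((K y - K x) * ?e y + K x * (?e y - ?e x))"
        unfolding g_def by (simp add: algebra_simps)
      then have "\<bar>g y - g x\<bar> = exp (2 * U) * \<bar>(K y - K x) * ?e y + K x * (?e y - ?e x)\<bar>" by (simp add: abs_mult)
      also have "\<dots> \<le> exp (2 * U) * (\<bar>(K y - K x) * ?e y\<bar> + \<bar>K x * (?e y - ?e x)\<bar>)"
        by (intro mult_left_mono abs_triangle_ineq) simp
      also have "\<dots> \<le> exp (2 * U) * (CK * ?d powr \<alpha> + Lam * (2 * (CL * 2 ^ k * ?d)))"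
      proof (intro mult_left_mono add_mono)
        have "\<bar>K y - K x\<bar> * ?e y \<le> (CK * ?d powr \<alpha>) * 1"
          using CK(2)[of y x] e1[of y] CK(1) by (intro mult_mono) (simp_all add: dist_norm norm_minus_commute)
        then show "\<bar>(K y - K x) * ?e y\<bar> \<le> CK * ?d powr \<alpha>" by (simp add: abs_mult)
        have "\<bar>?e y - ?e x\<bar> \<le> \<bar>2 * precise y - 2 * precise x\<bar>"
          by (rule exp_minus_lipschitz) (use precise_nonneg in simp_all)
        also have "\<dots> \<le> 2 * (CL * 2 ^ k * ?d)" using CL(2)[OF x y] by linarith
        finally have "\<bar>K x\<bar> * \<bar>?e y - ?e x\<bar> \<le> Lam * (2 * (CL * 2 ^ k * ?d))"
          using K0[of x] K_bounds[of x] Lam by (intro mult_mono) simp_all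
        then show "\<bar>K x * (?e y - ?e x)\<bar> \<le> Lam * (2 * (CL * 2 ^ k * ?d))" by (simp add: abs_mult)
      qed simp
      also have "\<dots> \<le> H * (?d powr \<alpha> + 2 ^ k * ?d)"
      proof -
        have "0 \<le> exp (2 * U) * CK * (2 ^ k * ?d)" "0 \<le> exp (2 * U) * (2 * Lam * CL) * ?d powr \<alpha>"
          using CK(1) CL(1) Lam by simp_all
        then show ?thesis unfolding H_def by (simp add: algebra_simps)
      qed
      finally show ?thesis .
    qed
    have H0: "0 \<le> H" unfolding H_def using CK(1) CL(1) Lam by simp
    interpret hold: poisson_holder w g M B \<epsilon> \<alpha> H
      by unfold_locales
        (use poisson_cong_AE[OF p fg gm] w0 g0 gM \<epsilon> B g_growth \<alpha> H0 holder in simp_all)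
    define D2u :: "real^2 \<Rightarrow> real^2^2" where "D2u x = (\<chi> i. \<chi> l. - hold.precise_hess l i x)" for x
    have "weak_hessian u D2u"
      unfolding weak_hessian_def
    proof (intro exI[of _ Du] conjI wg allI)
      fix i
      show "weak_gradient (\<lambda>x. Du x $ i) (\<lambda>x. D2u x $ i)"
        unfolding weak_gradient_def
      proof
        fix l
        have "weak_partial l (\<lambda>x. 0 - precise_grad i x) (\<lambda>x. - hold.precise_hess l i x)"
          by (rule weak_partial_const_minus[OF hold.weak_partial_precise_hess])
        then show "weak_partial l (\<lambda>x. Du x $ i) (\<lambda>x. D2u x $ i $ l)" by (simp add: Du_def D2u_def)
      qed
    qed
    moreover have "Linf_ball_bigo D2u (\<lambda>R. R powr \<alpha> * ln R)"
    proof -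
      obtain C where C: "0 < C" "\<And>k x l i. norm x \<le> 2 ^ k \<Longrightarrow> \<bar>hold.precise_hess l i x\<bar> \<le> C * (1 + real k)"
        using hold.precise_hess_growth by blast
      show ?thesis
      proof (rule Linf_ball_bigoI[where ?R0.0 = "exp 1" and C = "20 * C"])
        show "(\<lambda>x. norm (D2u x)) \<in> borel_measurable lebesgue"
          unfolding D2u_def by (rule norm_matrix_borel) (use borel_lebesgue[OF hold.precise_hess_measurable] in simp)
        fix R :: real assume Re: "exp 1 \<le> R"
        have R: "1 \<le> R" using Re exp_ge_add_one_self[of "1::real"] by linarith
        have lnR: "1 \<le> ln R" using Re R by (simp add: ln_ge_iff)
        obtain k where k: "R \<le> 2 ^ k" "2 ^ k \<le> 2 * R" using ex_comparable_dyadic[OF R] by blast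
        \<comment> \<open>As \<open>2^k \<le> 2 R\<close>, \<open>ln 2 \<ge> 1/2\<close> and \<open>ln R \<ge> 1\<close>.\<close>
        have kR: "1 + real k \<le> 5 * ln R"
        proof -
          have "ln (2 ^ k) \<le> ln (2 * R)" using k(2) R by simp
          then have "real k * ln 2 \<le> ln 2 + ln R" using R by (simp add: ln_realpow ln_mult)
          moreover have "real k * (1/2) \<le> real k * ln 2"
          proof (rule mult_left_mono)
            have "exp (1/2 :: real) \<le> 2"
            proof (rule power2_le_imp_le)
              have "(exp (1/2 :: real))\<^sup>2 = exp 1" by (simp add: power2_eq_square flip: exp_add)
              also have "\<dots> \<le> 2\<^sup>2" using exp_le by simp
              finally show "(exp (1/2 :: real))\<^sup>2 \<le> 2\<^sup>2" .
            qed simp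
            then show "1/2 \<le> ln (2::real)" by (subst ln_ge_iff) simp_all
          qed simp
          moreover have "ln (2::real) \<le> 1" using ln_le_minus_one[of "2::real"] by simp
          ultimately show ?thesis using lnR by linarith
        qed
        have "norm (D2u x) \<le> 20 * C * (R powr \<alpha> * ln R)" if x: "norm x < R" for x
        proof -
          have "norm (D2u x) \<le> 4 * (C * (1 + real k))"
          proof (rule norm_matrix_le)
            have "norm x \<le> 2 ^ k" using x k(1) by linarith
            then show "\<bar>D2u x $ i $ l\<bar> \<le> C * (1 + real k)" for i l using C(2)[of x k l i] by (simp add: D2u_def)
          qed
          also have "\<dots> \<le> 4 * (C * (5 * ln R))" using C(1) kR by (intro mult_left_mono) simp_all
          also have "\<dots> = 20 * C * (1 * ln R)" by simp
          also have "\<dots> \<le> 20 * C * (R powr \<alpha> * ln R)"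
            using C(1) lnR R \<alpha> by (intro mult_left_mono mult_right_mono ge_one_powr_ge_zero) simp_all
          finally show ?thesis .
        qed
        then show "AE x in lebesgue. norm x < R \<longrightarrow> norm (D2u x) \<le> 20 * C * (R powr \<alpha> * ln R)" by simp
      qed
    qed
    ultimately show ?thesis by blast
  qed
  show ?thesis
    using \<epsilon>(1) wg exp_growth u_bound Du_bound second by blast
qed

end
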